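(* Let $p$ be a prime and let $f\in\mathcal A$, with $n\ge0$ an integer such that $p^nf\in\mathcal B$. There is an integer $R$, depending only on $p$ and $n$, such that for every $y\in\mathbb Z_p$ and every integer $r\ge R$ the following holds: $f$ is ergodic on the sphere $S_{p^{-r}}(y)$ if and only if one of the following alternatives holds: (1) $p$ is odd, and simultaneously $f(y)\equiv y\pmod{p^{r+1}}$ and $f'(y)$ generates the whole group of units $(\mathbb Z/p^2\mathbb Z)^\ast$ modulo $p^2$; (2) $p=2$, and simultaneously $f(y)\equiv y\pmod{2^{r+1}}$, $f(y)\not\equiv y\pmod{2^{r+2}}$, and $f'(y)\equiv1\pmod4$.
   Context: $\mathcal B$ is the class of functions $g\colon\mathbb Z_p\to\mathbb Z_p$ of the form $g(x)=\sum_{i=0}^\infty a_i\binom{x}{i}$ with $\frac{a_i}{i!}\in\mathbb Z_p$ for all $i$. $\mathcal A$ is the class of functions $f\colon\mathbb Z_p\to\mathbb Z_p$ that are compatible (i.e. $\|f(x)-f(y)\|_p\le\|x-y\|_p$ for all $x,y\in\mathbb Z_p$) and satisfy $p^nf\in\mathcal B$ for some integer $n\ge0$. Functions in $\mathcal A$ are differentiable and, by compatibility, $f'$ takes values in $\mathbb Z_p$. $S_{p^{-r}}(y)=\{z\in\mathbb Z_p:\|z-y\|_p=p^{-r}\}$. $\hat\mu_p$ is the restriction to the sphere of the Haar measure on $\mathbb Z_p$, normalized so that the sphere has measure $1$. A function $f$ is ergodic on $S_{p^{-r}}(y)$ if $f(S_{p^{-r}}(y))\subset S_{p^{-r}}(y)$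 and the restriction of $f$ to the sphere is $\hat\mu_p$-preserving and ergodic with respect to $\hat\mu_p$ (every measurable $A\subset S_{p^{-r}}(y)$ whose preimage under the restriction is $A$ has $\hat\mu_p(A)\in\{0,1\}$). *)

theory Defs
  imports
    "HOL-Probability.Probability"
    "HOL-Algebra.Generated_Groups"
    "HOL-Number_Theory.Residues"
    "Berlekamp_Zassenhaus.Finite_Field"
begin

section \<open>The ring of \<open>p\<close>-adic integers\<close>

text \<open>
  The prime \<open>p\<close> is the cardinality of a type \<open>'p\<close> of class \<open>prime_card\<close>, and \<open>\<int>\<^sub>p\<close> is the inverse limit
  of the rings \<open>\<int>/p\<^sup>k\<int>\<close>, each represented by \<open>{0..<p\<^sup>k}\<close>.
\<close>

typedef (overloaded) ('p::prime_card) padic_int =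
  "{x :: nat \<Rightarrow> int. \<forall>k. 0 \<le> x k \<and> x k < int CARD('p) ^ k \<and> x (Suc k) mod int CARD('p) ^ k = x k}"
  morphisms padic_residue_seq Abs_padic_int
  by (rule exI[of _ "\<lambda>_. 0"]) (auto simp: prime_gt_0_nat[OF prime_card])

setup_lifting type_definition_padic_int

lemma CARD_prime_int: "prime (int CARD('p::prime_card))"
  by (simp add: prime_card)

lemma CARD_pos_int [simp]: "0 < int CARD('p::prime_card)"
  by (simp add: prime_card prime_gt_0_nat)

lemma CARD_power_pos [simp]: "0 < int CARD('p::prime_card) ^ k"
  by (rule zero_less_power) simp

lift_definition padic_residue :: "nat \<Rightarrow> 'p::prime_card padic_int \<Rightarrow> int" is "\<lambda>k x. x k" .

lemma mod_power_Suc_mod: "(a mod int CARD('p::prime_card) ^ Suc k) mod int CARD('p) ^ k = a mod int CARD('p) ^ k"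
  by (simp add: mod_mod_cancel)

lemma padic_seqI:
  assumes "a' mod int CARD('p::prime_card) ^ k = a mod int CARD('p) ^ k"
  shows "0 \<le> a mod int CARD('p) ^ k \<and> a mod int CARD('p) ^ k < int CARD('p) ^ k \<and>
    a' mod int CARD('p) ^ Suc k mod int CARD('p) ^ k = a mod int CARD('p) ^ k"
  using assms unfolding mod_power_Suc_mod by simp

instantiation padic_int :: (prime_card) comm_ring_1
begin

lift_definition zero_padic_int :: "'a padic_int" is "\<lambda>_. 0" by simp

lift_definition one_padic_int :: "'a padic_int" is "\<lambda>k. 1 mod int CARD('a) ^ k"
  by (rule padic_seqI) (rule refl)

lift_definition plus_padic_int :: "'a padic_int \<Rightarrow> 'a padic_int \<Rightarrow> 'a padic_int"
  is "\<lambda>x y k. (x k + y k) mod int CARD('a) ^ k"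
  by (rule padic_seqI) (metis mod_add_eq)

lift_definition times_padic_int :: "'a padic_int \<Rightarrow> 'a padic_int \<Rightarrow> 'a padic_int"
  is "\<lambda>x y k. (x k * y k) mod int CARD('a) ^ k"
  by (rule padic_seqI) (metis mod_mult_eq)

lift_definition minus_padic_int :: "'a padic_int \<Rightarrow> 'a padic_int \<Rightarrow> 'a padic_int"
  is "\<lambda>x y k. (x k - y k) mod int CARD('a) ^ k"
  by (rule padic_seqI) (metis mod_diff_eq)

lift_definition uminus_padic_int :: "'a padic_int \<Rightarrow> 'a padic_int"
  is "\<lambda>x k. (- x k) mod int CARD('a) ^ k"
  by (rule padic_seqI) (metis mod_minus_eq)

instance
proof
  fix a b c :: "'a padic_int"
  show "a + b + c = a + (b + c)"
    by transfer (auto simp: fun_eq_iff mod_simps add.assoc)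
  show "a * b * c = a * (b * c)"
    by transfer (auto simp: fun_eq_iff mod_simps mult.assoc)
  show "a + b = b + a"
    by transfer (auto simp: fun_eq_iff add.commute)
  show "a * b = b * a"
    by transfer (auto simp: fun_eq_iff mult.commute)
  show "0 + a = a"
    by transfer auto
  show "1 * a = a"
    by transfer (auto simp: fun_eq_iff mod_simps)
  show "- a + a = 0"
    by transfer (auto simp: fun_eq_iff mod_simps)
  show "a - b = a + - b"
    by transfer (auto simp: fun_eq_iff mod_simps)
  show "(a + b) * c = a * c + b * c"
    by transfer (auto simp: fun_eq_iff mod_simps algebra_simps)
  show "(0::'a padic_int) \<noteq> 1"
  proof
    assume "(0::'a padic_int) = 1"
    then have "(0::int) = 1 mod int CARD('a) ^ 1"
      by transfer metis
    moreover have "1 < int CARD('a)"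
      using prime_gt_1_int[OF CARD_prime_int] .
    ultimately show False by simp
  qed
qed

end

lemma padic_residue_bounds [simp]:
  "0 \<le> padic_residue k x" "padic_residue k (x :: 'p::prime_card padic_int) < int CARD('p) ^ k"
  by (transfer, blast)+

lemma padic_residue_Suc_mod:
  "padic_residue (Suc k) (x :: 'p::prime_card padic_int) mod int CARD('p) ^ k = padic_residue k x"
  by transfer blast

lemma padic_residue_mod:
  assumes "k \<le> n"
  shows "padic_residue n (x :: 'p::prime_card padic_int) mod int CARD('p) ^ k = padic_residue k x"
  using assms
proof (induction n rule: dec_induct)
  case base
  show ?case by simp
next
  case (step n)
  have "padic_residue (Suc n) x mod int CARD('p) ^ k =
      padic_residue (Suc n) x mod int CARD('p) ^ n mod int CARD('p) ^ k"
    using step.hyps by (simp add: mod_mod_cancel le_imp_power_dvd)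
  with step.IH show ?case by (simp add: padic_residue_Suc_mod)
qed

lemma padic_int_eqI: "(\<And>k. padic_residue k x = padic_residue k y) \<Longrightarrow> x = y"
  by transfer auto

lemma padic_residue_0 [simp]: "padic_residue k 0 = 0"
  by transfer simp

lemma padic_residue_add:
  "padic_residue k (x + y :: 'p::prime_card padic_int) = (padic_residue k x + padic_residue k y) mod int CARD('p) ^ k"
  by transfer simp

lemma padic_residue_mult:
  "padic_residue k (x * y :: 'p::prime_card padic_int) = (padic_residue k x * padic_residue k y) mod int CARD('p) ^ k"
  by transfer simp

lemma padic_residue_diff:
  "padic_residue k (x - y :: 'p::prime_card padic_int) = (padic_residue k x - padic_residue k y) mod int CARD('p) ^ k"
  by transfer simp

lemma padic_residue_of_nat:
  "padic_residue k (of_nat n :: 'p::prime_card padic_int) = int n mod int CARD('p) ^ k"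
proof (induction n)
  case (Suc n)
  have "padic_residue k (1 :: 'p padic_int) = 1 mod int CARD('p) ^ k"
    by transfer simp
  with Suc show ?case by (simp add: padic_residue_add mod_simps)
qed simp

lemma padic_residue_eq_0_mono:
  assumes "padic_residue n (x :: 'p::prime_card padic_int) = 0" "k \<le> n"
  shows "padic_residue k x = 0"
  using padic_residue_mod[OF assms(2), of x] assms(1) by simp

lemma padic_residue_dvd_iff:
  assumes "k \<le> n"
  shows "int CARD('p) ^ k dvd padic_residue n (x :: 'p::prime_card padic_int) \<longleftrightarrow> padic_residue k x = 0"
  using padic_residue_mod[OF assms, of x] by (metis dvd_eq_mod_eq_0)

lemma padic_int_nonzeroD: "x \<noteq> 0 \<Longrightarrow> \<exists>k. padic_residue (Suc k) (x :: 'p::prime_card padic_int) \<noteq> 0"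
  by (metis padic_int_eqI padic_residue_0 padic_residue_eq_0_mono le_SucI order_refl)

text \<open>\<open>x div y\<close> is the quotient if it lies in \<open>\<int>\<^sub>p\<close>, and \<open>0\<close> otherwise.\<close>

instantiation padic_int :: (prime_card) idom_divide
begin

definition divide_padic_int :: "'a padic_int \<Rightarrow> 'a padic_int \<Rightarrow> 'a padic_int" where
  "divide_padic_int x y = (if y \<noteq> 0 \<and> y dvd x then THE z. x = z * y else 0)"

instance
proof
  fix a b :: "'a padic_int"
  show no_zero_div: "a * b \<noteq> 0" if "a \<noteq> 0" "b \<noteq> 0" for a b :: "'a padic_int"
  proof
    assume ab: "a * b = 0"
    obtain i where i: "padic_residue (Suc i) a \<noteq> 0" using padic_int_nonzeroD[OF \<open>a \<noteq> 0\<close>] by blast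
    obtain j where j: "padic_residue (Suc j) b \<noteq> 0" using padic_int_nonzeroD[OF \<open>b \<noteq> 0\<close>] by blast
    define n where "n = Suc (i + j)"
    have "padic_residue n (a * b) = 0" using ab by simp
    then have "int CARD('a) ^ n dvd padic_residue n a * padic_residue n b"
      by (simp add: padic_residue_mult dvd_eq_mod_eq_0)
    then obtain k l where kl: "k + l = n" "int CARD('a) ^ k dvd padic_residue n a"
        "int CARD('a) ^ l dvd padic_residue n b"
      using prime_elem_power_dvd_prod[OF _ prime_imp_prime_elem[OF CARD_prime_int[where 'p = 'a]]] by blast
    have "padic_residue k a = 0" "padic_residue l b = 0"
      using kl by (simp_all add: padic_residue_dvd_iff)
    moreover have "Suc i \<le> k \<or> Suc j \<le> l" using kl(1) n_def by linarith
    ultimately show False using i j padic_residue_eq_0_mono by blast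
  qed
  show "(a * b) div b = a" if "b \<noteq> 0"
  proof -
    have "(THE z. a * b = z * b) = a"
    proof (rule the_equality)
      fix z assume "a * b = z * b"
      then have "(a - z) * b = 0" by (simp add: algebra_simps)
      then show "z = a" using no_zero_div[of "a - z" b] that by auto
    qed simp
    with that show ?thesis by (simp add: divide_padic_int_def)
  qed
  show "a div 0 = 0" by (simp add: divide_padic_int_def)
qed

end

instance padic_int :: (prime_card) semiring_char_0
proof
  show "inj (of_nat :: nat \<Rightarrow> 'a padic_int)"
  proof (rule injI)
    fix m n :: nat
    assume eq: "(of_nat m :: 'a padic_int) = of_nat n"
    define k where "k = m + n"
    have p2: "2 \<le> CARD('a)" using prime_ge_2_nat[OF prime_card] .
    have "m + n < 2 ^ k" unfolding k_def by (rule less_exp)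
    also have "(2::nat) ^ k \<le> CARD('a) ^ k" using p2 by (rule power_mono) simp
    finally have lt: "m + n < CARD('a) ^ k" .
    then have lt': "int m < int CARD('a) ^ k" "int n < int CARD('a) ^ k"
      by (metis add_lessD1 of_nat_less_iff of_nat_power, metis add.commute add_lessD1 of_nat_less_iff of_nat_power)
    from eq have "int m mod int CARD('a) ^ k = int n mod int CARD('a) ^ k"
      by (metis padic_residue_of_nat)
    with lt' show "m = n" by simp
  qed
qed


section \<open>The \<open>p\<close>-adic norm\<close>

definition padic_val :: "'p::prime_card padic_int \<Rightarrow> nat" where
  "padic_val x = (LEAST k. padic_residue (Suc k) x \<noteq> 0)"

lemma padic_residue_eq_0_iff:
  assumes "x \<noteq> 0"
  shows "padic_residue k (x :: 'p::prime_card padic_int) = 0 \<longleftrightarrow> k \<le> padic_val x"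
proof
  assume k: "padic_residue k x = 0"
  show "k \<le> padic_val x"
  proof (rule ccontr)
    assume "\<not> ?thesis"
    then have "Suc (padic_val x) \<le> k" by simp
    then have "padic_residue (Suc (padic_val x)) x = 0" using k padic_residue_eq_0_mono by blast
    moreover have "padic_residue (Suc (padic_val x)) x \<noteq> 0"
      unfolding padic_val_def by (rule LeastI_ex) (rule padic_int_nonzeroD[OF assms])
    ultimately show False by simp
  qed
next
  assume k: "k \<le> padic_val x"
  show "padic_residue k x = 0"
  proof (cases k)
    case 0
    have "padic_residue 0 x < int CARD('p) ^ 0" by (rule padic_residue_bounds)
    with 0 show ?thesis using padic_residue_bounds(1)[of 0 x] by (simp del: padic_residue_bounds)
  next
    case (Suc l)
    then show ?thesis using k not_less_Least[of l "\<lambda>k. padic_residue (Suc k) x \<noteq> 0"]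
      by (auto simp: padic_val_def)
  qed
qed

definition padic_norm :: "'p::prime_card padic_int \<Rightarrow> real" where
  "padic_norm x = (if x = 0 then 0 else 1 / real CARD('p) ^ padic_val x)"

lemma padic_norm_le_iff:
  "padic_norm (x :: 'p::prime_card padic_int) \<le> 1 / real CARD('p) ^ k \<longleftrightarrow> padic_residue k x = 0"
proof (cases "x = 0")
  case False
  have "1 < real CARD('p)"
    using prime_gt_1_nat[OF prime_card[where 'a = 'p]] by simp
  then show ?thesis
    using False by (simp add: padic_norm_def padic_residue_eq_0_iff field_simps)
qed (simp add: padic_norm_def)

instantiation padic_int :: (prime_card) metric_space
begin

definition dist_padic_int :: "'a padic_int \<Rightarrow> 'a padic_int \<Rightarrow> real" where
  "dist_padic_int x y = padic_norm (x - y)"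

definition uniformity_padic_int :: "('a padic_int \<times> 'a padic_int) filter" where
  "uniformity_padic_int = (INF e\<in>{0<..}. principal {(x, y). dist x y < e})"

definition open_padic_int :: "'a padic_int set \<Rightarrow> bool" where
  "open_padic_int U \<longleftrightarrow> (\<forall>x\<in>U. eventually (\<lambda>(x', y). x' = x \<longrightarrow> y \<in> U) uniformity)"

instance
proof
  fix x y z :: "'a padic_int"
  have p1: "1 < real CARD('a)"
    using prime_gt_1_nat[OF prime_card[where 'a = 'a]] by simp
  have pos: "0 \<le> padic_norm w" for w :: "'a padic_int"
    by (simp add: padic_norm_def)
  show "dist x y = 0 \<longleftrightarrow> x = y"
    using p1 by (auto simp: dist_padic_int_def padic_norm_def)
  have ultra: "padic_norm (u - v) \<le> max (padic_norm u) (padic_norm v)" for u v :: "'a padic_int"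
  proof -
    have *: "padic_norm (u - v) \<le> padic_norm w"
      if "w \<noteq> 0" "padic_norm u \<le> padic_norm w" "padic_norm v \<le> padic_norm w" for w :: "'a padic_int"
    proof -
      have w: "padic_norm w = 1 / real CARD('a) ^ padic_val w"
        using that(1) by (simp add: padic_norm_def)
      show ?thesis using that(2,3) unfolding w padic_norm_le_iff by (simp add: padic_residue_diff)
    qed
    show ?thesis
    proof (cases "u = 0 \<and> v = 0")
      case False
      have n0: "padic_norm w = 0 \<longleftrightarrow> w = 0" for w :: "'a padic_int"
        using p1 by (simp add: padic_norm_def)
      show ?thesis
      proof (cases "padic_norm u \<le> padic_norm v")
        case True
        then have "v \<noteq> 0" using False pos[of u] n0[of u] n0[of v] by force
        then show ?thesis using *[of v] True by simp
      next
        case F: False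
        then have "u \<noteq> 0" using False pos[of v] n0[of u] n0[of v] by force
        then show ?thesis using *[of u] F by simp
      qed
    qed (simp add: padic_norm_def)
  qed
  show "dist x y \<le> dist x z + dist y z"
    using ultra[of "x - z" "y - z"] pos[of "x - z"] pos[of "y - z"] by (simp add: dist_padic_int_def)
qed (simp_all add: uniformity_padic_int_def open_padic_int_def)

end



section \<open>The function classes\<close>

lemma padic_residue_1: "padic_residue k (1 :: 'p::prime_card padic_int) = 1 mod int CARD('p) ^ k"
  by transfer simp

lemma padic_residue_falling_fact:
  assumes "k \<le> l"
  shows "padic_residue k (\<Prod>j=0..<i. x - of_nat j :: 'p::prime_card padic_int) =
    (\<Prod>j=0..<i. padic_residue l x - int j) mod int CARD('p) ^ k"
proof (induction i)
  case (Suc i)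
  have "padic_residue k x mod int CARD('p) ^ k = padic_residue l x mod int CARD('p) ^ k"
    using padic_residue_mod[OF assms, of x] by (metis mod_mod_trivial)
  then have "(padic_residue k x - int i) mod int CARD('p) ^ k = (padic_residue l x - int i) mod int CARD('p) ^ k"
    by (rule mod_diff_cong) simp
  then have "(P * (padic_residue k x - int i)) mod int CARD('p) ^ k = (P * (padic_residue l x - int i)) mod int CARD('p) ^ k" for P
    by (metis mod_mult_right_eq)
  with Suc show ?case
    by (simp add: padic_residue_mult padic_residue_diff padic_residue_of_nat mod_simps)
qed (simp add: padic_residue_1)

lemma fact_dvd_falling_fact:
  "fact i dvd (\<Prod>j=0..<i. x - of_nat j :: 'p::prime_card padic_int)"
proof -
  have fact_nz: "(fact i :: 'p padic_int) \<noteq> 0" by simp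
  define v where "v = padic_val (fact i :: 'p padic_int)"
  have fact_res: "padic_residue k (fact i :: 'p padic_int) = fact i mod int CARD('p) ^ k" for k
    using padic_residue_of_nat[where n = "fact i" and 'p = 'p] by simp
  have dvd_iff: "int CARD('p) ^ k dvd fact i \<longleftrightarrow> k \<le> v" for k
    using padic_residue_eq_0_iff[OF fact_nz, of k] unfolding fact_res v_def by (simp add: dvd_eq_mod_eq_0)
  then obtain u :: int where u: "fact i = int CARD('p) ^ v * u" by (meson dvdE order_refl)
  have "\<not> int CARD('p) dvd u"
  proof
    assume "int CARD('p) dvd u"
    then have "int CARD('p) ^ Suc v dvd fact i" by (simp add: u mult.commute)
    then show False by (simp add: dvd_iff del: power_Suc)
  qed
  then have cop: "coprime (int CARD('p) ^ k) u" for k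
    using prime_imp_coprime[OF CARD_prime_int[where 'p = 'p], of u] by simp
  define P where "P m = (\<Prod>j=0..<i. m - int j)" for m :: int
  define b where "b k = P (padic_residue (k + v) x) div fact i" for k
  have P: "fact i * b k = P (padic_residue (k + v) x)" for k
  proof -
    have "fact i dvd P m" for m
      using fact_dvd_pochhammer[of i "m - int i + 1"] falling_fact_pochhammer'[of m i]
      by (simp add: P_def)
    then show ?thesis by (simp add: b_def)
  qed
  have P_cong: "P (padic_residue l x) mod int CARD('p) ^ k = padic_residue k (\<Prod>j=0..<i. x - of_nat j)"
    if "k \<le> l" for k l
    unfolding P_def by (rule padic_residue_falling_fact[OF that, symmetric])
  have b_cong: "b (Suc k) mod int CARD('p) ^ k = b k mod int CARD('p) ^ k" for k
  proof -
    have "P (padic_residue (Suc k + v) x) mod int CARD('p) ^ (k + v) = P (padic_residue (k + v) x) mod int CARD('p) ^ (k + v)"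
      using P_cong[of "k + v" "Suc k + v"] P_cong[of "k + v" "k + v"] by simp
    then have "int CARD('p) ^ (k + v) dvd fact i * (b (Suc k) - b k)"
      unfolding P[symmetric] mod_eq_dvd_iff by (simp add: right_diff_distrib)
    then have "int CARD('p) ^ k dvd u * (b (Suc k) - b k)"
      unfolding u by (simp add: power_add mult.assoc mult.commute[of "int CARD('p) ^ k"])
    then have "int CARD('p) ^ k dvd b (Suc k) - b k"
      using cop by (simp add: coprime_dvd_mult_right_iff)
    then show ?thesis by (simp add: mod_eq_dvd_iff)
  qed
  obtain z :: "'p padic_int" where z: "padic_residue k z = b k mod int CARD('p) ^ k" for k
  proof
    fix k
    show "padic_residue k (Abs_padic_int (\<lambda>k. b k mod int CARD('p) ^ k) :: 'p padic_int) = b k mod int CARD('p) ^ k"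
      unfolding padic_residue.rep_eq
      by (subst Abs_padic_int_inverse) (simp_all add: mod_power_Suc_mod b_cong del: power_Suc)
  qed
  have "(\<Prod>j=0..<i. x - of_nat j) = fact i * z"
  proof (rule padic_int_eqI)
    fix k
    show "padic_residue k (\<Prod>j=0..<i. x - of_nat j) = padic_residue k (fact i * z)"
      using P_cong[of k "k + v"] by (simp add: padic_residue_mult fact_res z mod_simps P)
  qed
  then show ?thesis by simp
qed

text \<open>
  The division in \<open>padic_binomial\<close> is exact, see \<open>fact_mult_padic_binomial\<close>.
  In the class \<open>\<B>\<close> the condition \<open>a\<^sub>i / i! \<in> \<int>\<^sub>p\<close> forces \<open>a\<^sub>i \<in> \<int>\<^sub>p\<close> and says that \<open>i!\<close> divides \<open>a\<^sub>i\<close> in \<open>\<int>\<^sub>p\<close>.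
\<close>

definition padic_binomial :: "'p::prime_card padic_int \<Rightarrow> nat \<Rightarrow> 'p padic_int" where
  "padic_binomial x i = (\<Prod>j=0..<i. x - of_nat j) div fact i"

lemma fact_mult_padic_binomial: "fact i * padic_binomial x i = (\<Prod>j=0..<i. x - of_nat j)"
proof -
  obtain z where z: "(\<Prod>j=0..<i. x - of_nat j) = fact i * z"
    using fact_dvd_falling_fact[of i x] by (rule dvdE)
  have "fact i * z div fact i = z"
    by (rule nonzero_mult_div_cancel_left) (rule fact_nonzero)
  then show ?thesis unfolding padic_binomial_def z by simp
qed

definition class_B :: "('p::prime_card padic_int \<Rightarrow> 'p padic_int) set" where
  "class_B = {g. \<exists>a :: nat \<Rightarrow> 'p padic_int. (\<forall>i. fact i dvd a i) \<and>
                   (\<forall>x. (\<lambda>i. a i * padic_binomial x i) sums g x)}"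

definition compatible :: "('p::prime_card padic_int \<Rightarrow> 'p padic_int) \<Rightarrow> bool" where
  "compatible f \<longleftrightarrow> (\<forall>x y. padic_norm (f x - f y) \<le> padic_norm (x - y))"

definition class_A :: "('p::prime_card padic_int \<Rightarrow> 'p padic_int) set" where
  "class_A = {f. compatible f \<and> (\<exists>n. (\<lambda>x. of_nat CARD('p) ^ n * f x) \<in> class_B)}"

text \<open>
  The difference quotient tends to \<open>D\<close>; the denominator is cleared because the quotient of a general
  \<open>f\<close> lies in \<open>\<rat>\<^sub>p\<close> only.
\<close>

definition has_padic_derivative ::
    "('p::prime_card padic_int \<Rightarrow> 'p padic_int) \<Rightarrow> 'p padic_int \<Rightarrow> 'p padic_int \<Rightarrow> bool" where
  "has_padic_derivative f D y \<longleftrightarrow> ((\<lambda>h. padic_norm (f (y + h) - f y - D * h) / padic_norm h) \<longlongrightarrow> 0) (at 0)"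

definition padic_deriv :: "('p::prime_card padic_int \<Rightarrow> 'p padic_int) \<Rightarrow> 'p padic_int \<Rightarrow> 'p padic_int" where
  "padic_deriv f y = (THE D. has_padic_derivative f D y)"


section \<open>Haar measure and ergodicity on spheres\<close>

definition is_padic_haar :: "'p::prime_card padic_int measure \<Rightarrow> bool" where
  "is_padic_haar M \<longleftrightarrow> sets M = sets borel \<and> emeasure M UNIV = 1 \<and>
     (\<forall>a. \<forall>A\<in>sets borel. emeasure M ((+) a ` A) = emeasure M A)"

definition padic_haar :: "'p::prime_card padic_int measure" where
  "padic_haar = (THE M. is_padic_haar M)"

lemma padic_dist_le_iff:
  "dist x y \<le> 1 / real CARD('p) ^ k \<longleftrightarrow> padic_residue k x = padic_residue k (y :: 'p::prime_card padic_int)"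
proof -
  have "padic_residue k (x - y) = 0 \<longleftrightarrow> padic_residue k x mod int CARD('p) ^ k = padic_residue k y mod int CARD('p) ^ k"
    by (simp add: padic_residue_diff mod_eq_dvd_iff dvd_eq_mod_eq_0 del: mod_pos_pos_trivial)
  then show ?thesis by (simp add: dist_padic_int_def padic_norm_le_iff)
qed

definition padic_cyl :: "nat \<Rightarrow> int \<Rightarrow> 'p::prime_card padic_int set" where
  "padic_cyl k r = {x. padic_residue k x = r}"

lemma open_padic_cyl: "open (padic_cyl k r :: 'p::prime_card padic_int set)"
  unfolding open_dist
proof
  fix x :: "'p padic_int"
  assume x: "x \<in> padic_cyl k r"
  have "y \<in> padic_cyl k r" if "dist y x < 1 / real CARD('p) ^ k" for y
    using padic_dist_le_iff[of y x k] that x by (simp add: padic_cyl_def)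
  moreover have "0 < 1 / real CARD('p) ^ k"
    using prime_gt_0_nat[OF prime_card[where 'a = 'p]] by simp
  ultimately show "\<exists>e>0. \<forall>y. dist y x < e \<longrightarrow> y \<in> padic_cyl k r" by blast
qed

lemma sets_borel_padic:
  "sets (borel :: 'p::prime_card padic_int measure) = sigma_sets UNIV (range (case_prod padic_cyl))"
proof -
  have "borel = sigma UNIV (range (case_prod padic_cyl) :: 'p padic_int set set)"
  proof (rule borel_eq_countable_basis)
    show "countable (range (case_prod padic_cyl) :: 'p padic_int set set)" by simp
    show "topological_basis (range (case_prod padic_cyl) :: 'p padic_int set set)"
    proof (rule topological_basisI)
      fix B :: "'p padic_int set"
      assume "B \<in> range (case_prod padic_cyl)"
      then show "open B" using open_padic_cyl by auto
    next
      fix U and x :: "'p padic_int"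
      assume "open U" "x \<in> U"
      then obtain e where e: "e > 0" "\<And>y. dist y x < e \<Longrightarrow> y \<in> U" unfolding open_dist by blast
      have "1 < real CARD('p)"
        using prime_gt_1_nat[OF prime_card[where 'a = 'p]] by simp
      then obtain k where k: "inverse e < real CARD('p) ^ k" using real_arch_pow by blast
      have "0 < inverse e" using e(1) by simp
      then have "1 / real CARD('p) ^ k < e"
        using k e(1) by (simp add: field_simps)
      then have "padic_cyl k (padic_residue k x) \<subseteq> U"
        using e(2) padic_dist_le_iff[of _ x k] by (force simp: padic_cyl_def)
      then show "\<exists>B\<in>range (case_prod padic_cyl). x \<in> B \<and> B \<subseteq> U"
        by (intro bexI[of _ "padic_cyl k (padic_residue k x)"] conjI range_eqI[of _ _ "(k, padic_residue k x)"])
           (simp_all add: padic_cyl_def)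
    qed
  qed
  then show ?thesis by (metis Pow_UNIV sets_measure_of subset_UNIV)
qed

lemma Int_stable_padic_cyl: "Int_stable (insert {} (range (case_prod padic_cyl)) :: 'p::prime_card padic_int set set)"
proof -
  have *: "padic_cyl k r \<inter> padic_cyl l s \<in> insert {} (range (case_prod padic_cyl) :: 'p padic_int set set)"
    if "k \<le> l" for k l r s
  proof (cases "s mod int CARD('p) ^ k = r")
    case True
    then have "padic_cyl k r \<inter> padic_cyl l s = (padic_cyl l s :: 'p padic_int set)"
      using padic_residue_mod[OF that, where 'p = 'p] by (auto simp: padic_cyl_def)
    then show ?thesis by auto
  next
    case False
    then have "padic_cyl k r \<inter> padic_cyl l s = ({} :: 'p padic_int set)"
      using padic_residue_mod[OF that, where 'p = 'p] by (auto simp: padic_cyl_def)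
    then show ?thesis by auto
  qed
  have "padic_cyl k r \<inter> padic_cyl l s \<in> insert {} (range (case_prod padic_cyl) :: 'p padic_int set set)" for k l r s
    using *[of k l r s] *[of l k s r] by (cases "k \<le> l") (auto simp: Int_commute)
  then show ?thesis unfolding Int_stable_def by (auto split: prod.splits)
qed

lemma padic_measure_eqI:
  fixes M N :: "'p::prime_card padic_int measure"
  assumes "sets M = sets borel" "sets N = sets borel" "emeasure M UNIV = 1"
    and "\<And>k r. 0 \<le> r \<Longrightarrow> r < int CARD('p) ^ k \<Longrightarrow> emeasure M (padic_cyl k r) = emeasure N (padic_cyl k r)"
  shows "M = N"
proof (rule measure_eqI_generator_eq[where E = "insert {} (range (case_prod padic_cyl))" and \<Omega> = UNIV and A = "\<lambda>_. UNIV"])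
  have empty: "padic_cyl k r = ({} :: 'p padic_int set)" if "\<not> (0 \<le> r \<and> r < int CARD('p) ^ k)" for k r
    using that padic_residue_bounds[where 'p = 'p] by (force simp: padic_cyl_def)
  have "emeasure M (padic_cyl k r) = emeasure N (padic_cyl k r)" for k r
    using assms(4)[of r k] empty[of r k] by (cases "0 \<le> r \<and> r < int CARD('p) ^ k") auto
  then show "emeasure M X = emeasure N X" if "X \<in> insert {} (range (case_prod padic_cyl))" for X
    using that by auto
  show "sets M = sigma_sets UNIV (insert {} (range (case_prod padic_cyl)))"
       "sets N = sigma_sets UNIV (insert {} (range (case_prod padic_cyl)))"
    unfolding assms(1,2) sets_borel_padic
    by (auto intro!: sigma_sets_eqI intro: sigma_sets.Empty sigma_sets.Basic)
  have "padic_residue 0 x = 0" for x :: "'p padic_int"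
    using padic_residue_bounds(1)[of 0 x] padic_residue_bounds(2)[of 0 x] unfolding power_0 by linarith
  then have "UNIV = (padic_cyl 0 0 :: 'p padic_int set)" by (auto simp: padic_cyl_def)
  then show "range (\<lambda>_. UNIV :: 'p padic_int set) \<subseteq> insert {} (range (case_prod padic_cyl))"
    by (auto intro: range_eqI[of _ _ "(0, 0)"])
qed (use assms(3) Int_stable_padic_cyl in auto)

lemma emeasure_padic_haar_cyl:
  fixes M :: "'p::prime_card padic_int measure"
  assumes M: "is_padic_haar M" and r: "0 \<le> r" "r < int CARD('p) ^ k"
  shows "emeasure M (padic_cyl k r) = ennreal (1 / real CARD('p) ^ k)"
proof -
  define q where "q = CARD('p) ^ k"
  have q: "0 < q" unfolding q_def using prime_gt_0_nat[OF prime_card[where 'a = 'p]] by simp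
  have meas: "padic_cyl k s \<in> sets borel" for s :: int by (rule borel_open[OF open_padic_cyl])
  have eq: "emeasure M (padic_cyl k (int s)) = emeasure M (padic_cyl k 0)" if "s < q" for s
  proof -
    have s: "int s mod int CARD('p) ^ k = int s" using that by (simp add: q_def flip: of_nat_power)
    have "(+) (of_nat s) ` padic_cyl k 0 = (padic_cyl k (int s) :: 'p padic_int set)"
    proof (intro equalityI subsetI)
      fix x :: "'p padic_int" assume "x \<in> padic_cyl k (int s)"
      then show "x \<in> (+) (of_nat s) ` padic_cyl k 0"
        by (intro image_eqI[of _ _ "x - of_nat s"]) (auto simp: padic_cyl_def padic_residue_diff padic_residue_of_nat s)
    qed (auto simp: padic_cyl_def padic_residue_add padic_residue_of_nat s)
    then show ?thesis using M meas[of 0] unfolding is_padic_haar_def by metis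
  qed
  have "(UNIV :: 'p padic_int set) = (\<Union>s\<in>{..<q}. padic_cyl k (int s))"
  proof (intro equalityI subsetI)
    fix x :: "'p padic_int"
    have "padic_residue k x < int q" by (simp add: q_def)
    then show "x \<in> (\<Union>s\<in>{..<q}. padic_cyl k (int s))"
      by (intro UN_I[of "nat (padic_residue k x)"]) (auto simp: padic_cyl_def nat_less_iff)
  qed simp
  then have "1 = emeasure M (\<Union>s\<in>{..<q}. padic_cyl k (int s))"
    using M by (simp add: is_padic_haar_def)
  also have "\<dots> = (\<Sum>s<q. emeasure M (padic_cyl k (int s)))"
    using M meas by (intro sum_emeasure[symmetric]) (auto simp: is_padic_haar_def disjoint_family_on_def padic_cyl_def)
  also have "\<dots> = of_nat q * emeasure M (padic_cyl k 0)"
    using eq by simp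
  finally have 1: "of_nat q * emeasure M (padic_cyl k 0) = 1" by simp
  have "emeasure M (padic_cyl k 0) = ennreal (1 / real q)"
  proof -
    have "emeasure M (padic_cyl k 0) = (of_nat q * emeasure M (padic_cyl k 0)) / of_nat q"
      using q ennreal_mult_divide_eq[of "of_nat q" "emeasure M (padic_cyl k 0)"] by (simp add: mult.commute)
    also have "\<dots> = ennreal (1 / real q)"
      unfolding 1 using q by (metis divide_ennreal ennreal_1 ennreal_of_nat_eq_real_of_nat of_nat_0_less_iff zero_le_one)
    finally show ?thesis .
  qed
  moreover have "nat r < q" using r by (simp add: q_def nat_less_iff)
  ultimately show ?thesis using eq[of "nat r"] r by (simp add: q_def)
qed

lemma ex_padic_haar: "\<exists>M :: 'p::prime_card padic_int measure. is_padic_haar M"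
proof -
  define p where "p = int CARD('p)"
  have p: "0 < p" "prime p" by (simp_all add: p_def prime_card prime_gt_0_nat)
  define D where "D = measure_pmf (pmf_of_set {0..<p})"
  interpret D: prob_space D unfolding D_def by (rule measure_pmf.prob_space_axioms)
  define P where "P = PiM UNIV (\<lambda>_::nat. D)"
  interpret product_prob_space "\<lambda>_::nat. D" UNIV by standard
  have P_prob: "prob_space P" unfolding P_def by (rule prob_space_PiM) (rule D.prob_space_axioms)
  define s where "s \<omega> k = (\<Sum>i<k. (\<omega> i mod p) * p ^ i)" for \<omega> :: "nat \<Rightarrow> int" and k
  have s_bounds: "0 \<le> s \<omega> k \<and> s \<omega> k < p ^ k" for \<omega> k
  proof (induction k)
    case (Suc k)
    have "\<omega> k mod p * p ^ k \<le> (p - 1) * p ^ k"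
      using p(1) by (intro mult_right_mono) (auto simp: zle_diff1_eq)
    moreover have "0 \<le> \<omega> k mod p * p ^ k" using p(1) by simp
    ultimately show ?case using Suc by (simp add: s_def algebra_simps)
  qed (simp add: s_def)
  have s_mod: "s \<omega> (Suc k) mod p ^ k = s \<omega> k" for \<omega> k
    using s_bounds[of \<omega> k] by (simp add: s_def)
  define Z where "Z \<omega> = (Abs_padic_int (s \<omega>) :: 'p padic_int)" for \<omega>
  have Z: "padic_residue k (Z \<omega>) = s \<omega> k" for k \<omega>
    unfolding padic_residue.rep_eq Z_def
    using s_bounds s_mod by (subst Abs_padic_int_inverse) (auto simp: p_def)
  have s_eq: "s \<omega> k = r \<longleftrightarrow> (\<forall>i<k. \<omega> i mod p = r div p ^ i mod p)" if "0 \<le> r" "r < p ^ k" for \<omega> k r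
    using that
  proof (induction k arbitrary: r)
    case 0
    then show ?case by (simp add: s_def)
  next
    case (Suc k)
    have pk: "0 < p ^ k" using p(1) by simp
    have q: "0 \<le> r div p ^ k" "r div p ^ k < p"
    proof -
      show "0 \<le> r div p ^ k" using Suc.prems pk by (simp add: pos_imp_zdiv_nonneg_iff)
      have "r div p ^ k * p ^ k \<le> r"
        using mod_mult_div_eq[of r "p ^ k"] pos_mod_sign[OF pk, of r] unfolding mult.commute[of "r div p ^ k"] by linarith
      also have "r < p * p ^ k" using Suc.prems by simp
      finally show "r div p ^ k < p" using pk by simp
    qed
    have low: "(r mod p ^ k) div p ^ i mod p = r div p ^ i mod p" if ik: "i < k" for i
    proof -
      obtain j where j: "k = Suc i + j" using less_imp_Suc_add[OF ik] by auto
      define c where "c = p * (p ^ j * (r div p ^ k))"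
      have "r = r mod p ^ k + p ^ k * (r div p ^ k)" by simp
      also have "p ^ k * (r div p ^ k) = p ^ i * c" by (simp add: c_def j power_add)
      finally have "r div p ^ i = (r mod p ^ k + p ^ i * c) div p ^ i" by (rule arg_cong)
      also have "\<dots> = c + r mod p ^ k div p ^ i"
        by (rule div_mult_self2) (use p(1) in simp)
      finally have "r div p ^ i mod p = (r mod p ^ k div p ^ i + p * (p ^ j * (r div p ^ k))) mod p"
        unfolding c_def by (simp only: add.commute)
      then show ?thesis by simp
    qed
    have "s \<omega> (Suc k) = r \<longleftrightarrow> s \<omega> k = r mod p ^ k \<and> \<omega> k mod p = r div p ^ k"
    proof
      assume r: "s \<omega> (Suc k) = r"
      have "r = s \<omega> k + (\<omega> k mod p) * p ^ k" using r by (simp add: s_def)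
      moreover have "(s \<omega> k + \<omega> k mod p * p ^ k) div p ^ k = \<omega> k mod p + s \<omega> k div p ^ k"
        by (rule div_mult_self1) (use p(1) in simp)
      moreover have "s \<omega> k div p ^ k = 0" "s \<omega> k mod p ^ k = s \<omega> k"
        using s_bounds[of \<omega> k] by simp_all
      ultimately show "s \<omega> k = r mod p ^ k \<and> \<omega> k mod p = r div p ^ k" by simp
    next
      assume "s \<omega> k = r mod p ^ k \<and> \<omega> k mod p = r div p ^ k"
      moreover have "s \<omega> (Suc k) = s \<omega> k + (\<omega> k mod p) * p ^ k" by (simp add: s_def)
      ultimately show "s \<omega> (Suc k) = r" using mod_div_mult_eq[of r "p ^ k"] by metis
    qed
    also have "\<dots> \<longleftrightarrow> (\<forall>i<k. \<omega> i mod p = r div p ^ i mod p) \<and> \<omega> k mod p = r div p ^ k mod p"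
      using Suc.IH[of "r mod p ^ k"] pk low q by simp
    finally show ?case by (auto simp: less_Suc_eq)
  qed
  have digit: "emeasure D {w. w mod p = d} = ennreal (1 / real CARD('p))" if "0 \<le> d" "d < p" for d
  proof -
    have "{w. w mod p = d} \<inter> {0..<p} = {d}" using that by auto
    then show ?thesis
      using p(1) unfolding D_def
      by (subst emeasure_pmf_of_set) (auto simp: Int_commute p_def)
  qed
  have pre: "Z -` padic_cyl k r = prod_emb UNIV (\<lambda>_. D) {..<k} (PiE {..<k} (\<lambda>i. {w. w mod p = r div p ^ i mod p}))"
    if "0 \<le> r" "r < p ^ k" for k r
    using s_eq[OF that] by (auto simp: padic_cyl_def Z prod_emb_def D_def space_PiM)
  have pre_empty: "Z -` padic_cyl k r = {}" if "\<not> (0 \<le> r \<and> r < p ^ k)" for k r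
    using that s_bounds by (auto simp: padic_cyl_def Z)
  have pre_sets: "Z -` padic_cyl k r \<in> sets P" for k r
    using pre[of r k] pre_empty[of r k] unfolding P_def
    by (cases "0 \<le> r \<and> r < p ^ k") (auto intro!: sets_PiM_I simp: D_def)
  have space_P: "space P = UNIV" by (simp add: P_def space_PiM D_def)
  have Z_meas: "Z \<in> measurable P borel"
    by (rule measurable_sigma_sets[OF sets_borel_padic]) (auto simp: space_P pre_sets)
  define M where "M = distr P borel Z"
  have cyl: "emeasure M (padic_cyl k r) = ennreal ((1 / real CARD('p)) ^ k)" if "0 \<le> r" "r < p ^ k" for k r
  proof -
    have "emeasure M (padic_cyl k r) = emeasure P (Z -` padic_cyl k r)"
      unfolding M_def using Z_meas borel_open[OF open_padic_cyl] by (subst emeasure_distr) (simp_all add: space_P)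
    also have "\<dots> = (\<Prod>i<k. emeasure D {w. w mod p = r div p ^ i mod p})"
      unfolding pre[OF that] P_def by (subst emeasure_PiM_emb) (auto simp: D_def)
    also have "\<dots> = (\<Prod>i<k. ennreal (1 / real CARD('p)))"
      using p(1) by (intro prod.cong refl digit) auto
    finally show ?thesis by (simp add: ennreal_power)
  qed
  have M_UNIV: "emeasure M UNIV = 1"
    unfolding M_def using Z_meas prob_space.emeasure_space_1[OF P_prob] by (subst emeasure_distr) (auto simp: space_P)
  have shift: "emeasure M ((+) a ` A) = emeasure M A" if A: "A \<in> sets borel" for a A
  proof -
    have vim: "(\<lambda>x. x - a) -` B = (+) a ` B" for B
      by (auto intro: image_eqI[of _ _ "_ - a"])
    have "continuous_on UNIV (\<lambda>x. x - a)"
      unfolding continuous_on_iff by (auto simp: dist_padic_int_def)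
    then have meas: "(\<lambda>x. x - a) \<in> borel_measurable borel" by (rule borel_measurable_continuous_onI)
    then have meas': "(\<lambda>x. x - a) \<in> measurable M borel" by (simp add: M_def)
    have em: "emeasure (distr M borel (\<lambda>x. x - a)) B = emeasure M ((+) a ` B)" if "B \<in> sets borel" for B
      using that meas' by (subst emeasure_distr) (auto simp: vim M_def)
    have "M = distr M borel (\<lambda>x. x - a)"
    proof (rule padic_measure_eqI)
      show "sets M = sets borel" "sets (distr M borel (\<lambda>x. x - a)) = sets borel" by (simp_all add: M_def)
      show "emeasure M UNIV = 1" by (rule M_UNIV)
      fix k r
      assume r: "0 \<le> r" "r < int CARD('p) ^ k"
      have "(+) a ` padic_cyl k r = padic_cyl k ((r + padic_residue k a) mod int CARD('p) ^ k)"
      proof -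
        have "padic_residue k (x - a) = r \<longleftrightarrow> padic_residue k x = (r + padic_residue k a) mod int CARD('p) ^ k" for x
        proof
          assume "padic_residue k (x - a) = r"
          then show "padic_residue k x = (r + padic_residue k a) mod int CARD('p) ^ k"
            using padic_residue_add[of k "x - a" a] by simp
        next
          assume "padic_residue k x = (r + padic_residue k a) mod int CARD('p) ^ k"
          then show "padic_residue k (x - a) = r"
            using r by (simp add: padic_residue_diff mod_simps)
        qed
        then show ?thesis unfolding vim[symmetric] by (auto simp: padic_cyl_def)
      qed
      then have "emeasure (distr M borel (\<lambda>x. x - a)) (padic_cyl k r) =
          emeasure M (padic_cyl k ((r + padic_residue k a) mod int CARD('p) ^ k))"
        using em[OF borel_open[OF open_padic_cyl]] by metis
      also have "\<dots> = ennreal ((1 / real CARD('p)) ^ k)"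
        by (rule cyl) (simp_all add: p_def)
      also have "\<dots> = emeasure M (padic_cyl k r)"
        using cyl[of r k] r by (simp add: p_def)
      finally show "emeasure M (padic_cyl k r) = emeasure (distr M borel (\<lambda>x. x - a)) (padic_cyl k r)" ..
    qed
    then show ?thesis using em[OF A] by simp
  qed
  have "is_padic_haar M"
    unfolding is_padic_haar_def using M_UNIV shift by (simp add: M_def)
  then show ?thesis ..
qed

lemma padic_haar_unique:
  fixes M N :: "'p::prime_card padic_int measure"
  assumes "is_padic_haar M" "is_padic_haar N"
  shows "M = N"
proof (rule padic_measure_eqI)
  show "sets M = sets borel" "sets N = sets borel" "emeasure M UNIV = 1"
    using assms by (auto simp: is_padic_haar_def)
qed (use assms emeasure_padic_haar_cyl in metis)

lemma is_padic_haar_padic_haar: "is_padic_haar padic_haar"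
  unfolding padic_haar_def using ex_padic_haar padic_haar_unique by (metis theI)

definition padic_sphere :: "'p::prime_card padic_int \<Rightarrow> nat \<Rightarrow> 'p padic_int set" where
  "padic_sphere y r = sphere y (1 / real CARD('p) ^ r)"

definition sphere_measure :: "'p::prime_card padic_int \<Rightarrow> nat \<Rightarrow> 'p padic_int measure" where
  "sphere_measure y r =
     scale_measure (1 / emeasure padic_haar (padic_sphere y r)) (restrict_space padic_haar (padic_sphere y r))"

definition preserves_measure :: "'a measure \<Rightarrow> ('a \<Rightarrow> 'a) \<Rightarrow> bool" where
  "preserves_measure M f \<longleftrightarrow> f \<in> measurable M M \<and>
     (\<forall>A\<in>sets M. emeasure M (f -` A \<inter> space M) = emeasure M A)"

definition ergodic_wrt :: "'a measure \<Rightarrow> ('a \<Rightarrow> 'a) \<Rightarrow> bool" where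
  "ergodic_wrt M f \<longleftrightarrow>
     (\<forall>A\<in>sets M. f -` A \<inter> space M = A \<longrightarrow> emeasure M A = 0 \<or> emeasure M A = 1)"

definition ergodic_on_sphere ::
    "('p::prime_card padic_int \<Rightarrow> 'p padic_int) \<Rightarrow> 'p padic_int \<Rightarrow> nat \<Rightarrow> bool" where
  "ergodic_on_sphere f y r \<longleftrightarrow> f ` padic_sphere y r \<subseteq> padic_sphere y r \<and>
     preserves_measure (sphere_measure y r) f \<and> ergodic_wrt (sphere_measure y r) f"


section \<open>Congruences and units\<close>

definition padic_cong :: "'p::prime_card padic_int \<Rightarrow> 'p padic_int \<Rightarrow> nat \<Rightarrow> bool" where
  "padic_cong x y k \<longleftrightarrow> of_nat CARD('p) ^ k dvd x - y"

definition generates_units_mod_p2 :: "'p::prime_card padic_int \<Rightarrow> bool" where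
  "generates_units_mod_p2 x \<longleftrightarrow>
     (let G = units_of (residue_ring (int CARD('p) ^ 2))
      in padic_residue 2 x \<in> carrier G \<and> generate G {padic_residue 2 x} = carrier G)"

end

theory Submission
  imports Defs
begin

text \<open>
  Since \<open>p\<^sup>n f\<close> is a uniform limit of polynomials over \<open>\<int>\<^sub>p\<close>, the difference quotients of \<open>f\<close> near \<open>y\<close>, at scale
  \<open>p\<^sup>r\<close>, agree with \<open>f'(y)\<close> modulo \<open>p\<^sup>r\<^sup>-\<^sup>n\<close>. If \<open>f\<close> preserves the sphere then \<open>f (y + p\<^sup>r u) = y + p\<^sup>r \<phi>(u)\<close>, where
  for \<open>r \<ge> n + 3\<close> the map \<open>\<phi>\<close> is affine with slope \<open>f'(y)\<close> modulo \<open>p\<^sup>3\<close> and acts on the units of \<open>\<int>\<^sub>p\<close>.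
  For compatible maps ergodicity amounts to transitivity modulo every power of \<open>p\<close>. For \<open>\<phi>\<close> this is an elementary
  question modulo \<open>p\<^sup>2\<close> (modulo \<open>8\<close> if \<open>p = 2\<close>), and it lifts to all higher powers because a return map that moves
  every unit by exactly \<open>p\<^sup>k\<close> has a \<open>p\<close>-th iterate that moves every unit by exactly \<open>p\<^sup>k\<^sup>+\<^sup>1\<close>.
\<close>

section \<open>Divisibility in the ring of \<open>p\<close>-adic integers\<close>

text \<open>The slope of \<open>\<phi>\<close> is known only to a bounded precision, yet orbits must
  be followed modulo every power of p. This works because the error is relative:
  \<open>\<phi> v - \<phi> u\<close> is \<open>v - u\<close> times something congruent to the slope
  modulo p^2, so a displacement divisible by p^k is controlled modulo p^(k+2). The bound on r is
  uniform in f because divided differences of polynomials over Z_p respect congruences in every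
  degree, however many terms a good approximation of p^n f may need; dividing by p^n then costs n
  digits. Three further digits come from p = 2. A slope congruent to 3 modulo 4 can still act
  transitively on the two units modulo 4; it is excluded only modulo 8, where the second iterate is
  the identity although there are four units. For odd p the modulus p^2 is enough. The return map is
  the (p-1)-th iterate for odd p and the map itself for p = 2.\<close>

abbreviation padic_p :: "'p::prime_card padic_int" ("\<pi>")
  where "\<pi> \<equiv> of_nat CARD('p)"

instance padic_int :: (prime_card) algebraic_semidom ..

lemma padic_seq_exists:
  fixes x :: "nat \<Rightarrow> int"
  assumes "\<And>k. x (Suc k) mod int CARD('p::prime_card) ^ k = x k mod int CARD('p) ^ k"
  shows "\<exists>z :: 'p padic_int. \<forall>k. padic_residue k z = x k mod int CARD('p) ^ k"
proof (intro exI allI)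
  fix k
  show "padic_residue k (Abs_padic_int (\<lambda>k. x k mod int CARD('p) ^ k) :: 'p padic_int) = x k mod int CARD('p) ^ k"
    unfolding padic_residue.rep_eq
    by (subst Abs_padic_int_inverse) (simp_all add: mod_power_Suc_mod assms del: power_Suc)
qed

lemma padic_residue_p_power: "padic_residue k (\<pi> ^ k :: 'p::prime_card padic_int) = 0"
  using padic_residue_of_nat[of k "CARD('p) ^ k", where 'p = 'p] by simp

text \<open>Bridge from the inverse limit to ring divisibility, in which the later arguments are
  phrased. The quotient by p^k is built as a residue sequence: its j-th entry needs \<open>x\<close>
  modulo p^(k+j), hence the shifted index in \<open>z\<close>.\<close>

lemma padic_residue_eq_0_iff_dvd:
  fixes x :: "'p::prime_card padic_int"
  shows "padic_residue k x = 0 \<longleftrightarrow> \<pi> ^ k dvd x"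
proof
  assume "\<pi> ^ k dvd x"
  then obtain z where "x = \<pi> ^ k * z" by (rule dvdE)
  then show "padic_residue k x = 0"
    by (simp add: padic_residue_mult padic_residue_p_power)
next
  assume x: "padic_residue k x = 0"
  define z where "z j = padic_residue (k + j) x div int CARD('p) ^ k" for j
  have z: "padic_residue (k + j) x = int CARD('p) ^ k * z j" for j
    using padic_residue_dvd_iff[of k "k + j" x] x by (simp add: z_def)
  have "z (Suc j) mod int CARD('p) ^ j = z j mod int CARD('p) ^ j" for j
  proof -
    have "padic_residue (k + Suc j) x mod int CARD('p) ^ (k + j) = padic_residue (k + j) x mod int CARD('p) ^ (k + j)"
      using padic_residue_mod[of "k + j" "k + Suc j" x] by simp
    then have "int CARD('p) ^ k * int CARD('p) ^ j dvd int CARD('p) ^ k * (z (Suc j) - z j)"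
      unfolding mod_eq_dvd_iff z power_add by (simp add: algebra_simps)
    then have "int CARD('p) ^ j dvd z (Suc j) - z j"
      using CARD_power_pos[of k, where 'p = 'p] by (subst (asm) dvd_mult_cancel_left) auto
    then show ?thesis by (simp add: mod_eq_dvd_iff)
  qed
  then obtain w :: "'p padic_int" where w: "\<And>j. padic_residue j w = z j mod int CARD('p) ^ j"
    using padic_seq_exists by blast
  have "x = \<pi> ^ k * w"
  proof (rule padic_int_eqI)
    fix j
    have "padic_residue j (\<pi> ^ k :: 'p padic_int) = int CARD('p) ^ k mod int CARD('p) ^ j"
      using padic_residue_of_nat[of j "CARD('p) ^ k", where 'p = 'p] by simp
    then have "padic_residue j (\<pi> ^ k * w) = (int CARD('p) ^ k * z j) mod int CARD('p) ^ j"
      by (simp add: padic_residue_mult w mod_simps)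
    also have "\<dots> = padic_residue j x"
      using padic_residue_mod[of j "k + j" x] by (simp add: z)
    finally show "padic_residue j x = padic_residue j (\<pi> ^ k * w)" ..
  qed
  then show "\<pi> ^ k dvd x" by simp
qed

lemma padic_residue_eq_iff_dvd:
  fixes x y :: "'p::prime_card padic_int"
  shows "padic_residue k x = padic_residue k y \<longleftrightarrow> \<pi> ^ k dvd x - y"
proof -
  have "padic_residue k x = padic_residue k y \<longleftrightarrow> padic_residue k (x - y) = 0"
    using padic_dist_le_iff[of x y k] by (simp add: dist_padic_int_def padic_norm_le_iff)
  then show ?thesis by (simp add: padic_residue_eq_0_iff_dvd)
qed

lemma padic_p_nonzero [simp]: "(\<pi> :: 'p::prime_card padic_int) \<noteq> 0"
  using prime_gt_0_nat[OF prime_card[where 'a = 'p]] by simp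

lemma padic_p_not_unit [simp]: "\<not> (\<pi> :: 'p::prime_card padic_int) dvd 1"
proof
  assume "(\<pi> :: 'p padic_int) dvd 1"
  then have "padic_residue 1 (1 :: 'p padic_int) = 0"
    by (simp add: padic_residue_eq_0_iff_dvd)
  then show False
    using prime_gt_1_nat[OF prime_card[where 'a = 'p]] by (simp add: padic_residue_1)
qed

lemma prime_elem_padic_p: "prime_elem (\<pi> :: 'p::prime_card padic_int)"
proof (rule prime_elemI)
  fix a b :: "'p padic_int"
  assume "\<pi> dvd a * b"
  then have "padic_residue 1 (a * b) = 0"
    by (simp add: padic_residue_eq_0_iff_dvd)
  then have "int CARD('p) dvd padic_residue 1 a * padic_residue 1 b"
    by (auto simp: padic_residue_mult)
  then have "int CARD('p) ^ 1 dvd padic_residue 1 a \<or> int CARD('p) ^ 1 dvd padic_residue 1 b"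
    using prime_dvd_mult_iff[OF CARD_prime_int[where 'p = 'p]] by simp
  then show "\<pi> dvd a \<or> \<pi> dvd b"
    by (subst (asm) (1 2) padic_residue_dvd_iff) (auto simp: padic_residue_eq_0_iff_dvd)
qed simp_all

lemmas padic_p_dvd_mult_iff = prime_elem_dvd_mult_iff[OF prime_elem_padic_p]

text \<open>Derived by induction from primality of p, because invertibility of \<open>a\<close>
  becomes available only in \<open>padic_is_unit_iff\<close>, whose proof relies on this
  cancellation.\<close>

lemma padic_p_power_dvd_mult_cancel:
  fixes a b :: "'p::prime_card padic_int"
  assumes "\<not> \<pi> dvd a"
  shows "\<pi> ^ k dvd a * b \<longleftrightarrow> \<pi> ^ k dvd b"
proof (induction k arbitrary: b)
  case (Suc k)
  show ?case
  proof
    assume *: "\<pi> ^ Suc k dvd a * b"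
    then have "\<pi> dvd a * b" by (metis dvd_mult_left power_Suc)
    then obtain c where c: "b = \<pi> * c" using assms by (auto simp: padic_p_dvd_mult_iff)
    then have "\<pi> * \<pi> ^ k dvd \<pi> * (a * c)" using * by (simp add: mult_ac)
    then have "\<pi> ^ k dvd a * c" by (subst (asm) dvd_mult_cancel_left) auto
    then show "\<pi> ^ Suc k dvd b" using Suc.IH c by (auto intro: mult_dvd_mono)
  qed auto
qed simp

lemma padic_int_eq_iff_dvd:
  fixes x y :: "'p::prime_card padic_int"
  shows "x = y \<longleftrightarrow> (\<forall>k. \<pi> ^ k dvd x - y)"
  by (metis padic_int_eqI padic_residue_eq_iff_dvd)

text \<open>Completeness in the form that builds inverses and derivatives: the k-th approximant is
  stable modulo p^k, and the limit agrees with it to the same precision.\<close>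

lemma padic_complete:
  fixes a :: "nat \<Rightarrow> 'p::prime_card padic_int"
  assumes "\<And>k. \<pi> ^ k dvd a (Suc k) - a k"
  shows "\<exists>z. \<forall>k. \<pi> ^ k dvd z - a k"
proof -
  have "padic_residue (Suc k) (a (Suc k)) mod int CARD('p) ^ k = padic_residue k (a k) mod int CARD('p) ^ k" for k
    using assms[of k] by (simp add: padic_residue_Suc_mod flip: padic_residue_eq_iff_dvd)
  from padic_seq_exists[OF this]
  obtain z :: "'p padic_int" where z: "\<And>k. padic_residue k z = padic_residue k (a k)" by auto
  then show ?thesis by (auto simp: padic_residue_eq_iff_dvd)
qed

lemma padic_cong_of_nat:
  fixes x :: "'p::prime_card padic_int"
  shows "\<exists>m. \<pi> ^ k dvd x - of_nat m"
proof
  show "\<pi> ^ k dvd x - of_nat (nat (padic_residue k x))"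
    unfolding padic_residue_eq_iff_dvd[symmetric] by (simp add: padic_residue_of_nat del: of_nat_nat)
qed

lemma padic_of_nat_dvd_iff:
  "(\<pi> ^ k :: 'p::prime_card padic_int) dvd of_nat m \<longleftrightarrow> CARD('p) ^ k dvd m"
proof -
  have "(\<pi> ^ k :: 'p padic_int) dvd of_nat m \<longleftrightarrow> int m mod int CARD('p) ^ k = 0"
    by (simp add: padic_residue_of_nat flip: padic_residue_eq_0_iff_dvd)
  also have "\<dots> \<longleftrightarrow> int (CARD('p) ^ k) dvd int m"
    by (simp add: dvd_eq_mod_eq_0)
  finally show ?thesis by (simp only: of_nat_dvd_iff)
qed

lemma padic_of_int_dvd_iff:
  "(\<pi> ^ k :: 'p::prime_card padic_int) dvd of_int m \<longleftrightarrow> int CARD('p) ^ k dvd m"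
proof (cases m)
  case (nonneg n)
  then show ?thesis using padic_of_nat_dvd_iff[of k n, where 'p = 'p]
    by (metis of_int_of_nat_eq of_nat_dvd_iff of_nat_power)
next
  case (neg n)
  then have "(of_int m :: 'p padic_int) = - of_nat (Suc n)" by simp
  then show ?thesis using padic_of_nat_dvd_iff[of k "Suc n", where 'p = 'p] neg
    by (metis dvd_minus_iff of_nat_dvd_iff of_nat_power)
qed

text \<open>Inverses modulo each p^k come from Bezout applied to a natural representative of
  \<open>x\<close>. They are unique modulo p^k, hence fit together, and completeness supplies the
  limit.\<close>

lemma padic_is_unit_iff:
  fixes x :: "'p::prime_card padic_int"
  shows "x dvd 1 \<longleftrightarrow> \<not> \<pi> dvd x"
proof
  assume "x dvd 1"
  then show "\<not> \<pi> dvd x" using dvd_trans padic_p_not_unit by blast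
next
  assume x: "\<not> \<pi> dvd x"
  have "\<exists>b. \<pi> ^ k dvd x * b - 1" for k
  proof -
    obtain m where m: "\<pi> ^ k dvd x - of_nat m" using padic_cong_of_nat by blast
    show ?thesis
    proof (cases "k = 0")
      case False
      have "\<not> (\<pi> :: 'p padic_int) dvd of_nat m"
      proof
        assume "(\<pi> :: 'p padic_int) dvd of_nat m"
        moreover have "\<pi> dvd x - of_nat m" using m False by (metis dvd_power dvd_trans gr0I)
        ultimately have "\<pi> dvd (x - of_nat m) + of_nat m" by (metis dvd_add)
        then show False using x by simp
      qed
      then have "\<not> CARD('p) dvd m"
        using padic_of_nat_dvd_iff[of 1 m, where 'p = 'p] by simp
      then have "coprime (int m) (int (CARD('p) ^ k))"
        using prime_card[where 'a = 'p] prime_imp_coprime coprime_commute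
        by (metis coprime_int_iff coprime_power_right_iff)
      then obtain b where b: "[int m * b = 1] (mod int (CARD('p) ^ k))"
        using cong_solve_coprime_int by blast
      then have "(\<pi> ^ k :: 'p padic_int) dvd of_int (int m * b - 1)"
        unfolding padic_of_int_dvd_iff by (simp add: cong_iff_dvd_diff)
      then have "\<pi> ^ k dvd (x - of_nat m) * of_int b + of_int (int m * b - 1)"
        using m by (metis dvd_add dvd_mult2)
      then have "\<pi> ^ k dvd x * of_int b - 1" by (simp add: algebra_simps)
      then show ?thesis ..
    qed auto
  qed
  then obtain b where b: "\<And>k. \<pi> ^ k dvd x * b k - 1" by metis
  have "\<pi> ^ k dvd b (Suc k) - b k" for k
  proof -
    have "\<pi> ^ k dvd x * b (Suc k) - 1" using b[of "Suc k"] dvd_mult_right by (metis power_Suc)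
    then have "\<pi> ^ k dvd (x * b (Suc k) - 1) - (x * b k - 1)" using b[of k] by (rule dvd_diff)
    then have "\<pi> ^ k dvd x * (b (Suc k) - b k)" by (simp add: algebra_simps)
    then show ?thesis using padic_p_power_dvd_mult_cancel[OF x] by blast
  qed
  then obtain z where z: "\<And>k. \<pi> ^ k dvd z - b k" using padic_complete by blast
  have "\<pi> ^ k dvd x * z - 1" for k
    using dvd_add[OF dvd_mult[OF z[of k], of x] b[of k]] by (simp add: algebra_simps)
  then have "x * z = 1" by (subst padic_int_eq_iff_dvd) auto
  then show "x dvd 1" by (metis dvd_triv_left)
qed

lemma padic_norm_le_iff_dvd:
  "padic_norm (x :: 'p::prime_card padic_int) \<le> 1 / real CARD('p) ^ k \<longleftrightarrow> \<pi> ^ k dvd x"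
  by (simp add: padic_norm_le_iff padic_residue_eq_0_iff_dvd)

lemma padic_unit_decomposition:
  fixes x :: "'p::prime_card padic_int"
  assumes "x \<noteq> 0"
  obtains u where "\<not> \<pi> dvd u" "x = \<pi> ^ padic_val x * u"
proof -
  have "\<pi> ^ padic_val x dvd x"
    using padic_residue_eq_0_iff[OF assms] by (simp add: padic_residue_eq_0_iff_dvd)
  then obtain u where u: "x = \<pi> ^ padic_val x * u" by (rule dvdE)
  have "\<not> \<pi> dvd u"
  proof
    assume "\<pi> dvd u"
    then have "\<pi> ^ padic_val x * \<pi> dvd \<pi> ^ padic_val x * u" by (rule mult_dvd_mono[OF dvd_refl])
    then have "\<pi> ^ Suc (padic_val x) dvd x" by (metis u mult.commute power_Suc)
    then show False
      using padic_residue_eq_0_iff[OF assms, of "Suc (padic_val x)"] by (simp add: padic_residue_eq_0_iff_dvd)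
  qed
  with u that show ?thesis by blast
qed

lemma padic_norm_mult: "padic_norm (x * y) = padic_norm x * padic_norm (y :: 'p::prime_card padic_int)"
proof (cases "x = 0 \<or> y = 0")
  case False
  then obtain u v where u: "\<not> \<pi> dvd u" "x = \<pi> ^ padic_val x * u" and v: "\<not> \<pi> dvd v" "y = \<pi> ^ padic_val y * v"
    by (metis padic_unit_decomposition)
  have xy: "x * y \<noteq> 0" using False by simp
  have eq: "x * y = (u * v) * \<pi> ^ (padic_val x + padic_val y)"
    by (subst u(2), subst v(2)) (simp add: power_add mult_ac)
  have "k \<le> padic_val (x * y) \<longleftrightarrow> k \<le> padic_val x + padic_val y" for k
  proof -
    have "k \<le> padic_val (x * y) \<longleftrightarrow> \<pi> ^ k dvd x * y"
      using padic_residue_eq_0_iff[OF xy] by (simp add: padic_residue_eq_0_iff_dvd)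
    also have "\<dots> \<longleftrightarrow> \<pi> ^ k dvd (u * v) * \<pi> ^ (padic_val x + padic_val y)"
      by (simp only: eq)
    also have "\<dots> \<longleftrightarrow> \<pi> ^ k dvd (\<pi> ^ (padic_val x + padic_val y) :: 'p padic_int)"
      using u v by (intro padic_p_power_dvd_mult_cancel) (simp add: padic_p_dvd_mult_iff)
    also have "\<dots> \<longleftrightarrow> k \<le> padic_val x + padic_val y"
      by (subst dvd_power_iff) simp_all
    finally show ?thesis .
  qed
  then have "padic_val (x * y) = padic_val x + padic_val y" by (metis dual_order.antisym order_refl)
  then show ?thesis using False by (simp add: padic_norm_def power_add)
qed (auto simp: padic_norm_def)

text \<open>Every nonzero element is a power of p times a unit, so comparing norms is comparing
  divisibility. This turns compatibility into \<open>x - y dvd f x - f y\<close>.\<close>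

lemma padic_norm_le_norm_iff:
  fixes x y :: "'p::prime_card padic_int"
  shows "padic_norm x \<le> padic_norm y \<longleftrightarrow> y dvd x"
proof (cases "y = 0")
  case True
  have "0 < real CARD('p) ^ k" for k
    using prime_gt_0_nat[OF prime_card[where 'a = 'p]] by simp
  with True show ?thesis by (auto simp: padic_norm_def not_le)
next
  case False
  then obtain v where v: "\<not> \<pi> dvd v" "y = \<pi> ^ padic_val y * v" by (metis padic_unit_decomposition)
  have "padic_norm x \<le> padic_norm y \<longleftrightarrow> \<pi> ^ padic_val y dvd x"
    using False padic_norm_le_iff_dvd[of x "padic_val y"] by (simp add: padic_norm_def[of y])
  also have "\<dots> \<longleftrightarrow> y dvd x"
    using v padic_is_unit_iff[of v] by (metis mult_unit_dvd_iff)
  finally show ?thesis .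
qed

section \<open>Difference quotients of functions in the classes \<open>\<A>\<close> and \<open>\<B>\<close>\<close>

text \<open>\<open>Q\<close> is the divided difference of \<open>F\<close>, itself polynomial in
  both variables over the same ring; it therefore respects congruences for every modulus, with no
  constant depending on the degree.\<close>

lemma poly_diff_factor:
  fixes F :: "'a::comm_ring_1 poly"
  shows "\<exists>Q. (\<forall>x x'. poly F x' - poly F x = (x' - x) * Q x x') \<and>
    (\<forall>d x x' z z'. d dvd x - z \<longrightarrow> d dvd x' - z' \<longrightarrow> d dvd Q x x' - Q z z')"
proof (induction F)
  case 0
  show ?case by (intro exI[of _ "\<lambda>_ _. 0"]) simp
next
  case (pCons a F)
  from pCons.IH obtain Q where Q: "\<forall>x x'. poly F x' - poly F x = (x' - x) * Q x x'"
    and Q_cong: "\<forall>d x x' z z'. d dvd x - z \<longrightarrow> d dvd x' - z' \<longrightarrow> d dvd Q x x' - Q z z'"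
    by (elim exE conjE)
  note Q = Q[rule_format] and Q_cong = Q_cong[rule_format]
  show ?case
  proof (intro exI[of _ "\<lambda>x x'. x' * Q x x' + poly F x"] conjI allI impI)
    fix x x'
    have "poly (pCons a F) x' - poly (pCons a F) x = x' * (poly F x' - poly F x) + (x' - x) * poly F x"
      by (simp add: algebra_simps)
    also have "\<dots> = (x' - x) * (x' * Q x x' + poly F x)"
      unfolding Q by (simp add: algebra_simps)
    finally show "poly (pCons a F) x' - poly (pCons a F) x = (x' - x) * (x' * Q x x' + poly F x)" .
  next
    fix d x x' z z' :: 'a
    assume d: "d dvd x - z" "d dvd x' - z'"
    \<comment> \<open>The last summand is \<open>poly F x - poly F z\<close>, rewritten by the
      factorization as \<open>(x - z) * Q z x\<close>.\<close>
    have eq: "x' * Q x x' + poly F x - (z' * Q z z' + poly F z) =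
        (x' - z') * Q x x' + z' * (Q x x' - Q z z') + (x - z) * Q z x"
      unfolding Q[symmetric] by (simp add: algebra_simps)
    show "d dvd x' * Q x x' + poly F x - (z' * Q z z' + poly F z)"
      unfolding eq by (intro dvd_add dvd_mult[OF Q_cong[OF d]] dvd_mult2[OF d(1)] dvd_mult2[OF d(2)])
  qed
qed

lemma padic_inverse_power_less: "0 < e \<Longrightarrow> \<exists>k. 1 / real CARD('p::prime_card) ^ k < e"
proof -
  assume "0 < e"
  have "1 < real CARD('p)"
    using prime_gt_1_nat[OF prime_card[where 'a = 'p]] by simp
  then have "\<exists>k. (1 / real CARD('p)) ^ k < e"
    using \<open>0 < e\<close> by (intro real_arch_pow_inv) simp_all
  then show ?thesis by (simp add: power_one_over)
qed

lemma padic_tendsto_imp_eventually_dvd: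
  fixes s :: "nat \<Rightarrow> 'p::prime_card padic_int"
  assumes "s \<longlonglongrightarrow> l"
  shows "eventually (\<lambda>N. \<pi> ^ m dvd s N - l) sequentially"
proof -
  have "0 < 1 / real CARD('p) ^ m"
    using prime_gt_0_nat[OF prime_card[where 'a = 'p]] by simp
  from tendstoD[OF assms this] show ?thesis
    by eventually_elim (simp add: dist_padic_int_def flip: padic_norm_le_iff_dvd)
qed

text \<open>At -1 all binomials are units, so convergence of the series at this single point already
  forces its coefficients to tend to 0.\<close>

lemma padic_binomial_minus_one: "padic_binomial (- 1 :: 'p::prime_card padic_int) i = (- 1) ^ i"
proof -
  have "(\<Prod>j=0..<i. - 1 - of_nat j :: 'p padic_int) = fact i * (- 1) ^ i"
    by (induction i) (simp_all add: algebra_simps)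
  then have "fact i * padic_binomial (- 1 :: 'p padic_int) i = fact i * (- 1) ^ i"
    by (simp add: fact_mult_padic_binomial)
  then show ?thesis by simp
qed

text \<open>Evaluation at -1 shows that the coefficients tend to 0, which makes the pointwise
  convergent series uniformly convergent. Divisibility of \<open>a i\<close> by
  \<open>fact i\<close> cancels the denominator of the binomial, so the truncation is a polynomial
  over Z_p.\<close>

lemma class_B_polynomial_approximation:
  fixes g :: "'p::prime_card padic_int \<Rightarrow> 'p padic_int"
  assumes "g \<in> class_B"
  shows "\<exists>F. \<forall>x. \<pi> ^ m dvd g x - poly F x"
proof -
  obtain a :: "nat \<Rightarrow> 'p padic_int" where a: "\<And>i. fact i dvd a i"
    and sums: "\<And>x. (\<lambda>i. a i * padic_binomial x i) sums g x"
    using assms unfolding class_B_def by blast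
  define s where "s N x = (\<Sum>i<N. a i * padic_binomial x i)" for N x
  have ev: "eventually (\<lambda>N. \<pi> ^ m dvd s N x - g x) sequentially" for x
    using sums[of x] unfolding sums_def s_def by (rule padic_tendsto_imp_eventually_dvd)
  obtain N where N: "\<And>k. N \<le> k \<Longrightarrow> \<pi> ^ m dvd s k (- 1) - g (- 1)"
    using ev[of "- 1"] unfolding eventually_sequentially by blast
  have a_dvd: "\<pi> ^ m dvd a k" if "N \<le> k" for k
  proof -
    have "\<pi> ^ m dvd (s (Suc k) (- 1) - g (- 1)) - (s k (- 1) - g (- 1))"
      using that by (intro dvd_diff N) simp_all
    then have "\<pi> ^ m dvd a k * (- 1) ^ k" by (simp add: s_def padic_binomial_minus_one)
    then have "\<pi> ^ m dvd a k * (- 1) ^ k * (- 1) ^ k" by (rule dvd_mult2)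
    then show ?thesis by (simp add: mult.assoc flip: power_mult_distrib)
  qed
  have s_dvd: "\<pi> ^ m dvd s k x - s N x" if "N \<le> k" for k x
    using that
  proof (induction k rule: dec_induct)
    case (step k)
    have "\<pi> ^ m dvd (s k x - s N x) + a k * padic_binomial x k"
      using step a_dvd[of k] by (intro dvd_add) simp_all
    then show ?case by (simp add: s_def algebra_simps)
  qed simp
  obtain c where c: "\<And>i. a i = fact i * c i" using a unfolding dvd_def by metis
  define F where "F = (\<Sum>i<N. Polynomial.smult (c i) (\<Prod>j=0..<i. [:- of_nat j, 1:]))"
  have F: "poly F x = s N x" for x
    unfolding F_def s_def poly_sum poly_smult poly_prod c
    by (intro sum.cong refl) (simp add: mult_ac flip: fact_mult_padic_binomial)
  have "\<pi> ^ m dvd g x - poly F x" for x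
  proof -
    \<comment> \<open>\<open>k\<close> depends on \<open>x\<close>, but the truncation index
      \<open>N\<close> does not.\<close>
    obtain k where k: "N \<le> k" "\<pi> ^ m dvd s k x - g x"
      using ev[of x] unfolding eventually_sequentially by (meson linear order_refl)
    have "\<pi> ^ m dvd (s k x - s N x) - (s k x - g x)"
      using s_dvd[OF k(1)] k(2) by (rule dvd_diff)
    then show ?thesis by (simp add: F)
  qed
  then show ?thesis by blast
qed

text \<open>The difference quotients of \<open>g\<close> at \<open>(x, x')\<close> and \<open>(z, z')\<close> agree modulo \<open>p\<^sup>r\<close>, with denominators cleared.\<close>

lemma class_B_difference_quotient_cong:
  fixes g :: "'p::prime_card padic_int \<Rightarrow> 'p padic_int"
  assumes g: "g \<in> class_B" and xz: "\<pi> ^ r dvd x - z" "\<pi> ^ r dvd x' - z'"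
  shows "\<pi> ^ r * ((x' - x) * (z' - z)) dvd (g x' - g x) * (z' - z) - (g z' - g z) * (x' - x)"
proof -
  define w where "w = \<pi> ^ r * ((x' - x) * (z' - z))"
  define E where "E h = (h x' - h x) * (z' - z) - (h z' - h z) * (x' - x)" for h
  have "w dvd E g"
  proof (cases "w = 0")
    case True
    then have "x' = x \<or> z' = z" by (auto simp: w_def)
    then show ?thesis by (auto simp: E_def)
  next
    case False
    then obtain u where u: "\<not> \<pi> dvd u" "w = \<pi> ^ padic_val w * u" by (metis padic_unit_decomposition)
    define m where "m = padic_val w"
    \<comment> \<open>The precision \<open>m\<close> is chosen so that the approximation error, a
      multiple of p^m, is absorbed by the modulus \<open>w\<close>. The degree of \<open>F\<close>
      grows with \<open>m\<close>, which is harmless for the congruences of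
      \<open>Q\<close>.\<close>
    have w: "w dvd \<pi> ^ m" using u padic_is_unit_iff[of u] unfolding m_def
      by (metis dvd_refl mult_unit_dvd_iff)
    obtain F where F: "\<And>x. \<pi> ^ m dvd g x - poly F x"
      using class_B_polynomial_approximation[OF g] by blast
    obtain Q where Q: "\<And>x x'. poly F x' - poly F x = (x' - x) * Q x x'"
      and Q_cong: "\<And>d x x' z z'. d dvd x - z \<Longrightarrow> d dvd x' - z' \<Longrightarrow> d dvd Q x x' - Q z z'"
      using poly_diff_factor[of F] by metis
    have "E (poly F) = (Q x x' - Q z z') * ((x' - x) * (z' - z))"
      unfolding E_def Q by (simp add: algebra_simps)
    then have 1: "w dvd E (poly F)"
      unfolding w_def using Q_cong[OF xz] by (auto intro: mult_dvd_mono)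
    have "\<pi> ^ m dvd ((g x' - poly F x') - (g x - poly F x)) * (z' - z) -
        ((g z' - poly F z') - (g z - poly F z)) * (x' - x)"
      by (intro dvd_diff dvd_mult2 F)
    then have "\<pi> ^ m dvd E g - E (poly F)"
      by (simp add: E_def algebra_simps)
    with w have "w dvd E g - E (poly F)" by (rule dvd_trans)
    from dvd_add[OF this 1] show ?thesis by simp
  qed
  then show ?thesis by (simp add: w_def E_def)
qed

text \<open>Cancelling p^n lowers the precision from r to r - n digits; this is how n enters the
  bound on r.\<close>

lemma scaled_class_B_difference_quotient_cong:
  fixes f :: "'p::prime_card padic_int \<Rightarrow> 'p padic_int"
  assumes "(\<lambda>x. \<pi> ^ n * f x) \<in> class_B" "n \<le> r" "\<pi> ^ r dvd x - z" "\<pi> ^ r dvd x' - z'"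
  shows "\<pi> ^ (r - n) * ((x' - x) * (z' - z)) dvd (f x' - f x) * (z' - z) - (f z' - f z) * (x' - x)"
proof -
  have "\<pi> ^ r = (\<pi> ^ n * \<pi> ^ (r - n) :: 'p padic_int)" using assms(2) by (simp flip: power_add)
  then have "\<pi> ^ n * (\<pi> ^ (r - n) * ((x' - x) * (z' - z))) dvd
      \<pi> ^ n * ((f x' - f x) * (z' - z) - (f z' - f z) * (x' - x))"
    using class_B_difference_quotient_cong[OF assms(1,3,4)] by (simp add: algebra_simps)
  then show ?thesis by (subst (asm) dvd_mult_cancel_left) auto
qed

section \<open>Existence, uniqueness and precision of the derivative\<close>

lemma compatible_iff_dvd: "compatible f \<longleftrightarrow> (\<forall>x y. x - y dvd f x - f y)"
  by (simp add: compatible_def padic_norm_le_norm_iff)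

text \<open>The powers of p are nonzero and tend to 0, so 0 is not isolated; this is what makes the
  derivative unique.\<close>

lemma eventually_at_0_padic_p_power:
  assumes "eventually P (at (0 :: 'p::prime_card padic_int))"
  shows "\<exists>k. P (\<pi> ^ k)"
proof -
  obtain d where d: "0 < d" "\<And>x :: 'p padic_int. x \<noteq> 0 \<Longrightarrow> dist x 0 < d \<Longrightarrow> P x"
    using assms unfolding eventually_at by auto
  obtain k where k: "1 / real CARD('p) ^ k < d"
    using padic_inverse_power_less[OF d(1)] by blast
  have "padic_norm (\<pi> ^ k :: 'p padic_int) \<le> 1 / real CARD('p) ^ k"
    by (simp add: padic_norm_le_iff_dvd)
  then have "P (\<pi> ^ k)" using k by (intro d(2)) (simp_all add: dist_padic_int_def)
  then show ?thesis ..
qed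

lemma has_padic_derivative_unique:
  fixes f :: "'p::prime_card padic_int \<Rightarrow> 'p padic_int"
  assumes "has_padic_derivative f D y" "has_padic_derivative f D' y"
  shows "D = D'"
proof (rule ccontr)
  assume "D \<noteq> D'"
  define q where "q D h = padic_norm (f (y + h) - f y - D * h) / padic_norm h" for D h
  have q0: "0 \<le> q D h" for D h by (simp add: q_def padic_norm_def)
  have "0 < padic_norm (D' - D)"
    using \<open>D \<noteq> D'\<close> prime_gt_0_nat[OF prime_card[where 'a = 'p]] by (simp add: padic_norm_def)
  then have pos: "0 < padic_norm (D' - D) / 2" by simp
  have "eventually (\<lambda>h. dist (q D h) 0 < padic_norm (D' - D) / 2) (at 0)"
       "eventually (\<lambda>h. dist (q D' h) 0 < padic_norm (D' - D) / 2) (at 0)"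
    using assms[unfolded has_padic_derivative_def] tendstoD[OF _ pos] unfolding q_def by blast+
  then have "eventually (\<lambda>h. q D h + q D' h < padic_norm (D' - D)) (at 0)"
    by eventually_elim (use q0 in \<open>simp add: dist_real_def\<close>)
  then obtain k where k: "q D (\<pi> ^ k) + q D' (\<pi> ^ k) < padic_norm (D' - D)"
    using eventually_at_0_padic_p_power by blast
  define h where "h = (\<pi> ^ k :: 'p padic_int)"
  have h: "0 < padic_norm h"
    using prime_gt_0_nat[OF prime_card[where 'a = 'p]] by (simp add: padic_norm_def h_def)
  have "padic_norm (D' - D) * padic_norm h =
      dist (f (y + h) - f y - D * h) (f (y + h) - f y - D' * h)"
    unfolding dist_padic_int_def padic_norm_mult[symmetric] by (rule arg_cong[of _ _ padic_norm]) (simp add: algebra_simps)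
  also have "\<dots> \<le> dist (f (y + h) - f y - D * h) 0 + dist (f (y + h) - f y - D' * h) 0"
    by (rule dist_triangle2)
  also have "\<dots> = (q D h + q D' h) * padic_norm h"
    using h by (simp add: q_def dist_padic_int_def field_simps)
  finally show False using k h by (simp add: h_def)
qed

lemma has_padic_derivative_imp_padic_deriv: "has_padic_derivative f D y \<Longrightarrow> padic_deriv f y = D"
  unfolding padic_deriv_def using has_padic_derivative_unique by blast

text \<open>Existence of the derivative is part of the argument. The difference quotients
  \<open>q k\<close> at \<open>y\<close> with step p^k form a Cauchy sequence, their limit
  \<open>D\<close> inherits the bound for every pair of points of the ball, and the bound for pairs
  starting at \<open>y\<close> identifies \<open>D\<close> as the derivative.\<close>

lemma padic_deriv_difference_bound:
  fixes f :: "'p::prime_card padic_int \<Rightarrow> 'p padic_int"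
  assumes compat: "compatible f" and B: "(\<lambda>x. \<pi> ^ n * f x) \<in> class_B"
    and r: "n \<le> r" and xy: "\<pi> ^ r dvd x - y" "\<pi> ^ r dvd x' - y"
  shows "\<pi> ^ (r - n) * (x' - x) dvd f x' - f x - padic_deriv f y * (x' - x)"
proof -
  have "\<exists>q. f (y + \<pi> ^ k) - f y = \<pi> ^ k * q" for k
    using compat[unfolded compatible_iff_dvd] by (metis add_diff_cancel_left' dvdE)
  then obtain q where q: "\<And>k. f (y + \<pi> ^ k) - f y = \<pi> ^ k * q k" by metis
  \<comment> \<open>The pair \<open>(x, x')\<close> is compared with
    \<open>(y, y + \<pi> ^ k)\<close>; the condition \<open>r \<le> k\<close> keeps this second pair
    in the ball modulo p^r.\<close>
  have *: "\<pi> ^ (r - n) * (x' - x) dvd f x' - f x - q k * (x' - x)"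
    if "n \<le> r" "r \<le> k" "\<pi> ^ r dvd x - y" "\<pi> ^ r dvd x' - y" for r k x x'
  proof -
    have "\<pi> ^ r dvd x' - (y + \<pi> ^ k)"
      using dvd_diff[OF that(4) le_imp_power_dvd[OF that(2)]] by (simp add: algebra_simps)
    from scaled_class_B_difference_quotient_cong[OF B that(1,3) this]
    have "\<pi> ^ k * (\<pi> ^ (r - n) * (x' - x)) dvd \<pi> ^ k * (f x' - f x - q k * (x' - x))"
      unfolding add_diff_cancel_left' q by (simp only: algebra_simps)
    then show ?thesis by (subst (asm) dvd_mult_cancel_left) auto
  qed
  \<comment> \<open>The index is shifted by n because quotients at level n + k are only shown to
    agree modulo p^k.\<close>
  have "\<pi> ^ k dvd q (n + Suc k) - q (n + k)" for k
  proof -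
    have "\<pi> ^ k * \<pi> ^ (n + Suc k) dvd \<pi> ^ (n + Suc k) * (q (n + Suc k) - q (n + k))"
      using *[of "n + k" "n + k" y "y + \<pi> ^ (n + Suc k)"] le_imp_power_dvd[of "n + k" "n + Suc k"]
      unfolding add_diff_cancel_left' q by (simp add: algebra_simps)
    then show ?thesis by (subst (asm) mult.commute, subst (asm) dvd_mult_cancel_left) auto
  qed
  then obtain D where D: "\<And>k. \<pi> ^ k dvd D - q (n + k)"
    using padic_complete[of "\<lambda>k. q (n + k)"] by blast
  have D_bound: "\<pi> ^ (r - n) * (x' - x) dvd f x' - f x - D * (x' - x)"
    if "n \<le> r" "\<pi> ^ r dvd x - y" "\<pi> ^ r dvd x' - y" for r x x'
  proof -
    have "\<pi> ^ (r - n) * (x' - x) dvd (D - q r) * (x' - x)"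
      using D[of "r - n"] that(1) by (intro mult_dvd_mono) simp_all
    from dvd_diff[OF *[OF that(1) order_refl that(2,3)] this] show ?thesis
      by (simp add: algebra_simps)
  qed
  have "has_padic_derivative f D y"
    unfolding has_padic_derivative_def
  proof (rule tendstoI)
    fix e :: real assume "0 < e"
    then obtain m where m: "1 / real CARD('p) ^ m < e" using padic_inverse_power_less by blast
    have small: "padic_norm (f (y + h) - f y - D * h) / padic_norm h < e"
      if h: "h \<noteq> 0" "padic_norm h < 1 / real CARD('p) ^ (n + m)" for h
    proof -
      have "\<pi> ^ (n + m) dvd h" using h(2) by (simp flip: padic_norm_le_iff_dvd)
      then have "\<pi> ^ m * h dvd f (y + h) - f y - D * h"
        using D_bound[of "n + m" y "y + h"] by simp
      then obtain w where "f (y + h) - f y - D * h = \<pi> ^ m * h * w" by (rule dvdE)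
      then have w: "f (y + h) - f y - D * h = h * (\<pi> ^ m * w)" by (simp add: mult_ac)
      have "padic_norm h \<noteq> 0"
        using h(1) by (simp add: padic_norm_def)
      then have "padic_norm (f (y + h) - f y - D * h) / padic_norm h = padic_norm (\<pi> ^ m * w)"
        unfolding w padic_norm_mult by simp
      also have "\<dots> \<le> 1 / real CARD('p) ^ m" by (simp add: padic_norm_le_iff_dvd)
      finally show ?thesis using m by simp
    qed
    have "0 < 1 / real CARD('p) ^ (n + m)"
      using prime_gt_0_nat[OF prime_card[where 'a = 'p]] by simp
    moreover have "0 \<le> padic_norm x" for x :: "'p padic_int" by (simp add: padic_norm_def)
    ultimately show "eventually (\<lambda>h. dist (padic_norm (f (y + h) - f y - D * h) / padic_norm h) 0 < e) (at 0)"
      unfolding eventually_at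
      by (intro exI[of _ "1 / real CARD('p) ^ (n + m)"]) (auto simp: dist_padic_int_def dist_real_def small)
  qed
  then have "padic_deriv f y = D" by (rule has_padic_derivative_imp_padic_deriv)
  then show ?thesis using D_bound[OF r xy] by simp
qed

section \<open>Transitivity on the units\<close>

text \<open>Difference quotients of \<open>\<phi>\<close> are all congruent to \<open>E\<close> modulo \<open>m\<close>, with denominators cleared.\<close>

definition has_slope_mod :: "'a::comm_ring_1 \<Rightarrow> ('a \<Rightarrow> 'a) \<Rightarrow> 'a \<Rightarrow> bool" where
  "has_slope_mod m \<phi> E \<longleftrightarrow> (\<forall>u v. m * (v - u) dvd \<phi> v - \<phi> u - E * (v - u))"

lemma has_slope_modE:
  assumes "has_slope_mod m \<phi> E"
  obtains e where "\<phi> v - \<phi> u = (v - u) * (E + m * e)"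
proof -
  obtain e where "\<phi> v - \<phi> u - E * (v - u) = m * (v - u) * e"
    using assms unfolding has_slope_mod_def by (meson dvdE)
  then have "\<phi> v - \<phi> u = E * (v - u) + m * (v - u) * e" by (simp add: diff_eq_eq add.commute)
  then show ?thesis using that[of e] by (simp add: algebra_simps)
qed

text \<open>Chain rule: increments multiply, and a relative error modulo \<open>m\<close> stays
  relative.\<close>

lemma has_slope_mod_comp:
  assumes "has_slope_mod m \<phi> E" "has_slope_mod m \<psi> E'"
  shows "has_slope_mod m (\<lambda>u. \<phi> (\<psi> u)) (E * E')"
  unfolding has_slope_mod_def
proof (intro allI)
  fix u v
  obtain e' where e': "\<psi> v - \<psi> u = (v - u) * (E' + m * e')" using assms(2) by (rule has_slope_modE)
  obtain e where "\<phi> (\<psi> v) - \<phi> (\<psi> u) = (\<psi> v - \<psi> u) * (E + m * e)" using assms(1) by (rule has_slope_modE)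
  then have "\<phi> (\<psi> v) - \<phi> (\<psi> u) - E * E' * (v - u) =
      m * (v - u) * (E' * e + E * e' + m * e' * e)"
    unfolding e' by (simp add: algebra_simps)
  then show "m * (v - u) dvd \<phi> (\<psi> v) - \<phi> (\<psi> u) - E * E' * (v - u)"
    by simp
qed

lemma has_slope_mod_funpow:
  assumes "has_slope_mod m \<phi> E"
  shows "has_slope_mod m (\<phi> ^^ j) (E ^ j)"
proof (induction j)
  case 0
  show ?case by (simp add: has_slope_mod_def)
next
  case (Suc j)
  then show ?case using has_slope_mod_comp[OF assms Suc] by (simp add: comp_def)
qed

text \<open>One more step turns the displacement \<open>d * s\<close> into
  \<open>d * (1 + E * s)\<close> up to a multiple of \<open>d * m\<close>, which is the recursion of
  the geometric sum. As the error keeps the factor \<open>d\<close>, no precision is lost however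
  small \<open>d\<close> is.\<close>

lemma has_slope_mod_funpow_displacement:
  fixes \<psi> :: "'a::comm_ring_1 \<Rightarrow> 'a"
  assumes slope: "has_slope_mod m \<psi> E" and step: "\<psi> u = u + d"
  shows "\<exists>s. (\<psi> ^^ j) u = u + d * s \<and> m dvd s - (\<Sum>i<j. E ^ i)"
proof (induction j)
  case 0
  show ?case by (intro exI[of _ 0]) simp
next
  case (Suc j)
  then obtain s where s: "(\<psi> ^^ j) u = u + d * s" "m dvd s - (\<Sum>i<j. E ^ i)" by (elim exE conjE)
  obtain e where e: "\<psi> (u + d * s) - \<psi> u = (u + d * s - u) * (E + m * e)"
    using slope by (rule has_slope_modE)
  have 1: "(\<psi> ^^ Suc j) u = u + d * (1 + E * s + m * (e * s))"
    using e by (simp add: s(1) step algebra_simps)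
  have eq: "1 + E * s + m * (e * s) - (\<Sum>i<Suc j. E ^ i) = E * (s - (\<Sum>i<j. E ^ i)) + m * (e * s)"
    unfolding sum.lessThan_Suc_shift by (simp add: algebra_simps sum_distrib_left)
  have 2: "m dvd 1 + E * s + m * (e * s) - (\<Sum>i<Suc j. E ^ i)"
    unfolding eq using s(2) by (intro dvd_add dvd_mult dvd_triv_left)
  from 1 2 show ?case by (intro exI[of _ "1 + E * s + m * (e * s)"]) (rule conjI)
qed

section \<open>Geometric sums modulo p^2 and lifting of transitivity to all powers of p\<close>

lemma power_one_plus_dvd:
  fixes a t :: "'a::comm_ring_1"
  shows "a ^ 2 dvd (1 + a * t) ^ i - (1 + of_nat i * (a * t))"
proof (induction i)
  case (Suc i)
  have "(1 + a * t) ^ Suc i - (1 + of_nat (Suc i) * (a * t)) =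
      (1 + a * t) * ((1 + a * t) ^ i - (1 + of_nat i * (a * t))) + a ^ 2 * (of_nat i * t ^ 2)"
    by (simp add: algebra_simps power2_eq_square)
  then show ?case using Suc by simp
qed simp

lemma dvd_power_diff_one: "d dvd E - (1 :: 'a::comm_ring_1) \<Longrightarrow> d dvd E ^ i - 1"
  by (metis dvd_trans dvd_triv_left power_diff_1_eq)

lemma sum_powers_cong_of_nat:
  assumes "d dvd E - (1 :: 'a::comm_ring_1)"
  shows "d dvd (\<Sum>i<j. E ^ i) - of_nat j"
proof -
  have "(\<Sum>i<j. E ^ i) - of_nat j = (\<Sum>i<j. E ^ i - 1)" by (simp add: sum_subtractf)
  also have "d dvd \<dots>" using dvd_power_diff_one[OF assms] by (intro dvd_sum) simp
  finally show ?thesis .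
qed

text \<open>With E = 1 + p t the first-order term of the sum is p t times p (p - 1) / 2, which p^2
  divides if p is odd. For p = 2 the sum is 1 + E, whence the stronger hypothesis modulo 4.\<close>

lemma sum_powers_cong_p:
  fixes E :: "'p::prime_card padic_int"
  assumes E: "\<pi> dvd E - 1" and two: "CARD('p) = 2 \<Longrightarrow> \<pi> ^ 2 dvd E - 1"
  shows "\<pi> ^ 2 dvd (\<Sum>i<CARD('p). E ^ i) - \<pi>"
proof (cases "CARD('p) = 2")
  case True
  show ?thesis by (rule sum_powers_cong_of_nat[OF two[OF True]])
next
  case False
  define q where "q = CARD('p)"
  have "odd q" using False prime_odd_nat[OF prime_card[where 'a = 'p]] prime_ge_2_nat[OF prime_card[where 'a = 'p]]
    unfolding q_def by linarith
  then obtain h where h: "q = 2 * h + 1" by (rule oddE)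
  obtain t where t: "E - 1 = \<pi> * t" using E by (rule dvdE)
  then have E': "E = 1 + of_nat q * t" by (simp add: q_def algebra_simps)
  have "(of_nat q :: 'p padic_int) ^ 2 dvd (\<Sum>i<q. E ^ i - (1 + of_nat i * (of_nat q * t)))"
    unfolding E' by (intro dvd_sum power_one_plus_dvd)
  moreover have "(\<Sum>i<q. 1 + of_nat i * (of_nat q * t)) = of_nat q + (of_nat q :: 'p padic_int) ^ 2 * (of_nat h * t)"
  proof -
    have "(\<Sum>i<q. i) = q * h"
      using gauss_sum_nat[of "2 * h"] unfolding h atLeast0AtMost
      by (simp add: lessThan_Suc_atMost mult_ac)
    then have "(\<Sum>i<q. of_nat i :: 'p padic_int) = of_nat (q * h)"
      by (simp only: flip: of_nat_sum)
    then show ?thesis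
      by (simp add: sum.distrib power2_eq_square mult.assoc flip: sum_distrib_right)
  qed
  ultimately have "(of_nat q :: 'p padic_int) ^ 2 dvd (\<Sum>i<q. E ^ i) - (of_nat q + of_nat q ^ 2 * (of_nat h * t))"
    by (simp only: sum_subtractf)
  from dvd_add[OF this dvd_triv_left[of "of_nat q ^ 2" "of_nat h * t"]]
  show ?thesis by (simp add: q_def algebra_simps)
qed

lemma padic_p_power_mult_dvd_mult_iff:
  "(\<pi> ^ k * a :: 'p::prime_card padic_int) dvd \<pi> ^ k * b \<longleftrightarrow> a dvd b"
  by (subst dvd_mult_cancel_left) auto

text \<open>Since \<open>1 + E + \<dots> + E\<^sup>p\<^sup>-\<^sup>1 \<equiv> p\<close> modulo \<open>p\<^sup>2\<close>, passing to the \<open>p\<close>-th iterate multiplies displacements by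
  \<open>p\<close> up to a unit.\<close>

lemma funpow_p_displacement:
  fixes \<psi> :: "'p::prime_card padic_int \<Rightarrow> 'p padic_int"
  assumes slope: "has_slope_mod (\<pi> ^ 2) \<psi> E"
    and E: "\<pi> dvd E - 1" "CARD('p) = 2 \<Longrightarrow> \<pi> ^ 2 dvd E - 1"
    and step: "\<psi> u = u + \<pi> ^ k * w" "\<not> \<pi> dvd w"
  shows "\<exists>w'. \<not> \<pi> dvd w' \<and> (\<psi> ^^ CARD('p)) u = u + \<pi> ^ Suc k * w'"
proof -
  obtain s where s: "(\<psi> ^^ CARD('p)) u = u + \<pi> ^ k * w * s" "\<pi> ^ 2 dvd s - (\<Sum>i<CARD('p). E ^ i)"
    using has_slope_mod_funpow_displacement[OF slope step(1)] by metis
  have "\<pi> ^ 2 dvd s - \<pi>" using dvd_add[OF s(2) sum_powers_cong_p[OF E]] by simp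
  then obtain c where "s - \<pi> = \<pi> ^ 2 * c" by (rule dvdE)
  then have c: "s = \<pi> * (1 + \<pi> * c)" by (simp add: algebra_simps power2_eq_square)
  have "\<not> \<pi> dvd 1 + \<pi> * c" by (simp add: dvd_add_left_iff)
  then have "\<not> \<pi> dvd w * (1 + \<pi> * c)" using step(2) by (simp add: padic_p_dvd_mult_iff)
  moreover have "(\<psi> ^^ CARD('p)) u = u + \<pi> ^ Suc k * (w * (1 + \<pi> * c))"
    unfolding s(1) c by (simp add: mult_ac)
  ultimately show ?thesis by blast
qed

text \<open>\<open>N\<close> is the length of a return, later p - 1 for odd p and 1 for p = 2. Its
  p^l-fold iterate moves each unit by exactly p^(l+1). An orbit point agreeing with \<open>v\<close>
  modulo p^k can thus be pushed in steps of size exactly p^k until it agrees modulo p^(k+1).\<close>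

lemma units_transitive_lift:
  fixes \<phi> :: "'p::prime_card padic_int \<Rightarrow> 'p padic_int"
  assumes slope: "has_slope_mod (\<pi> ^ 2) \<phi> D"
    and units: "\<And>u. \<not> \<pi> dvd u \<Longrightarrow> \<not> \<pi> dvd \<phi> u"
    and trans: "\<And>u v. \<not> \<pi> dvd u \<Longrightarrow> \<not> \<pi> dvd v \<Longrightarrow> \<exists>j. \<pi> dvd (\<phi> ^^ j) u - v"
    and return: "\<And>u. \<not> \<pi> dvd u \<Longrightarrow> \<exists>w. \<not> \<pi> dvd w \<and> (\<phi> ^^ N) u = u + \<pi> * w"
    and E: "\<pi> dvd D ^ N - 1" "CARD('p) = 2 \<Longrightarrow> \<pi> ^ 2 dvd D ^ N - 1"
    and uv: "\<not> \<pi> dvd u" "\<not> \<pi> dvd v"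
  shows "\<exists>j. \<pi> ^ k dvd (\<phi> ^^ j) u - v"
proof -
  have units_iter: "\<not> \<pi> dvd (\<phi> ^^ j) u" if "\<not> \<pi> dvd u" for j u
    using that by (induction j) (auto simp: units)
  have ret: "\<exists>w. \<not> \<pi> dvd w \<and> (\<phi> ^^ (N * CARD('p) ^ k)) u = u + \<pi> ^ Suc k * w" if "\<not> \<pi> dvd u" for k u
  proof (induction k)
    case 0
    then show ?case using return[OF that] by simp
  next
    case (Suc k)
    define M where "M = N * CARD('p) ^ k"
    have M: "D ^ M = (D ^ N) ^ (CARD('p) ^ k)" by (simp add: M_def power_mult)
    obtain w where "\<not> \<pi> dvd w" "(\<phi> ^^ M) u = u + \<pi> ^ Suc k * w" using Suc by (auto simp: M_def)
    moreover have "has_slope_mod (\<pi> ^ 2) (\<phi> ^^ M) (D ^ M)" by (rule has_slope_mod_funpow[OF slope])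
    moreover have "\<pi> dvd D ^ M - 1" "CARD('p) = 2 \<Longrightarrow> \<pi> ^ 2 dvd D ^ M - 1"
      unfolding M using E dvd_power_diff_one by blast+
    ultimately have "\<exists>w'. \<not> \<pi> dvd w' \<and> ((\<phi> ^^ M) ^^ CARD('p)) u = u + \<pi> ^ Suc (Suc k) * w'"
      by (intro funpow_p_displacement)
    then show ?case by (simp add: funpow_mult M_def mult_ac)
  qed
  show ?thesis
  proof (induction k)
    case (Suc k)
    show ?case
    proof (cases k)
      case 0
      then show ?thesis using trans[OF uv] by simp
    next
      case (Suc l)
      obtain j where j: "\<pi> ^ k dvd (\<phi> ^^ j) u - v" using Suc.IH by blast
      then obtain c where c: "(\<phi> ^^ j) u - v = \<pi> ^ k * c" by (rule dvdE)
      define x where "x = (\<phi> ^^ j) u"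
      define M where "M = N * CARD('p) ^ l"
      have x: "\<not> \<pi> dvd x" unfolding x_def by (rule units_iter[OF uv(1)])
      obtain w where w: "\<not> \<pi> dvd w" "(\<phi> ^^ M) x = x + \<pi> ^ k * w"
        using ret[OF x, of l] Suc by (auto simp: M_def)
      have "w dvd 1" using w(1) padic_is_unit_iff by blast
      then obtain w' where w': "1 = w * w'" by (rule dvdE)
      \<comment> \<open>\<open>i\<close> solves \<open>c + w * i = 0\<close> modulo p, so that
        \<open>i\<close> steps of displacement p^k w cancel the remaining error p^k c.\<close>
      obtain i where i: "\<pi> dvd - (c * w') - of_nat i"
        using padic_cong_of_nat[of 1] by (auto simp only: power_one_right)
      have "\<pi> dvd D ^ M - 1"
        using E(1) dvd_power_diff_one unfolding M_def power_mult by blast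
      from sum_powers_cong_of_nat[OF this]
      have sum: "\<pi> dvd (\<Sum>t<i. (D ^ M) ^ t) - of_nat i" .
      obtain s where s: "((\<phi> ^^ M) ^^ i) x = x + \<pi> ^ k * w * s" "\<pi> ^ 2 dvd s - (\<Sum>t<i. (D ^ M) ^ t)"
        using has_slope_mod_funpow_displacement[OF has_slope_mod_funpow[OF slope] w(2)] by metis
      have "\<pi> dvd s - (\<Sum>t<i. (D ^ M) ^ t)" using s(2) by (metis dvd_mult_left power2_eq_square)
      then have "\<pi> dvd (s - (\<Sum>t<i. (D ^ M) ^ t) + ((\<Sum>t<i. (D ^ M) ^ t) - of_nat i)) - (- (c * w') - of_nat i)"
        by (rule dvd_diff[OF dvd_add[OF _ sum] i])
      then have "\<pi> dvd s + c * w'" by (simp add: algebra_simps)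
      then have "\<pi> dvd w * (s + c * w')" by (rule dvd_mult)
      also have "w * (s + c * w') = w * s + c * (w * w')" by (simp add: algebra_simps)
      finally have *: "\<pi> dvd w * s + c" by (simp flip: w')
      have "((\<phi> ^^ M) ^^ i) x - v = \<pi> ^ k * (w * s + c)"
        using c unfolding s(1) x_def[symmetric] by (simp add: algebra_simps)
      moreover have "((\<phi> ^^ M) ^^ i) x = (\<phi> ^^ (M * i + j)) u"
        by (simp add: funpow_mult funpow_add x_def)
      moreover have "\<pi> ^ Suc k dvd \<pi> ^ k * (w * s + c)"
        unfolding power_Suc2 using * by (intro mult_dvd_mono) simp_all
      ultimately show ?thesis by metis
    qed
  qed simp
qed

section \<open>Generators of the group of units modulo p^2\<close>

lemma dvd_iff_of_dvd_diff:
  fixes x y :: "'a::comm_ring_1"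
  shows "d dvd x - y \<Longrightarrow> d dvd x \<longleftrightarrow> d dvd y"
  by (metis diff_add_cancel dvd_add_right_iff)

lemma padic_residue_power:
  "padic_residue k (x ^ j :: 'p::prime_card padic_int) = padic_residue k x ^ j mod int CARD('p) ^ k"
  by (induction j) (simp_all add: padic_residue_1 padic_residue_mult mod_simps)

lemma padic_cong_power:
  fixes x y :: "'a::comm_ring_1"
  assumes "d dvd x - y"
  shows "d dvd x ^ j - y ^ j"
  using assms by (metis dvd_mult2 power_diff_sumr2)

lemma padic_fermat:
  fixes x :: "'p::prime_card padic_int"
  assumes "\<not> \<pi> dvd x"
  shows "\<pi> dvd x ^ (CARD('p) - 1) - 1"
proof -
  obtain a where a: "\<pi> dvd x - of_nat a" using padic_cong_of_nat[of 1 x] by auto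
  then have "\<not> \<pi> dvd (of_nat a :: 'p padic_int)" using assms dvd_iff_of_dvd_diff by blast
  then have "\<not> CARD('p) dvd a" using padic_of_nat_dvd_iff[of 1 a, where 'p = 'p] by simp
  then have "[int (a ^ (CARD('p) - 1)) = int 1] (mod int CARD('p))"
    unfolding cong_int_iff by (intro fermat_theorem prime_card)
  then have "(\<pi> ^ 1 :: 'p padic_int) dvd of_int (int (a ^ (CARD('p) - 1)) - int 1)"
    unfolding padic_of_int_dvd_iff by (simp add: cong_iff_dvd_diff)
  then have "(\<pi> :: 'p padic_int) dvd of_nat a ^ (CARD('p) - 1) - 1" by simp
  from dvd_add[OF padic_cong_power[OF a, of "CARD('p) - 1"] this] show ?thesis by simp
qed

lemma padic_residue_in_units_iff:
  fixes u :: "'p::prime_card padic_int"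
  assumes "0 < k"
  shows "padic_residue k u \<in> carrier (units_of (residue_ring (int CARD('p) ^ k))) \<longleftrightarrow> \<not> \<pi> dvd u"
proof -
  have "1 < int CARD('p) ^ k"
    using assms prime_gt_1_int[OF CARD_prime_int[where 'p = 'p]] by simp
  then interpret residues "int CARD('p) ^ k" "residue_ring (int CARD('p) ^ k)"
    by unfold_locales simp_all
  have "coprime (int CARD('p)) a \<longleftrightarrow> \<not> int CARD('p) dvd a" for a
    using prime_imp_coprime[OF CARD_prime_int[where 'p = 'p], of a]
      not_prime_unit[of "int CARD('p)"] CARD_prime_int[where 'p = 'p]
    by (metis coprime_common_divisor dvd_refl)
  then have "coprime (padic_residue k u) (int CARD('p) ^ k) \<longleftrightarrow> \<not> int CARD('p) ^ 1 dvd padic_residue k u"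
    using assms by (simp add: coprime_commute[of "padic_residue k u"])
  also have "\<dots> \<longleftrightarrow> \<not> \<pi> dvd u"
    using assms padic_residue_dvd_iff[of 1 k u] by (simp add: padic_residue_eq_0_iff_dvd)
  finally have cop: "coprime (padic_residue k u) (int CARD('p) ^ k) \<longleftrightarrow> \<not> \<pi> dvd u" .
  have "padic_residue k u \<noteq> 0" if "\<not> \<pi> dvd u"
    using that assms by (auto simp: padic_residue_eq_0_iff_dvd dest: dvd_trans[rotated])
  then have "0 < padic_residue k u" if "\<not> \<pi> dvd u"
    using that padic_residue_bounds(1)[of k u] by (metis order_le_less)
  with cop show ?thesis by (auto simp: units_of_carrier res_units_eq)
qed

text \<open>The unit group is finite, so the subgroup generated by one element consists of its
  powers with natural exponents. This replaces group notation by divisibility in Z_p.\<close>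

lemma generates_units_mod_p2_iff:
  fixes x :: "'p::prime_card padic_int"
  shows "generates_units_mod_p2 x \<longleftrightarrow> \<not> \<pi> dvd x \<and> (\<forall>v. \<not> \<pi> dvd v \<longrightarrow> (\<exists>j. \<pi> ^ 2 dvd x ^ j - v))"
proof -
  define q where "q = int CARD('p) ^ 2"
  define R where "R = residue_ring q"
  define G where "G = units_of R"
  have "1 < q"
    using prime_gt_1_int[OF CARD_prime_int[where 'p = 'p]] by (simp add: q_def)
  then interpret residues q R
    by unfold_locales (simp_all add: R_def)
  interpret G: group G unfolding G_def by (rule units_group)
  have carrier: "padic_residue 2 u \<in> carrier G \<longleftrightarrow> \<not> \<pi> dvd u" for u :: "'p padic_int"
    unfolding G_def R_def q_def by (rule padic_residue_in_units_iff) simp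
  have pow: "padic_residue 2 x [^]\<^bsub>G\<^esub> j = padic_residue 2 (x ^ j)" if "\<not> \<pi> dvd x" for j :: nat
  proof -
    have "padic_residue 2 x \<in> Units R" using that carrier[of x] by (simp add: G_def units_of_carrier)
    then have "padic_residue 2 x [^]\<^bsub>G\<^esub> j = padic_residue 2 x [^]\<^bsub>R\<^esub> j"
      unfolding G_def by (simp add: units_of_pow)
    also have "\<dots> = padic_residue 2 x ^ j mod q"
      using pow_cong[of "padic_residue 2 x" j] by (simp add: q_def)
    finally show ?thesis by (simp add: padic_residue_power q_def)
  qed
  have gen: "generate G {padic_residue 2 x} = (\<lambda>j. padic_residue 2 (x ^ j)) ` UNIV" if "\<not> \<pi> dvd x"
  proof -
    have "finite (carrier G)" by (simp add: G_def units_of_carrier)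
    then show ?thesis
      using G.generate_pow_on_finite_carrier[of "padic_residue 2 x"] carrier[of x] that pow[OF that] by auto
  qed
  have unit_pow: "\<not> \<pi> dvd x ^ j" if "\<not> \<pi> dvd x" for j
    using that by (induction j) (auto simp: padic_p_dvd_mult_iff)
  have rep: "\<exists>v :: 'p padic_int. padic_residue 2 v = c" if "c \<in> carrier G" for c
  proof
    have "0 \<le> c" "c < q" using that by (auto simp: G_def units_of_carrier res_units_eq)
    then show "padic_residue 2 (of_nat (nat c) :: 'p padic_int) = c"
      by (simp add: padic_residue_of_nat q_def del: of_nat_nat)
  qed
  have "generate G {padic_residue 2 x} = carrier G \<longleftrightarrow> (\<forall>v. \<not> \<pi> dvd v \<longrightarrow> (\<exists>j. \<pi> ^ 2 dvd x ^ j - v))"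
    if x: "\<not> \<pi> dvd x"
  proof
    assume "generate G {padic_residue 2 x} = carrier G"
    then show "\<forall>v. \<not> \<pi> dvd v \<longrightarrow> (\<exists>j. \<pi> ^ 2 dvd x ^ j - v)"
      unfolding gen[OF x] padic_residue_eq_iff_dvd[symmetric] by (metis (no_types, lifting) carrier imageE)
  next
    assume *: "\<forall>v. \<not> \<pi> dvd v \<longrightarrow> (\<exists>j. \<pi> ^ 2 dvd x ^ j - v)"
    show "generate G {padic_residue 2 x} = carrier G"
      unfolding gen[OF x]
    proof (intro equalityI subsetI)
      fix c assume c: "c \<in> carrier G"
      then obtain v :: "'p padic_int" where v: "padic_residue 2 v = c" using rep by blast
      then obtain j where "padic_residue 2 (x ^ j) = padic_residue 2 v"
        using * carrier[of v] c unfolding padic_residue_eq_iff_dvd by blast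
      then show "c \<in> range (\<lambda>j. padic_residue 2 (x ^ j))" using v by (metis rangeI)
    qed (use carrier unit_pow[OF x] in auto)
  qed
  then show ?thesis
    unfolding generates_units_mod_p2_def Let_def q_def[symmetric] R_def[symmetric] G_def[symmetric]
    using carrier by blast
qed

section \<open>Criteria for transitivity on the units, for odd p and for p = 2\<close>

definition unit_transitive :: "('p::prime_card padic_int \<Rightarrow> 'p padic_int) \<Rightarrow> bool" where
  "unit_transitive \<phi> \<longleftrightarrow> (\<forall>u. \<not> \<pi> dvd u \<longrightarrow> \<not> \<pi> dvd \<phi> u) \<and>
     (\<forall>u v k. \<not> \<pi> dvd u \<longrightarrow> \<not> \<pi> dvd v \<longrightarrow> (\<exists>j. \<pi> ^ k dvd (\<phi> ^^ j) u - v))"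

lemma unit_transitive_funpow_unit:
  "unit_transitive \<phi> \<Longrightarrow> \<not> \<pi> dvd u \<Longrightarrow> \<not> \<pi> dvd (\<phi> ^^ j) u"
  by (induction j) (auto simp: unit_transitive_def)

lemma unit_transitive_surj:
  fixes \<phi> :: "'p::prime_card padic_int \<Rightarrow> 'p padic_int"
  assumes "unit_transitive \<phi>" "\<not> \<pi> dvd v"
  shows "\<exists>u. \<not> \<pi> dvd u \<and> \<pi> ^ k dvd \<phi> u - v"
proof -
  \<comment> \<open>The orbit starts at \<open>\<phi> v\<close> and not at \<open>v\<close>, so that
    the point reached is an image under \<open>\<phi>\<close> even if \<open>j = 0\<close>.\<close>
  obtain j where "\<pi> ^ k dvd (\<phi> ^^ j) (\<phi> v) - v"
    using assms unfolding unit_transitive_def by blast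
  then have "\<pi> ^ k dvd \<phi> ((\<phi> ^^ j) v) - v" by (simp add: funpow_swap1)
  then show ?thesis using unit_transitive_funpow_unit[OF assms] by blast
qed

lemma has_slope_mod_affine: "has_slope_mod m \<phi> E \<Longrightarrow> m dvd \<phi> u - (\<phi> 0 + E * u)"
  unfolding has_slope_mod_def
  by (drule spec[of _ 0], drule spec[of _ u]) (auto simp: algebra_simps dest: dvd_mult_left)

lemma has_slope_mod_dvd: "has_slope_mod m \<phi> E \<Longrightarrow> d dvd m \<Longrightarrow> has_slope_mod d \<phi> E"
  unfolding has_slope_mod_def by (meson dvd_refl dvd_trans mult_dvd_mono)

text \<open>Serves twice: with \<open>u0\<close> a fixed point it conjugates \<open>\<phi>\<close>
  to multiplication by \<open>D\<close>, and with \<open>u0 = 0\<close> and \<open>D = 1\<close> it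
  shows that the orbits of a map congruent to the identity stand still.\<close>

lemma affine_funpow_cong:
  fixes \<phi> :: "'a::comm_ring_1 \<Rightarrow> 'a"
  assumes "\<And>u. m dvd \<phi> u - u0 - D * (u - u0)"
  shows "m dvd (\<phi> ^^ j) u - u0 - D ^ j * (u - u0)"
proof (induction j)
  case (Suc j)
  let ?x = "(\<phi> ^^ j) u"
  have "m dvd (\<phi> ?x - u0 - D * (?x - u0)) + D * (?x - u0 - D ^ j * (u - u0))"
    using Suc assms by (intro dvd_add dvd_mult)
  then show ?case by (simp add: algebra_simps)
qed simp

lemma padic_p_not_dvd_two:
  assumes "odd CARD('p::prime_card)"
  shows "\<not> (\<pi> :: 'p padic_int) dvd 2"
proof
  assume "(\<pi> :: 'p padic_int) dvd 2"
  then have "CARD('p) dvd 2"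
    using padic_of_nat_dvd_iff[of 1 2, where 'p = 'p] by simp
  then have "CARD('p) \<le> 2" by (rule dvd_imp_le) simp
  then show False
    using assms prime_ge_2_nat[OF prime_card[where 'a = 'p]] by (cases "CARD('p) = 2") auto
qed

text \<open>Modulo \<open>p\<^sup>2\<close> such a map is affine; for odd \<open>p\<close> and \<open>D \<noteq> 1\<close> modulo \<open>p\<close> it is conjugate to
  multiplication by \<open>D\<close> around its fixed point \<open>u\<^sub>0\<close>.\<close>

lemma unit_transitive_iff_odd:
  fixes \<phi> :: "'p::prime_card padic_int \<Rightarrow> 'p padic_int"
  assumes odd: "odd CARD('p)" and slope: "has_slope_mod (\<pi> ^ 2) \<phi> D"
  shows "unit_transitive \<phi> \<longleftrightarrow> \<pi> dvd \<phi> 0 \<and> generates_units_mod_p2 D"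
proof
  have affine: "\<pi> ^ 2 dvd \<phi> u - (\<phi> 0 + D * u)" for u by (rule has_slope_mod_affine[OF slope])
  have affine1: "\<pi> dvd \<phi> u - (\<phi> 0 + D * u)" for u
    using affine[of u] by (metis dvd_mult_left power2_eq_square)
  \<comment> \<open>For odd p the units 1 and -1 differ modulo p. The degenerate slopes 0 and 1
    modulo p are excluded because an image or an orbit would have to meet both classes.\<close>
  have not_one_minus_one: "\<not> (\<pi> dvd a - 1 \<and> \<pi> dvd a - (- 1))" for a :: "'p padic_int"
  proof
    assume "\<pi> dvd a - 1 \<and> \<pi> dvd a - (- 1)"
    then have "\<pi> dvd (a - (- 1)) - (a - 1)" using dvd_diff by blast
    then show False using padic_p_not_dvd_two[OF odd] by simp
  qed
  have fixed_point: "\<exists>u0. \<pi> dvd u0 \<and> (\<forall>u. \<pi> ^ 2 dvd \<phi> u - u0 - D * (u - u0))"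
    if "\<not> \<pi> dvd D - 1" "\<pi> dvd \<phi> 0"
  proof -
    have "\<not> \<pi> dvd 1 - D" using that(1) by (metis dvd_minus_iff minus_diff_eq)
    then obtain w where w: "(1 - D) * w = 1" using padic_is_unit_iff by (metis dvdE)
    \<comment> \<open>The affine map with slope \<open>D\<close> and value \<open>\<phi> 0\<close>
      at 0 has the fixed point \<open>\<phi> 0\<close> / (1 - D), here
      \<open>w * \<phi> 0\<close>.\<close>
    have "\<pi> ^ 2 dvd \<phi> u - w * \<phi> 0 - D * (u - w * \<phi> 0)" for u
    proof -
      have "\<phi> u - w * \<phi> 0 - D * (u - w * \<phi> 0) = \<phi> u - ((1 - D) * w * \<phi> 0 + D * u)"
        by (simp add: algebra_simps)
      also have "(1 - D) * w * \<phi> 0 = \<phi> 0" by (simp add: w)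
      finally show ?thesis using affine[of u] by (simp only:)
    qed
    then show ?thesis using that(2) by (intro exI[of _ "w * \<phi> 0"]) simp
  qed
  {
    assume tr: "unit_transitive \<phi>"
    have D: "\<not> \<pi> dvd D"
    proof
      assume "\<pi> dvd D"
      have cong: "\<pi> dvd \<phi> u - \<phi> 0" for u
        using dvd_add[OF affine1[of u] dvd_mult2[OF \<open>\<pi> dvd D\<close>, of u]] by simp
      have "\<pi> dvd \<phi> 0 - v" if v: "\<not> \<pi> dvd v" for v
      proof -
        obtain u where "\<pi> ^ 1 dvd \<phi> u - v" using unit_transitive_surj[OF tr v] by blast
        then have "\<pi> dvd \<phi> u - v" by simp
        then have "\<pi> dvd (\<phi> u - v) - (\<phi> u - \<phi> 0)" using cong by (rule dvd_diff)
        then show ?thesis by simp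
      qed
      from this[of 1] this[of "- 1"] not_one_minus_one[of "\<phi> 0"] show False by simp
    qed
    \<comment> \<open>Otherwise -\<open>\<phi> 0\<close> / D would be a unit whose image is
      divisible by p.\<close>
    have b: "\<pi> dvd \<phi> 0"
    proof (rule ccontr)
      assume b: "\<not> \<pi> dvd \<phi> 0"
      obtain w where w: "D * w = 1" using D padic_is_unit_iff by (metis dvdE)
      have "\<not> \<pi> dvd w" using w padic_p_not_unit by (metis dvd_mult)
      then have "\<not> \<pi> dvd - (w * \<phi> 0)" using b by (simp add: padic_p_dvd_mult_iff)
      then have "\<not> \<pi> dvd \<phi> (- (w * \<phi> 0))" using tr by (simp add: unit_transitive_def)
      moreover have "\<phi> 0 + D * (- (w * \<phi> 0)) = \<phi> 0 * (1 - D * w)" by (simp add: algebra_simps)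
      then have "\<phi> 0 + D * (- (w * \<phi> 0)) = 0" by (simp only: w) simp
      ultimately show False using affine1[of "- (w * \<phi> 0)"] by (metis diff_zero)
    qed
    have D1: "\<not> \<pi> dvd D - 1"
    proof
      assume D1: "\<pi> dvd D - 1"
      have "\<pi> dvd \<phi> u - 0 - 1 * (u - 0)" for u
      proof -
        have "\<pi> dvd (\<phi> u - (\<phi> 0 + D * u)) + \<phi> 0 + (D - 1) * u"
          using affine1[of u] b D1 by (intro dvd_add) simp_all
        then show ?thesis by (simp add: algebra_simps)
      qed
      then have fix1: "\<pi> dvd (\<phi> ^^ j) 1 - 0 - 1 ^ j * (1 - 0)" for j by (rule affine_funpow_cong)
      obtain j where "\<pi> ^ 1 dvd (\<phi> ^^ j) 1 - (- 1)"
        using tr padic_p_not_unit unfolding unit_transitive_def by (metis dvd_minus_iff)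
      with fix1[of j] not_one_minus_one[of "(\<phi> ^^ j) 1"] show False by simp
    qed
    obtain u0 where u0: "\<pi> dvd u0" "\<And>u. \<pi> ^ 2 dvd \<phi> u - u0 - D * (u - u0)"
      using fixed_point[OF D1 b] by blast
    have "\<exists>j. \<pi> ^ 2 dvd D ^ j - v" if v: "\<not> \<pi> dvd v" for v
    proof -
      have "\<not> \<pi> dvd 1 + u0" "\<not> \<pi> dvd v + u0" using u0(1) v by (simp_all add: dvd_add_left_iff)
      then obtain j where j: "\<pi> ^ 2 dvd (\<phi> ^^ j) (1 + u0) - (v + u0)"
        using tr unfolding unit_transitive_def by blast
      have "\<pi> ^ 2 dvd (\<phi> ^^ j) (1 + u0) - u0 - D ^ j * (1 + u0 - u0)"
        by (rule affine_funpow_cong[OF u0(2)])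
      from dvd_diff[OF j this] show ?thesis by (auto simp: algebra_simps)
    qed
    with D b show "\<pi> dvd \<phi> 0 \<and> generates_units_mod_p2 D"
      by (simp add: generates_units_mod_p2_iff)
  }
  {
    assume "\<pi> dvd \<phi> 0 \<and> generates_units_mod_p2 D"
    then have b: "\<pi> dvd \<phi> 0" and D: "\<not> \<pi> dvd D" and gen: "\<And>v. \<not> \<pi> dvd v \<Longrightarrow> \<exists>j. \<pi> ^ 2 dvd D ^ j - v"
      by (auto simp: generates_units_mod_p2_iff)
    have p2: "\<pi> dvd a" if "\<pi> ^ 2 dvd a" for a :: "'p padic_int"
      using that by (metis dvd_mult_left power2_eq_square)
    have D1: "\<not> \<pi> dvd D - 1"
    proof
      assume D1: "\<pi> dvd D - 1"
      obtain j where "\<pi> ^ 2 dvd D ^ j - (- 1)" using gen[of "- 1"] by auto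
      with not_one_minus_one[of "D ^ j"] dvd_power_diff_one[OF D1] p2 show False by blast
    qed
    obtain u0 where u0: "\<pi> dvd u0" "\<And>u. \<pi> ^ 2 dvd \<phi> u - u0 - D * (u - u0)"
      using fixed_point[OF D1 b] by blast
    define N where "N = CARD('p) - 1"
    have DN: "\<pi> dvd D ^ N - 1" unfolding N_def by (rule padic_fermat[OF D])
    \<comment> \<open>Some power of \<open>D\<close> is 1 + p modulo p^2. If D^(p-1) were 1 modulo
      p^2, raising that power to the exponent p - 1 would give 1 = 1 + (p - 1) p modulo p^2, so p
      would divide p - 1.\<close>
    have DN2: "\<not> \<pi> ^ 2 dvd D ^ N - 1"
    proof
      assume *: "\<pi> ^ 2 dvd D ^ N - 1"
      have "\<not> (\<pi> :: 'p padic_int) dvd 1 + \<pi> * 1" by (simp add: dvd_add_left_iff)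
      then obtain j where "\<pi> ^ 2 dvd D ^ j - (1 + \<pi> * 1)" using gen by blast
      then have 1: "\<pi> ^ 2 dvd (D ^ j) ^ N - (1 + \<pi> * 1) ^ N" by (rule padic_cong_power)
      have 2: "\<pi> ^ 2 dvd (D ^ N) ^ j - 1" by (rule dvd_power_diff_one[OF *])
      have 3: "\<pi> ^ 2 dvd (1 + \<pi> * 1) ^ N - (1 + of_nat N * (\<pi> * 1 :: 'p padic_int))"
        by (rule power_one_plus_dvd)
      have eq: "(D ^ j) ^ N = (D ^ N) ^ j" by (simp add: mult.commute flip: power_mult)
      have "\<pi> ^ 2 dvd ((D ^ N) ^ j - 1) - ((D ^ N) ^ j - (1 + \<pi> * 1) ^ N) - ((1 + \<pi> * 1) ^ N - (1 + of_nat N * (\<pi> * 1)))"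
        by (rule dvd_diff[OF dvd_diff[OF 2 1[unfolded eq]] 3])
      then have "\<pi> * \<pi> dvd \<pi> * (of_nat N :: 'p padic_int)" by (simp add: power2_eq_square mult.commute)
      then have "(\<pi> :: 'p padic_int) dvd of_nat N" by (subst (asm) dvd_mult_cancel_left) auto
      then have "CARD('p) dvd N" using padic_of_nat_dvd_iff[of 1 N, where 'p = 'p] by simp
      then have "CARD('p) \<le> N"
        by (rule dvd_imp_le) (use prime_ge_2_nat[OF prime_card[where 'a = 'p]] in \<open>simp add: N_def\<close>)
      then show False
        using prime_ge_2_nat[OF prime_card[where 'a = 'p]] by (simp add: N_def)
    qed
    have units: "\<not> \<pi> dvd \<phi> u" if "\<not> \<pi> dvd u" for u
    proof
      assume "\<pi> dvd \<phi> u"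
      have "\<pi> dvd \<phi> u - (\<phi> u - (\<phi> 0 + D * u)) - \<phi> 0"
        by (rule dvd_diff[OF dvd_diff[OF \<open>\<pi> dvd \<phi> u\<close> affine1] b])
      then have "\<pi> dvd D * u" by simp
      then show False using that D by (simp add: padic_p_dvd_mult_iff)
    qed
    have unit_diff: "\<not> \<pi> dvd u - u0" if "\<not> \<pi> dvd u" for u
      using that u0(1) by (metis diff_add_cancel dvd_add)
    have tr1: "\<exists>j. \<pi> dvd (\<phi> ^^ j) u - v" if uv: "\<not> \<pi> dvd u" "\<not> \<pi> dvd v" for u v
    proof -
      \<comment> \<open>Around the fixed point, reaching \<open>v\<close> from \<open>u\<close>
        means that D^j equals (v - u0) / (u - u0); this quotient is a unit, hence a power of
        \<open>D\<close> modulo p^2.\<close>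
      obtain w where w: "(u - u0) * w = 1" using unit_diff[OF uv(1)] padic_is_unit_iff by (metis dvdE)
      have "\<not> \<pi> dvd w" using w padic_p_not_unit by (metis dvd_mult)
      then have "\<not> \<pi> dvd w * (v - u0)" using unit_diff[OF uv(2)] by (simp add: padic_p_dvd_mult_iff)
      then obtain j where "\<pi> ^ 2 dvd D ^ j - w * (v - u0)" using gen by blast
      then have 1: "\<pi> ^ 2 dvd (D ^ j - w * (v - u0)) * (u - u0)" by (rule dvd_mult2)
      have "(D ^ j - w * (v - u0)) * (u - u0) = D ^ j * (u - u0) - (u - u0) * w * (v - u0)"
        by (simp add: algebra_simps)
      then have 2: "(D ^ j - w * (v - u0)) * (u - u0) = D ^ j * (u - u0) - (v - u0)" by (simp add: w)
      have "\<pi> ^ 2 dvd ((\<phi> ^^ j) u - u0 - D ^ j * (u - u0)) + (D ^ j * (u - u0) - (v - u0))"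
        using affine_funpow_cong[OF u0(2)] 1 unfolding 2 by (rule dvd_add)
      then have "\<pi> ^ 2 dvd (\<phi> ^^ j) u - v" by simp
      then show ?thesis using p2 by blast
    qed
    \<comment> \<open>Modulo p^2 the displacement is \<open>(D ^ N - 1) * (u - u0)\<close>, where
      \<open>D ^ N - 1\<close> is p times a unit by \<open>DN\<close> and
      \<open>DN2\<close>.\<close>
    have ret: "\<exists>w. \<not> \<pi> dvd w \<and> (\<phi> ^^ N) u = u + \<pi> * w" if u: "\<not> \<pi> dvd u" for u
    proof -
      obtain c where c: "D ^ N - 1 = \<pi> * c" using DN by (rule dvdE)
      have "\<not> \<pi> dvd c"
      proof
        assume "\<pi> dvd c"
        then have "\<pi> * \<pi> dvd D ^ N - 1" unfolding c by (rule mult_dvd_mono[OF dvd_refl])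
        then show False using DN2 by (simp add: power2_eq_square)
      qed
      then have "\<not> \<pi> dvd c * (u - u0)" using unit_diff[OF u] by (simp add: padic_p_dvd_mult_iff)
      moreover obtain e where "(\<phi> ^^ N) u - u0 - D ^ N * (u - u0) = \<pi> ^ 2 * e"
        using affine_funpow_cong[OF u0(2)] by (rule dvdE)
      then have "(\<phi> ^^ N) u = u + (D ^ N - 1) * (u - u0) + \<pi> * (\<pi> * e)"
        by (simp add: algebra_simps power2_eq_square)
      then have "(\<phi> ^^ N) u = u + \<pi> * (c * (u - u0) + \<pi> * e)" unfolding c by (simp add: algebra_simps)
      ultimately show ?thesis
        by (intro exI[of _ "c * (u - u0) + \<pi> * e"]) (simp add: dvd_add_left_iff)
    qed
    show "unit_transitive \<phi>"
      unfolding unit_transitive_def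
    proof (intro conjI allI impI units)
      fix u v :: "'p padic_int" and k
      assume "\<not> \<pi> dvd u" "\<not> \<pi> dvd v"
      moreover have "CARD('p) = 2 \<Longrightarrow> \<pi> ^ 2 dvd D ^ N - 1" using odd by simp
      ultimately show "\<exists>j. \<pi> ^ k dvd (\<phi> ^^ j) u - v"
        by (intro units_transitive_lift[OF slope units tr1 ret DN])
    qed
  }
qed

lemma padic_two_dvd_diff_one:
  fixes a :: "'p::prime_card padic_int"
  assumes "CARD('p) = 2" "\<not> \<pi> dvd a"
  shows "\<pi> dvd a - 1"
proof -
  have "padic_residue 1 a \<noteq> 0" using assms(2) by (simp add: padic_residue_eq_0_iff_dvd)
  moreover have "0 \<le> padic_residue 1 a" "padic_residue 1 a < 2"
    using padic_residue_bounds[of 1 a] by (simp_all add: assms(1))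
  ultimately have "padic_residue 1 a = 1" by linarith
  then have "padic_residue 1 a = padic_residue 1 (1 :: 'p padic_int)"
    by (simp add: padic_residue_1 assms(1))
  then show ?thesis by (simp add: padic_residue_eq_iff_dvd)
qed

text \<open>Modulo 4 the map is translation by 2, so already a single step moves every point by
  exactly 2. The units form one class modulo 2, hence transitivity modulo 2 is automatic and lifting
  applies with return length 1.\<close>

lemma unit_transitive_if_two:
  fixes \<phi> :: "'p::prime_card padic_int \<Rightarrow> 'p padic_int"
  assumes two: "CARD('p) = 2" and slope: "has_slope_mod (\<pi> ^ 2) \<phi> D"
    and b: "\<pi> dvd \<phi> 0" "\<not> \<pi> ^ 2 dvd \<phi> 0" and D: "\<pi> ^ 2 dvd D - 1"
  shows "unit_transitive \<phi>"
proof -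
  define q where "q = (\<pi> :: 'p padic_int)"
  note qs = q_def[symmetric]
  obtain c where c: "\<phi> 0 = q * c" using b(1) unfolding qs by (rule dvdE)
  have c_unit: "\<not> q dvd c"
    using b(2) unfolding qs c power2_eq_square by (auto intro: mult_dvd_mono)
  obtain t where t: "D - 1 = q ^ 2 * t" using D unfolding qs by (rule dvdE)
  have step: "\<exists>w. \<not> q dvd w \<and> \<phi> u = u + q * w" for u
  proof -
    obtain e where e: "\<phi> u - (\<phi> 0 + D * u) = q ^ 2 * e"
      using has_slope_mod_affine[OF slope] unfolding qs by (rule dvdE)
    then have "\<phi> u = u + \<phi> 0 + (D - 1) * u + q ^ 2 * e" by (simp add: algebra_simps)
    also have "\<dots> = u + q * (c + q * (t * u + e))"
      unfolding t c by (simp add: algebra_simps power2_eq_square)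
    finally show ?thesis using c_unit by (intro exI[of _ "c + q * (t * u + e)"]) (simp add: dvd_add_left_iff)
  qed
  have units: "\<not> \<pi> dvd \<phi> u" if "\<not> \<pi> dvd u" for u
    using step[of u] that unfolding qs by (auto simp: dvd_add_left_iff)
  have tr1: "\<exists>j. \<pi> dvd (\<phi> ^^ j) u - v" if "\<not> \<pi> dvd u" "\<not> \<pi> dvd v" for u v
  proof
    have "\<pi> dvd (u - 1) - (v - 1)" using that by (intro dvd_diff padic_two_dvd_diff_one two)
    then show "\<pi> dvd (\<phi> ^^ 0) u - v" by simp
  qed
  have ret: "\<exists>w. \<not> \<pi> dvd w \<and> (\<phi> ^^ 1) u = u + \<pi> * w" for u
    using step[of u] unfolding qs by simp
  have D1: "\<pi> dvd D ^ 1 - 1"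
    using D by (metis dvd_mult_left power2_eq_square power_one_right)
  show ?thesis
    unfolding unit_transitive_def
  proof (intro conjI allI impI units)
    fix u v :: "'p padic_int" and k
    assume "\<not> \<pi> dvd u" "\<not> \<pi> dvd v"
    moreover have "CARD('p) = 2 \<Longrightarrow> \<pi> ^ 2 dvd D ^ 1 - 1" using D by simp
    ultimately show "\<exists>j. \<pi> ^ k dvd (\<phi> ^^ j) u - v"
      by (intro units_transitive_lift[OF slope units tr1 ret D1])
  qed
qed

text \<open>The slope is needed modulo 8 to exclude \<open>D\<close> congruent to 3 modulo 4: then
  \<open>\<phi>\<close> is an involution modulo 8, its orbits have at most two elements there, and
  there are four units. Modulo 4 no contradiction would arise if 4 divides
  \<open>\<phi> 0\<close>.\<close>

lemma unit_transitive_only_if_two: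
  fixes \<phi> :: "'p::prime_card padic_int \<Rightarrow> 'p padic_int"
  assumes two: "CARD('p) = 2" and slope: "has_slope_mod (\<pi> ^ 3) \<phi> D" and tr: "unit_transitive \<phi>"
  shows "\<pi> dvd \<phi> 0" "\<not> \<pi> ^ 2 dvd \<phi> 0" "\<pi> ^ 2 dvd D - 1"
proof -
  define q where "q = (\<pi> :: 'p padic_int)"
  note qs = q_def[symmetric]
  have q2: "q = 1 + 1" by (simp add: q_def two)
  have q0: "q \<noteq> 0" and q1: "\<not> q dvd 1" unfolding q_def by simp_all
  have q_mult: "q dvd x * y \<longleftrightarrow> q dvd x \<or> q dvd y" for x y unfolding q_def by (rule padic_p_dvd_mult_iff)
  have q_cancel: "q * x dvd q * y \<longleftrightarrow> x dvd y" for x y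
    using q0 by (subst dvd_mult_cancel_left) simp
  have q1q: "\<not> q dvd 1 + q * x" for x using q1 by (simp add: dvd_add_left_iff)
  have parity: "q dvd a - 1" if "\<not> q dvd a" for a
    using padic_two_dvd_diff_one[OF two, of a] that unfolding qs .
  note slope = slope[unfolded qs] and tr_unit = tr[unfolded unit_transitive_def qs, THEN conjunct1, rule_format]
    and tr_orbit = tr[unfolded unit_transitive_def qs, THEN conjunct2, rule_format]
  note tr_surj = unit_transitive_surj[OF tr, unfolded qs]
  have "\<exists>e. \<phi> u = \<phi> 0 + D * u + q ^ 3 * e" for u
    using has_slope_mod_affine[OF slope, of u] by (metis dvdE add.commute diff_add_cancel)
  then obtain e where affine: "\<And>u. \<phi> u = \<phi> 0 + D * u + q ^ 3 * e u" by metis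
  have not_q2: "\<not> q ^ 2 dvd q"
    using q_cancel[of q 1] q1 by (simp add: power2_eq_square)
  have q2_1: "\<not> q ^ 2 dvd 1" using q1 by (metis dvd_mult_left power2_eq_square)
  \<comment> \<open>For even \<open>D\<close> all units would have the same image modulo 4, while 1
    and 3 both have to be reached.\<close>
  have D: "\<not> q dvd D"
  proof
    assume "q dvd D"
    then obtain d where d: "D = q * d" by (rule dvdE)
    have hit: "q ^ 2 dvd \<phi> 0 + D - v" if v: "\<not> q dvd v" for v
    proof -
      obtain u where u: "\<not> q dvd u" "q ^ 2 dvd \<phi> u - v" using tr_surj[OF v] by blast
      obtain t where "u - 1 = q * t" using parity[OF u(1)] by (rule dvdE)
      then have t: "u = 1 + q * t" by (simp add: algebra_simps)
      have eq: "\<phi> 0 + D - v = (\<phi> u - v) - q ^ 2 * (d * t + q * e u)"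
        unfolding affine[of u] unfolding t d by (simp add: algebra_simps power2_eq_square power3_eq_cube)
      show ?thesis unfolding eq by (rule dvd_diff[OF u(2) dvd_triv_left])
    qed
    have "q ^ 2 dvd (\<phi> 0 + D - 1) - (\<phi> 0 + D - (1 + q * 1))"
      using hit[OF q1] hit[OF q1q] by (rule dvd_diff)
    then show False using not_q2 by simp
  qed
  have b: "q dvd \<phi> 0"
  proof (rule ccontr)
    assume "\<not> q dvd \<phi> 0"
    have "q dvd (\<phi> 0 - 1) + (D - 1) + q + q * (q * q * e 1)"
      by (intro dvd_add parity D \<open>\<not> q dvd \<phi> 0\<close> dvd_triv_left dvd_refl)
    moreover have "(\<phi> 0 - 1) + (D - 1) + q + q * (q * q * e 1) = \<phi> 1"
      using affine[of 1] by (simp add: q2 power3_eq_cube)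
    ultimately show False using tr_unit[OF q1] by simp
  qed
  obtain t where t: "D - 1 = q * t" using parity[OF D] by (rule dvdE)
  have "q ^ 2 dvd D - 1"
  proof (rule ccontr)
    assume "\<not> q ^ 2 dvd D - 1"
    \<comment> \<open>Here \<open>D\<close> is 3 modulo 4, so that \<open>D + 1\<close> is divisible
      by 4.\<close>
    then have "\<not> q dvd t" unfolding t power2_eq_square by (auto intro: mult_dvd_mono)
    then obtain s where s: "t - 1 = q * s" using parity by (meson dvdE)
    have D1: "D + 1 = q ^ 2 * (s + 1)"
    proof -
      have "D + 1 = (D - 1) + q" by (simp add: q2)
      also have "\<dots> = q * (t - 1 + q)" unfolding t by (simp add: algebra_simps q2)
      also have "\<dots> = q ^ 2 * (s + 1)" unfolding s by (simp add: algebra_simps power2_eq_square)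
      finally show ?thesis .
    qed
    obtain c where c: "\<phi> 0 = q * c" using b by (rule dvdE)
    \<comment> \<open>The factor 4 of \<open>D + 1\<close> combines with the factor 2 of
      \<open>\<phi> 0\<close> and of \<open>D - 1\<close>.\<close>
    have invol: "q ^ 3 dvd \<phi> (\<phi> u) - u" for u
    proof -
      have "\<phi> (\<phi> u) - u = (D + 1) * \<phi> 0 + (D - 1) * (D + 1) * u + q ^ 3 * (D * e u + e (\<phi> u))"
        by (subst affine[of "\<phi> u"], subst affine[of u]) (simp add: algebra_simps)
      also have "\<dots> = q ^ 3 * ((s + 1) * c + t * (s + 1) * u + (D * e u + e (\<phi> u)))"
        unfolding D1 t c by (simp add: algebra_simps power2_eq_square power3_eq_cube)
      finally show ?thesis by simp
    qed
    have cong: "q ^ 3 dvd \<phi> x - \<phi> y" if "q ^ 3 dvd x - y" for x y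
    proof -
      have "q ^ 3 dvd D * (x - y) + q ^ 3 * (e x - e y)"
        by (intro dvd_add dvd_mult that dvd_triv_left)
      moreover have "\<phi> x - \<phi> y = D * (x - y) + q ^ 3 * (e x - e y)"
        by (subst affine[of x], subst affine[of y]) (simp add: algebra_simps)
      ultimately show ?thesis by simp
    qed
    have orbit: "q ^ 3 dvd (\<phi> ^^ j) 1 - 1 \<or> q ^ 3 dvd (\<phi> ^^ j) 1 - \<phi> 1" for j
    proof (induction j)
      case (Suc j)
      then show ?case
      proof
        assume "q ^ 3 dvd (\<phi> ^^ j) 1 - 1"
        from cong[OF this] show ?thesis by simp
      next
        assume "q ^ 3 dvd (\<phi> ^^ j) 1 - \<phi> 1"
        from dvd_add[OF cong[OF this] invol[of 1]] show ?thesis by simp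
      qed
    qed simp
    have hit: "q ^ 3 dvd v - 1 \<or> q ^ 3 dvd v - \<phi> 1" if v: "\<not> q dvd v" for v
    proof -
      obtain j where j: "q ^ 3 dvd (\<phi> ^^ j) 1 - v" using tr_orbit[OF q1 v] by blast
      from orbit[of j] show ?thesis
      proof
        assume "q ^ 3 dvd (\<phi> ^^ j) 1 - 1"
        from dvd_diff[OF this j] show ?thesis by simp
      next
        assume "q ^ 3 dvd (\<phi> ^^ j) 1 - \<phi> 1"
        from dvd_diff[OF this j] show ?thesis by simp
      qed
    qed
    have not_dvd: "\<not> q ^ 3 dvd q * x" if "\<not> q ^ 2 dvd x" for x
      using that q_cancel[of "q * q" x] by (simp add: power3_eq_cube power2_eq_square mult.assoc)
    \<comment> \<open>The units 3 and 5, written as 1 + q and 1 + q q, both differ from 1 modulo 8.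
      Both would have to equal \<open>\<phi> 1\<close> modulo 8, which they cannot as their
      difference is 2.\<close>
    have n1: "\<not> q ^ 3 dvd 1 + q * 1 - 1"
      using not_dvd[of 1] q2_1 by simp
    have n2: "\<not> q ^ 3 dvd 1 + q * q - 1"
      using not_dvd[of q] not_q2 by simp
    have "q ^ 3 dvd (1 + q * q - \<phi> 1) - (1 + q * 1 - \<phi> 1)"
      using hit[OF q1q, of 1] hit[OF q1q, of q] n1 n2 by (metis dvd_diff)
    then have "q ^ 3 dvd q * (q - 1)" by (simp add: algebra_simps)
    moreover have "\<not> q ^ 2 dvd q - 1" 
    proof
      assume "q ^ 2 dvd q - 1"
      then have "q dvd q - 1" by (metis dvd_mult_left power2_eq_square)
      from dvd_diff[OF dvd_refl this] q1 show False by simp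
    qed
    ultimately show False using not_dvd by blast
  qed
  then show "\<pi> ^ 2 dvd D - 1" unfolding qs .
  show "\<pi> dvd \<phi> 0" using b unfolding qs .
  show "\<not> \<pi> ^ 2 dvd \<phi> 0"
    unfolding qs
  proof
    \<comment> \<open>Then \<open>\<phi>\<close> is the identity modulo 4, and the orbit of 1 never
      reaches 3.\<close>
    assume b2: "q ^ 2 dvd \<phi> 0"
    have "q ^ 2 dvd \<phi> u - 0 - 1 * (u - 0)" for u
    proof -
      have "\<phi> u - 0 - 1 * (u - 0) = \<phi> 0 + (D - 1) * u + q ^ 2 * (q * e u)"
        by (subst affine[of u]) (simp add: algebra_simps power2_eq_square power3_eq_cube)
      also have "q ^ 2 dvd \<dots>"
        by (intro dvd_add dvd_mult2 b2 \<open>q ^ 2 dvd D - 1\<close> dvd_triv_left)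
      finally show ?thesis .
    qed
    then have fix1: "q ^ 2 dvd (\<phi> ^^ j) 1 - 0 - 1 ^ j * (1 - 0)" for j by (rule affine_funpow_cong)
    obtain j where "q ^ 2 dvd (\<phi> ^^ j) 1 - (1 + q * 1)" using tr_orbit[OF q1 q1q] by blast
    from dvd_diff[OF fix1[of j] this] show False using not_q2 by simp
  qed
qed

section \<open>Ergodicity on spheres\<close>

abbreviation padic_ball :: "nat \<Rightarrow> 'p::prime_card padic_int \<Rightarrow> 'p padic_int set"
  where "padic_ball k x \<equiv> padic_cyl k (padic_residue k x)"

lemma mem_padic_sphere_iff:
  fixes x y :: "'p::prime_card padic_int"
  shows "x \<in> padic_sphere y r \<longleftrightarrow>
    padic_residue r x = padic_residue r y \<and> padic_residue (Suc r) x \<noteq> padic_residue (Suc r) y"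
proof -
  have p: "1 < real CARD('p)"
    using prime_gt_1_nat[OF prime_card[where 'a = 'p]] by simp
  have le: "padic_residue k x = padic_residue k y \<longleftrightarrow> dist y x \<le> 1 / real CARD('p) ^ k" for k
    using padic_dist_le_iff[of y x k] by auto
  \<comment> \<open>Norms take only the values 0 and p^(-k), so an equality becomes two inequalities
    at consecutive levels.\<close>
  have "dist y x = 1 / real CARD('p) ^ r \<longleftrightarrow>
      dist y x \<le> 1 / real CARD('p) ^ r \<and> \<not> dist y x \<le> 1 / real CARD('p) ^ Suc r"
  proof (cases "x = y")
    case False
    then have "dist y x = 1 / real CARD('p) ^ padic_val (y - x)"
      by (simp add: dist_padic_int_def padic_norm_def)
    moreover have "1 / real CARD('p) ^ a \<le> 1 / real CARD('p) ^ b \<longleftrightarrow> b \<le> a" for a b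
      using p by (simp add: divide_simps)
    moreover have "1 / real CARD('p) ^ a = 1 / real CARD('p) ^ b \<longleftrightarrow> a = b" for a b
      using p by (auto simp: divide_simps)
    ultimately show ?thesis by (simp only: not_less_eq_eq) linarith
  qed (use p in auto)
  then show ?thesis unfolding padic_sphere_def le by simp
qed

lemma padic_sphere_eq_diff:
  "padic_sphere y r = padic_ball r y - padic_ball (Suc r) y"
  by (auto simp: mem_padic_sphere_iff padic_cyl_def)

lemma padic_cyl_borel [measurable]: "padic_cyl k c \<in> sets borel"
  by (rule borel_open[OF open_padic_cyl])

lemma padic_sphere_borel [measurable]: "padic_sphere y r \<in> sets borel"
  unfolding padic_sphere_eq_diff by measurable

lemma padic_residue_mono:
  fixes x y :: "'p::prime_card padic_int"
  assumes "padic_residue n x = padic_residue n y" "k \<le> n"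
  shows "padic_residue k x = padic_residue k y"
  using padic_residue_mod[OF assms(2), of x] padic_residue_mod[OF assms(2), of y] assms(1) by simp

lemma padic_ball_subset_sphere:
  assumes x: "x \<in> padic_sphere y r" and k: "r < k"
  shows "padic_ball k x \<subseteq> padic_sphere y r"
proof
  fix z assume "z \<in> padic_ball k x"
  then have "padic_residue k z = padic_residue k x" by (simp add: padic_cyl_def)
  then have "padic_residue r z = padic_residue r x" "padic_residue (Suc r) z = padic_residue (Suc r) x"
    using padic_residue_mono[of k z x r] padic_residue_mono[of k z x "Suc r"] k by simp_all
  then show "z \<in> padic_sphere y r" using x by (simp add: mem_padic_sphere_iff)
qed

lemma padic_sphere_nonempty: "y + \<pi> ^ r \<in> padic_sphere y (r :: nat)"
  unfolding mem_padic_sphere_iff padic_residue_eq_iff_dvd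
  using dvd_power_iff[of "\<pi> :: 'a padic_int" "Suc r" r] by (simp del: power_Suc)

lemma sets_padic_haar [simp, measurable_cong]: "sets padic_haar = sets borel"
  by (rule is_padic_haar_padic_haar[unfolded is_padic_haar_def, THEN conjunct1])

lemma emeasure_padic_haar_ball:
  "emeasure padic_haar (padic_ball k (x :: 'p::prime_card padic_int)) = ennreal (1 / real CARD('p) ^ k)"
  by (rule emeasure_padic_haar_cyl[OF is_padic_haar_padic_haar]) simp_all

lemma emeasure_padic_haar_UNIV: "emeasure padic_haar UNIV = 1"
  by (rule is_padic_haar_padic_haar[unfolded is_padic_haar_def, THEN conjunct2, THEN conjunct1])

lemma emeasure_padic_haar_finite: "emeasure padic_haar A \<noteq> \<infinity>"
proof -
  have "emeasure padic_haar A \<le> emeasure padic_haar (UNIV :: 'a padic_int set)"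
    by (intro emeasure_mono) simp_all
  then show ?thesis using emeasure_padic_haar_UNIV[where 'a = 'a] by (auto simp: top_unique)
qed

lemma emeasure_padic_ball_pos: "emeasure padic_haar (padic_ball k (x :: 'p::prime_card padic_int)) \<noteq> 0"
  unfolding emeasure_padic_haar_ball
  using prime_gt_0_nat[OF prime_card[where 'a = 'p]] by simp

lemma emeasure_padic_sphere_pos: "emeasure padic_haar (padic_sphere y r) \<noteq> 0"
proof -
  have "emeasure padic_haar (padic_ball (Suc r) (y + \<pi> ^ r)) \<le> emeasure padic_haar (padic_sphere y r)"
    by (intro emeasure_mono padic_ball_subset_sphere padic_sphere_nonempty) simp_all
  then show ?thesis using emeasure_padic_ball_pos[of "Suc r" "y + \<pi> ^ r"] by auto
qed

lemma space_sphere_measure [simp]: "space (sphere_measure y r) = padic_sphere y r"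
  by (simp add: sphere_measure_def space_restrict_space space_scale_measure
      sets_eq_imp_space_eq[OF sets_padic_haar])

lemma sets_sphere_measure_eq: "sets (sphere_measure y r) = sets (restrict_space borel (padic_sphere y r))"
  by (simp add: sphere_measure_def sets_restrict_space)

lemma sets_sphere_measure_iff:
  "A \<in> sets (sphere_measure y r) \<longleftrightarrow> A \<in> sets borel \<and> A \<subseteq> padic_sphere y r"
  unfolding sets_sphere_measure_eq by (subst sets_restrict_space_iff) auto

lemma emeasure_uniform_sphere:
  assumes "A \<in> sets borel"
  shows "emeasure (uniform_measure padic_haar (padic_sphere y r)) A =
    emeasure padic_haar (padic_sphere y r \<inter> A) / emeasure padic_haar (padic_sphere y r)"
  using assms by (intro emeasure_uniform_measure) simp_all

text \<open>Moves the computation to a measure on all Borel sets of Z_p, where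
  \<open>padic_measure_eqI\<close> applies; the restricted measure lives on another space.\<close>

lemma emeasure_sphere_measure:
  assumes "A \<in> sets borel" "A \<subseteq> padic_sphere y r"
  shows "emeasure (sphere_measure y r) A = emeasure (uniform_measure padic_haar (padic_sphere y r)) A"
proof -
  have "emeasure (sphere_measure y r) A =
      1 / emeasure padic_haar (padic_sphere y r) * emeasure padic_haar A"
    unfolding sphere_measure_def using assms(2)
    by (simp add: emeasure_scale_measure emeasure_restrict_space sets_eq_imp_space_eq[OF sets_padic_haar])
  also have "\<dots> = emeasure padic_haar A / emeasure padic_haar (padic_sphere y r)"
    by (simp add: divide_ennreal_def mult.commute)
  finally show ?thesis using assms by (simp add: emeasure_uniform_sphere Int_absorb1)
qed

lemma emeasure_uniform_sphere_self:
  "emeasure (uniform_measure padic_haar (padic_sphere y r)) (padic_sphere y r) = 1"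
  using emeasure_padic_sphere_pos[of y r] emeasure_padic_haar_finite[of "padic_sphere y r"]
  by (simp add: emeasure_uniform_sphere ennreal_divide_self less_top)

lemma emeasure_uniform_sphere_ball:
  assumes "x \<in> padic_sphere y r" "r < k"
  shows "emeasure (uniform_measure padic_haar (padic_sphere y r)) (padic_ball k (x :: 'p::prime_card padic_int)) =
    ennreal (1 / real CARD('p) ^ k) / emeasure padic_haar (padic_sphere y r)"
  using padic_ball_subset_sphere[OF assms]
  by (simp add: emeasure_uniform_sphere Int_absorb1 emeasure_padic_haar_ball)

lemma emeasure_sphere_measure_ball_pos:
  assumes "x \<in> padic_sphere y r" "r < k" "padic_ball k x \<subseteq> A" "A \<in> sets borel" "A \<subseteq> padic_sphere y r"
  shows "emeasure (sphere_measure y r) A \<noteq> 0"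
proof -
  have "emeasure (uniform_measure padic_haar (padic_sphere y r)) (padic_ball k x) \<noteq> 0"
    unfolding emeasure_uniform_sphere_ball[OF assms(1,2)]
    using emeasure_padic_ball_pos[of k x] emeasure_padic_haar_finite[of "padic_sphere y r"]
    by (simp add: emeasure_padic_haar_ball ennreal_divide_eq_0_iff)
  moreover have "emeasure (uniform_measure padic_haar (padic_sphere y r)) (padic_ball k x) \<le>
      emeasure (uniform_measure padic_haar (padic_sphere y r)) A"
    using assms by (intro emeasure_mono) simp_all
  ultimately show ?thesis using assms(4,5) by (metis emeasure_sphere_measure le_zero_eq)
qed

section \<open>Equivalence of ergodicity and transitivity for compatible maps\<close>

lemma compatible_residue:
  "compatible f \<Longrightarrow> padic_residue k x = padic_residue k z \<Longrightarrow> padic_residue k (f x) = padic_residue k (f z)"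
  unfolding compatible_def padic_residue_eq_iff_dvd by (metis dvd_trans padic_norm_le_norm_iff)

definition sphere_transitive :: "('p::prime_card padic_int \<Rightarrow> 'p padic_int) \<Rightarrow> 'p padic_int \<Rightarrow> nat \<Rightarrow> bool" where
  "sphere_transitive f y r \<longleftrightarrow> f ` padic_sphere y r \<subseteq> padic_sphere y r \<and>
     (\<forall>x\<in>padic_sphere y r. \<forall>z\<in>padic_sphere y r. \<forall>k. \<exists>j. padic_residue k ((f ^^ j) x) = padic_residue k z)"

lemma funpow_mem: "f ` S \<subseteq> S \<Longrightarrow> x \<in> S \<Longrightarrow> (f ^^ j) x \<in> S"
  by (induction j) auto

text \<open>The points whose residue lies on the orbit of \<open>x\<close> modulo \<open>p\<^sup>k\<close> form an open invariant set.\<close>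

lemma ergodic_on_sphere_imp_transitive:
  fixes f :: "'p::prime_card padic_int \<Rightarrow> 'p padic_int"
  assumes compat: "compatible f" and erg: "ergodic_on_sphere f y r"
  shows "sphere_transitive f y r"
proof -
  define S where "S = padic_sphere y r"
  define \<nu> where "\<nu> = sphere_measure y r"
  note erg' = erg[unfolded ergodic_on_sphere_def preserves_measure_def ergodic_wrt_def space_sphere_measure,
      folded S_def \<nu>_def]
  have maps: "f ` S \<subseteq> S" by (rule conjunct1[OF erg'])
  have meas: "f \<in> measurable \<nu> \<nu>" by (rule conjunct1[OF conjunct1[OF conjunct2[OF erg']]])
  note pres = conjunct2[OF conjunct1[OF conjunct2[OF erg']], rule_format]
  note erg = conjunct2[OF conjunct2[OF erg'], rule_format]
  have sets: "A \<in> sets \<nu> \<longleftrightarrow> A \<in> sets borel \<and> A \<subseteq> S" for A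
    unfolding \<nu>_def S_def by (rule sets_sphere_measure_iff)
  have S: "S \<in> sets \<nu>" and total: "emeasure \<nu> S = 1"
    using emeasure_sphere_measure[of S y r] emeasure_uniform_sphere_self[of y r]
    by (simp_all add: sets) (simp_all add: \<nu>_def S_def)
  have fin: "emeasure \<nu> A \<noteq> \<infinity>" if "A \<in> sets \<nu>" for A
    using emeasure_mono[of A S \<nu>] total S sets that by (auto simp: top_unique)
  have pos: "emeasure \<nu> A \<noteq> 0" if "A \<in> sets \<nu>" "w \<in> A" "r < k" "\<And>z. padic_residue k z = padic_residue k w \<Longrightarrow> z \<in> A"
    for A k and w :: "'p padic_int"
    using that sets[of A] emeasure_sphere_measure_ball_pos[of w y r k A]
    by (auto simp: S_def \<nu>_def padic_cyl_def subset_iff)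
  have "\<exists>j. padic_residue k ((f ^^ j) x) = padic_residue k z" if x: "x \<in> S" and z: "z \<in> S" and k: "r < k" for x z k
  proof (rule ccontr)
    assume no_orbit: "\<not> ?thesis"
    define A where "A = (\<Union>j. padic_ball k ((f ^^ j) x))"
    have A_iff: "w \<in> A \<longleftrightarrow> (\<exists>j. padic_residue k w = padic_residue k ((f ^^ j) x))" for w
      by (auto simp: A_def padic_cyl_def)
    have ball_S: "w' \<in> S" if "padic_residue k w' = padic_residue k w" "w \<in> S" for w w' :: "'p padic_int"
      using that padic_ball_subset_sphere[of w y r k] k by (auto simp: S_def padic_cyl_def)
    have "A \<subseteq> S"
    proof
      fix w assume "w \<in> A"
      then obtain j where "padic_residue k w = padic_residue k ((f ^^ j) x)" unfolding A_iff by (elim exE)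
      then show "w \<in> S" using funpow_mem[OF maps x] by (rule ball_S)
    qed
    moreover have "A \<in> sets borel" unfolding A_def by (intro borel_open open_UN) (simp add: open_padic_cyl)
    ultimately have A: "A \<in> sets \<nu>" by (simp add: sets)
    have pre: "f -` A \<inter> S \<in> sets \<nu>"
      using measurable_sets[OF meas A] by (simp add: \<nu>_def S_def)
    have sub: "A \<subseteq> f -` A \<inter> S"
    proof
      fix w assume w: "w \<in> A"
      then obtain j where "padic_residue k w = padic_residue k ((f ^^ j) x)" unfolding A_iff by (elim exE)
      then have "padic_residue k (f w) = padic_residue k (f ((f ^^ j) x))"
        by (rule compatible_residue[OF compat])
      then have "padic_residue k (f w) = padic_residue k ((f ^^ Suc j) x)" by simp
      then have "f w \<in> A" unfolding A_iff by (rule exI)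
      then show "w \<in> f -` A \<inter> S" using subsetD[OF \<open>A \<subseteq> S\<close> w] by simp
    qed
    \<comment> \<open>The orbit argument only yields \<open>A\<close> inside its preimage. A point
      of the difference would bring its whole ball along, and measure preservation forbids a
      difference of positive measure.\<close>
    have "f -` A \<inter> S = A"
    proof (rule ccontr)
      assume "f -` A \<inter> S \<noteq> A"
      then have "f -` A \<inter> S - A \<noteq> {}" using sub by (metis Diff_eq_empty_iff subset_antisym)
      then obtain w where w: "w \<in> f -` A \<inter> S - A" by (meson equals0I)
      have "emeasure \<nu> (f -` A \<inter> S - A) \<noteq> 0"
      proof (rule pos[OF _ w k])
        show "f -` A \<inter> S - A \<in> sets \<nu>" using pre A by (rule sets.Diff)
        fix w' :: "'p padic_int" assume eq: "padic_residue k w' = padic_residue k w"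
        have "padic_residue k (f w') = padic_residue k (f w)" by (rule compatible_residue[OF compat eq])
        then have "f w' \<in> A" using w by (simp add: A_iff)
        then show "w' \<in> f -` A \<inter> S - A" using w ball_S[OF eq] eq by (simp add: A_iff)
      qed
      moreover have "emeasure \<nu> (f -` A \<inter> S - A) = emeasure \<nu> (f -` A \<inter> S) - emeasure \<nu> A"
        by (rule emeasure_Diff[OF fin[OF A] pre A sub])
      ultimately show False using pres[OF A] fin[OF A] by simp
    qed
    then have zero_one: "emeasure \<nu> A = 0 \<or> emeasure \<nu> A = 1" by (rule erg[OF A])
    have xA: "w \<in> A" if "padic_residue k w = padic_residue k x" for w :: "'p padic_int"
      unfolding A_iff using that by (intro exI[of _ 0]) simp
    have "emeasure \<nu> A \<noteq> 0" using A xA[OF refl] k xA by (rule pos)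
    then have one: "emeasure \<nu> A = 1" using zero_one by simp
    have "emeasure \<nu> (S - A) = emeasure \<nu> S - emeasure \<nu> A"
      by (rule emeasure_Diff[OF fin[OF A] S A \<open>A \<subseteq> S\<close>])
    also have "\<dots> = 0" unfolding one total by (rule ennreal_diff_self) simp
    finally have SA_null: "emeasure \<nu> (S - A) = 0" .
    have zA: "z \<in> S - A" using z no_orbit by (auto simp: A_iff)
    have "emeasure \<nu> (S - A) \<noteq> 0"
    proof (rule pos[OF sets.Diff[OF S A] zA k])
      fix w :: "'p padic_int" assume eq: "padic_residue k w = padic_residue k z"
      then have "w \<in> A \<longleftrightarrow> z \<in> A" by (simp only: A_iff)
      moreover have "w \<in> S" by (rule ball_S[OF eq z])
      ultimately show "w \<in> S - A" using zA by simp
    qed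
    with SA_null show False by simp
  qed
  note large = this
  have "\<exists>j. padic_residue k ((f ^^ j) x) = padic_residue k z" if xz: "x \<in> S" "z \<in> S" for x z k
  proof -
    \<comment> \<open>The measure argument needs balls contained in the sphere, that is levels above
      r; coarser levels follow from a finer one.\<close>
    have "\<exists>j. padic_residue (max k (Suc r)) ((f ^^ j) x) = padic_residue (max k (Suc r)) z"
      by (rule large[OF xz]) simp
    then obtain j where "padic_residue (max k (Suc r)) ((f ^^ j) x) = padic_residue (max k (Suc r)) z" ..
    then have "padic_residue k ((f ^^ j) x) = padic_residue k z" by (rule padic_residue_mono) simp
    then show ?thesis by (rule exI)
  qed
  with maps show ?thesis unfolding sphere_transitive_def S_def[symmetric] by (intro conjI ballI allI)
qed

text \<open>By compatibility \<open>f\<close> induces a map on the finite set of residues of the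
  sphere modulo p^k. Transitivity makes it surjective, hence injective.\<close>

lemma sphere_transitive_residue_inj:
  fixes f :: "'p::prime_card padic_int \<Rightarrow> 'p padic_int"
  assumes compat: "compatible f" and tr: "sphere_transitive f y r"
    and xz: "x \<in> padic_sphere y r" "z \<in> padic_sphere y r" and eq: "padic_residue k (f x) = padic_residue k (f z)"
  shows "padic_residue k x = padic_residue k z"
proof -
  define S where "S = padic_sphere y r"
  have maps: "f ` S \<subseteq> S" using tr by (simp add: sphere_transitive_def S_def)
  define K where "K = padic_residue k ` S"
  have "K \<subseteq> {0..<int CARD('p) ^ k}" by (auto simp: K_def)
  then have fin: "finite K" by (rule finite_subset) simp
  define F where "F c = padic_residue k (f (of_nat (nat c)))" for c
  have F: "F (padic_residue k w) = padic_residue k (f w)" for w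
    unfolding F_def by (rule compatible_residue[OF compat]) (simp add: padic_residue_of_nat del: of_nat_nat)
  have "K \<subseteq> F ` K"
  proof
    fix c assume "c \<in> K"
    then obtain w where w: "w \<in> S" "c = padic_residue k w" unfolding K_def by (rule imageE)
    have fw: "f w \<in> S" using maps w(1) by auto
    then obtain j where j: "padic_residue k ((f ^^ j) (f w)) = padic_residue k w"
      using tr w(1) unfolding sphere_transitive_def S_def by metis
    have "c = F (padic_residue k ((f ^^ j) w))" using j unfolding F w(2) by (simp add: funpow_swap1)
    moreover have "padic_residue k ((f ^^ j) w) \<in> K" unfolding K_def by (intro imageI funpow_mem[OF maps w(1)])
    ultimately show "c \<in> F ` K" by (rule image_eqI)
  qed
  then have "inj_on F K" by (rule finite_surj_inj[OF fin])
  then show ?thesis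
    by (rule inj_onD) (use xz eq in \<open>simp_all add: F K_def S_def\<close>)
qed

text \<open>Applied to the image measure for invariance, and to the measure conditioned on an
  invariant set for ergodicity. Small balls suffice, as a cylinder of level at most r contains the
  sphere or misses it.\<close>

lemma measure_eq_uniform_sphereI:
  fixes N :: "'p::prime_card padic_int measure"
  assumes sets: "sets N = sets borel" and total: "emeasure N UNIV = 1"
    and conc: "\<And>A. A \<in> sets borel \<Longrightarrow> emeasure N A = emeasure N (A \<inter> padic_sphere y r)"
    and ball: "\<And>k z. r < k \<Longrightarrow> z \<in> padic_sphere y r \<Longrightarrow>
      emeasure N (padic_ball k z) = emeasure (uniform_measure padic_haar (padic_sphere y r)) (padic_ball k z)"
  shows "uniform_measure padic_haar (padic_sphere y r) = N"
proof -
  define S where "S = padic_sphere y r"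
  define U where "U = uniform_measure padic_haar S"
  have U: "emeasure U A = emeasure U (A \<inter> S)" if "A \<in> sets borel" for A
    using that unfolding U_def S_def by (simp add: emeasure_uniform_sphere Int_commute Int_left_commute)
  have U_S: "emeasure U S = 1" unfolding U_def S_def by (rule emeasure_uniform_sphere_self)
  have N_S: "emeasure N S = 1" using conc[of UNIV] total by (simp add: S_def)
  have "U = N"
  proof (rule padic_measure_eqI)
    show "sets U = sets borel" by (simp add: U_def)
    show "sets N = sets borel" by (rule sets)
    show "emeasure U UNIV = 1" using U[of UNIV] U_S by simp
    fix k c
    have eq: "emeasure U (padic_cyl k c \<inter> S) = emeasure N (padic_cyl k c \<inter> S)"
    proof (cases "\<exists>z\<in>S. padic_residue k z = c")
      case False
      then have "padic_cyl k c \<inter> S = {}" by (auto simp: padic_cyl_def)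
      then show ?thesis by simp
    next
      case True
      then obtain z where z: "z \<in> S" "padic_residue k z = c" by (rule bexE)
      show ?thesis
      proof (cases "r < k")
        case True
        then have "emeasure U (padic_cyl k c) = emeasure N (padic_cyl k c)"
          using ball[OF True, of z] z by (simp add: S_def U_def)
        then show ?thesis
          using U[of "padic_cyl k c"] conc[of "padic_cyl k c"] by (simp add: padic_cyl_borel S_def)
      next
        case False
        have "w \<in> padic_cyl k c" if "w \<in> S" for w
        proof -
          have "padic_residue r w = padic_residue r z" using that z(1) by (simp add: S_def mem_padic_sphere_iff)
          then have "padic_residue k w = padic_residue k z" by (rule padic_residue_mono) (use False in simp)
          then show ?thesis by (simp add: padic_cyl_def z(2))
        qed
        then have "padic_cyl k c \<inter> S = S" by auto
        then show ?thesis by (simp add: U_S N_S)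
      qed
    qed
    show "emeasure U (padic_cyl k c) = emeasure N (padic_cyl k c)"
      using eq U[of "padic_cyl k c"] conc[of "padic_cyl k c"] by (simp add: padic_cyl_borel S_def)
  qed
  then show ?thesis by (simp add: U_def S_def)
qed

lemma compatible_borel_measurable:
  fixes f :: "'p::prime_card padic_int \<Rightarrow> 'p padic_int"
  assumes "compatible f"
  shows "f \<in> borel_measurable borel"
proof (rule borel_measurable_continuous_onI)
  have "dist (f x) (f z) \<le> dist x z" for x z
    using assms by (simp add: compatible_def dist_padic_int_def)
  then show "continuous_on UNIV f"
    unfolding continuous_on_iff by (metis dist_commute le_less_trans)
qed

text \<open>Injectivity on residues makes \<open>f\<close> permute the balls of each level, so a
  preimage within the sphere is a single ball of the same radius.\<close>

lemma sphere_transitive_vimage_ball: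
  fixes f :: "'p::prime_card padic_int \<Rightarrow> 'p padic_int"
  assumes compat: "compatible f" and tr: "sphere_transitive f y r" and x: "x \<in> padic_sphere y r" and k: "r < k"
  shows "f -` padic_ball k (f x) \<inter> padic_sphere y r = padic_ball k x"
proof (intro equalityI subsetI)
  fix w assume "w \<in> f -` padic_ball k (f x) \<inter> padic_sphere y r"
  then have "w \<in> padic_sphere y r" "padic_residue k (f w) = padic_residue k (f x)" by (auto simp: padic_cyl_def)
  then have "padic_residue k w = padic_residue k x" by (intro sphere_transitive_residue_inj[OF compat tr _ x])
  then show "w \<in> padic_ball k x" by (simp add: padic_cyl_def)
next
  fix w assume w: "w \<in> padic_ball k x"
  then have "padic_residue k w = padic_residue k x" by (simp add: padic_cyl_def)
  then have "padic_residue k (f w) = padic_residue k (f x)" by (rule compatible_residue[OF compat])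
  moreover have "w \<in> padic_sphere y r" using padic_ball_subset_sphere[OF x k] w by (rule subsetD)
  ultimately show "w \<in> f -` padic_ball k (f x) \<inter> padic_sphere y r" by (simp add: padic_cyl_def)
qed

lemma sphere_transitive_residue_surj:
  assumes tr: "sphere_transitive f y r" and z: "z \<in> padic_sphere y r"
  shows "\<exists>x\<in>padic_sphere y r. padic_residue k (f x) = padic_residue k z"
proof -
  have maps: "f ` padic_sphere y r \<subseteq> padic_sphere y r" using tr by (simp add: sphere_transitive_def)
  then have "f z \<in> padic_sphere y r" using z by auto
  then obtain j where "padic_residue k ((f ^^ j) (f z)) = padic_residue k z"
    using tr z unfolding sphere_transitive_def by metis
  then have "padic_residue k (f ((f ^^ j) z)) = padic_residue k z" by (simp add: funpow_swap1)
  then show ?thesis using funpow_mem[OF maps z] by (rule bexI)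
qed

lemma sphere_transitive_imp_measurable:
  assumes compat: "compatible f" and tr: "sphere_transitive f y r"
  shows "f \<in> measurable (sphere_measure y r) (sphere_measure y r)"
proof -
  have "f \<in> measurable (restrict_space borel (padic_sphere y r)) (restrict_space borel (padic_sphere y r))"
    using tr by (intro measurable_restrict_space3 compatible_borel_measurable[OF compat])
      (auto simp: sphere_transitive_def)
  then show ?thesis
    by (subst measurable_cong_sets[OF sets_sphere_measure_eq sets_sphere_measure_eq])
qed

text \<open>Balls of the same level have equal measure and are permuted by \<open>f\<close>, so the
  image measure agrees with the original one on balls, hence everywhere.\<close>

lemma sphere_transitive_imp_preserves_measure:
  fixes f :: "'p::prime_card padic_int \<Rightarrow> 'p padic_int"
  assumes compat: "compatible f" and tr: "sphere_transitive f y r"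
  shows "preserves_measure (sphere_measure y r) f"
proof -
  define S where "S = padic_sphere y r"
  define \<nu> where "\<nu> = sphere_measure y r"
  define U where "U = uniform_measure padic_haar S"
  have maps: "f ` S \<subseteq> S" using tr by (simp add: sphere_transitive_def S_def)
  have meas: "f \<in> measurable \<nu> \<nu>"
    unfolding \<nu>_def by (rule sphere_transitive_imp_measurable[OF compat tr])
  have sets: "A \<in> sets \<nu> \<longleftrightarrow> A \<in> sets borel \<and> A \<subseteq> S" for A
    unfolding \<nu>_def S_def by (rule sets_sphere_measure_iff)
  have \<nu>: "emeasure \<nu> A = emeasure U A" if "A \<in> sets \<nu>" for A
    using that emeasure_sphere_measure[of A y r] unfolding \<nu>_def U_def S_def sets_sphere_measure_iff by blast
  have meas_borel: "f \<in> measurable \<nu> borel"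
    unfolding \<nu>_def measurable_cong_sets[OF sets_sphere_measure_eq refl]
    by (rule measurable_restrict_space1[OF compatible_borel_measurable[OF compat]])
  define N where "N = distr \<nu> borel f"
  have N: "emeasure N A = emeasure \<nu> (f -` A \<inter> S)" if "A \<in> sets borel" for A
    using that meas_borel unfolding N_def by (subst emeasure_distr) (simp_all add: \<nu>_def S_def)
  have S_borel: "S \<in> sets borel" by (simp add: S_def padic_sphere_borel)
  have "U = N"
    unfolding U_def S_def
  proof (rule measure_eq_uniform_sphereI)
    show "sets N = sets borel" by (simp add: N_def)
    have "S \<in> sets \<nu>" using S_borel by (simp add: sets)
    then show "emeasure N UNIV = 1"
      using N[of UNIV] \<nu>[of S] emeasure_uniform_sphere_self[of y r] by (simp add: U_def S_def)
    fix A :: "'p padic_int set" assume A: "A \<in> sets borel"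
    have "f -` (A \<inter> S) \<inter> S = f -` A \<inter> S" using maps by auto
    then show "emeasure N A = emeasure N (A \<inter> padic_sphere y r)"
      using N[OF A] N[OF sets.Int[OF A S_borel]] by (simp add: S_def)
  next
    fix k and z :: "'p padic_int"
    assume k: "r < k" and z: "z \<in> padic_sphere y r"
    obtain x where x: "x \<in> padic_sphere y r" "padic_residue k (f x) = padic_residue k z"
      using sphere_transitive_residue_surj[OF tr z] by (rule bexE)
    have "padic_ball k x \<in> sets \<nu>"
      using padic_ball_subset_sphere[OF x(1) k] by (simp add: sets S_def padic_cyl_borel)
    then have "emeasure N (padic_ball k (f x)) = emeasure U (padic_ball k x)"
      using \<nu>[of "padic_ball k x"] N[of "padic_ball k (f x)"] sphere_transitive_vimage_ball[OF compat tr x(1) k]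
      by (simp add: S_def padic_cyl_borel)
    then show "emeasure N (padic_ball k z) = emeasure (uniform_measure padic_haar (padic_sphere y r)) (padic_ball k z)"
      using emeasure_uniform_sphere_ball[OF x(1) k] emeasure_uniform_sphere_ball[OF z k]
      by (simp add: x(2) U_def S_def)
  qed
  then have "emeasure \<nu> (f -` A \<inter> S) = emeasure \<nu> A" if "A \<in> sets \<nu>" for A
    using N[of A] \<nu>[OF that] that by (simp add: sets)
  then show ?thesis
    using meas by (simp add: preserves_measure_def \<nu>_def S_def)
qed

text \<open>An invariant set meets all balls of radius \<open>p\<^sup>-\<^sup>k\<close> in the sphere in the same measure, hence is
  independent of every ball, and therefore of itself.\<close>

lemma sphere_transitive_imp_ergodic_wrt:
  fixes f :: "'p::prime_card padic_int \<Rightarrow> 'p padic_int"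
  assumes compat: "compatible f" and tr: "sphere_transitive f y r"
  shows "ergodic_wrt (sphere_measure y r) f"
  unfolding ergodic_wrt_def
proof (intro ballI impI)
  fix A :: "'p padic_int set"
  define S where "S = padic_sphere y r"
  define \<nu> where "\<nu> = sphere_measure y r"
  define U where "U = uniform_measure padic_haar S"
  assume A: "A \<in> sets (sphere_measure y r)"
    and inv: "f -` A \<inter> space (sphere_measure y r) = A"
  have maps: "f ` S \<subseteq> S" using tr by (simp add: sphere_transitive_def S_def)
  have A_borel: "A \<in> sets borel" and AS: "A \<subseteq> S" using A by (simp_all add: sets_sphere_measure_iff S_def)
  have inv: "f -` A \<inter> S = A" using inv by (simp add: S_def)
  have sets_U: "sets U = sets borel" by (simp add: U_def)
  have \<nu>: "emeasure \<nu> B = emeasure U B" if "B \<in> sets borel" "B \<subseteq> S" for B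
    using emeasure_sphere_measure[of B y r] that unfolding \<nu>_def U_def S_def by blast
  have pres: "emeasure U (f -` B \<inter> S) = emeasure U B" if "B \<in> sets borel" "B \<subseteq> S" for B
  proof -
    have "B \<in> sets \<nu>" using that by (simp add: \<nu>_def S_def sets_sphere_measure_iff)
    then have "emeasure \<nu> (f -` B \<inter> S) = emeasure \<nu> B"
      using sphere_transitive_imp_preserves_measure[OF compat tr] by (simp add: preserves_measure_def \<nu>_def S_def)
    moreover have "f -` B \<inter> S \<in> sets borel"
      using measurable_sets[OF sphere_transitive_imp_measurable[OF compat tr], of B] \<open>B \<in> sets \<nu>\<close>
      by (simp add: \<nu>_def S_def sets_sphere_measure_iff)
    ultimately show ?thesis using \<nu> that by simp
  qed
  have step: "emeasure U (A \<inter> padic_ball k (f x)) = emeasure U (A \<inter> padic_ball k x)" if "x \<in> S" "r < k" for x k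
  proof -
    have "f -` (A \<inter> padic_ball k (f x)) \<inter> S = (f -` A \<inter> S) \<inter> (f -` padic_ball k (f x) \<inter> S)" by auto
    also have "\<dots> = A \<inter> padic_ball k x"
      unfolding inv using sphere_transitive_vimage_ball[OF compat tr] that by (simp add: S_def)
    finally show ?thesis
      using pres[of "A \<inter> padic_ball k (f x)"] A_borel AS by (simp add: padic_cyl_borel le_infI1)
  qed
  have const: "emeasure U (A \<inter> padic_ball k x) = emeasure U (A \<inter> padic_ball k z)"
    if "x \<in> S" "z \<in> S" "r < k" for x z k
  proof -
    have iter: "emeasure U (A \<inter> padic_ball k ((f ^^ j) x)) = emeasure U (A \<inter> padic_ball k x)" for j
    proof (induction j)
      case (Suc j)
      then show ?case using step[OF funpow_mem[OF maps that(1), of j] that(3)] by simp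
    qed simp
    have "\<exists>j. padic_residue k ((f ^^ j) x) = padic_residue k z"
      using tr that(1,2) by (simp add: sphere_transitive_def S_def)
    then obtain j where "padic_residue k ((f ^^ j) x) = padic_residue k z" by (rule exE)
    then show ?thesis using iter[of j] by (simp only:)
  qed
  \<comment> \<open>The balls of one level partition the sphere, so a set meeting each of them in
    measure \<open>t\<close> has measure \<open>t\<close> times their number.\<close>
  have count: "emeasure U B = of_nat (card (padic_residue k ` S)) * t"
    if B: "B \<in> sets borel" "B \<subseteq> S" and t: "\<And>z. z \<in> S \<Longrightarrow> emeasure U (B \<inter> padic_ball k z) = t" for B k t
  proof -
    have "padic_residue k ` S \<subseteq> {0..<int CARD('p) ^ k}" by auto
    then have fin: "finite (padic_residue k ` S)" by (rule finite_subset) simp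
    have "B = (\<Union>c\<in>padic_residue k ` S. B \<inter> padic_cyl k c)" using B(2) by (auto simp: padic_cyl_def)
    then have "emeasure U B = emeasure U (\<Union>c\<in>padic_residue k ` S. B \<inter> padic_cyl k c)" by (rule arg_cong)
    also have "\<dots> = (\<Sum>c\<in>padic_residue k ` S. emeasure U (B \<inter> padic_cyl k c))"
    proof (rule sum_emeasure[symmetric, OF _ _ fin])
      show "(\<lambda>c. B \<inter> padic_cyl k c) ` padic_residue k ` S \<subseteq> sets U"
        using B(1) padic_cyl_borel by (auto simp: sets_U)
      show "disjoint_family_on (\<lambda>c. B \<inter> padic_cyl k c) (padic_residue k ` S)"
        by (auto simp: disjoint_family_on_def padic_cyl_def)
    qed
    also have "\<dots> = (\<Sum>c\<in>padic_residue k ` S. t)"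
      using t by (intro sum.cong) auto
    finally show ?thesis by simp
  qed
  show "emeasure (sphere_measure y r) A = 0 \<or> emeasure (sphere_measure y r) A = 1"
  proof (rule disjCI)
    assume "emeasure (sphere_measure y r) A \<noteq> 1"
    show "emeasure (sphere_measure y r) A = 0"
    proof (rule ccontr)
      assume "emeasure (sphere_measure y r) A \<noteq> 0"
      then have A0: "emeasure U A \<noteq> 0" using \<nu>[OF A_borel AS] by (simp add: \<nu>_def)
      have U_S: "emeasure U S = 1" unfolding U_def S_def by (rule emeasure_uniform_sphere_self)
      have S_borel: "S \<in> sets borel" by (simp add: S_def padic_sphere_borel)
      have "emeasure U A \<le> emeasure U S" using AS S_borel by (intro emeasure_mono) (simp_all add: sets_U)
      then have A_fin: "emeasure U A \<noteq> \<top>" using U_S by (auto simp: top_unique)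
      \<comment> \<open>Conditioning on \<open>A\<close>: the equality \<open>U = N\<close>
        expresses that \<open>A\<close> is independent of every Borel set.\<close>
      define N where "N = uniform_measure U A"
      have N: "emeasure N B = emeasure U (A \<inter> B) / emeasure U A" if "B \<in> sets borel" for B
        unfolding N_def using that A_borel by (intro emeasure_uniform_measure) (simp_all add: sets_U)
      have self: "emeasure U A / emeasure U A = 1"
        using A0 A_fin by (simp add: ennreal_divide_self less_top)
      have "U = N"
        unfolding U_def S_def
      proof (rule measure_eq_uniform_sphereI)
        show "sets N = sets borel" by (simp add: N_def sets_U)
        show "emeasure N UNIV = 1" using N[of UNIV] self by simp
        fix B :: "'p padic_int set" assume B: "B \<in> sets borel"
        have "A \<inter> (B \<inter> S) = A \<inter> B" using AS by auto
        then show "emeasure N B = emeasure N (B \<inter> padic_sphere y r)"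
          using N[OF B] N[OF sets.Int[OF B S_borel]] by (simp add: S_def)
      next
        fix k and z :: "'p padic_int"
        assume k: "r < k" and "z \<in> padic_sphere y r"
        then have z: "z \<in> S" by (simp add: S_def)
        define m where "m = (of_nat (card (padic_residue k ` S)) :: ennreal)"
        define s where "s = emeasure U (padic_ball k z)"
        define t where "t = emeasure U (A \<inter> padic_ball k z)"
        have At: "emeasure U A = m * t"
          unfolding m_def t_def by (rule count[OF A_borel AS const[OF _ z k]])
        have "emeasure U (S \<inter> padic_ball k w) = s" if "w \<in> S" for w
          using emeasure_uniform_sphere_ball[of w y r k] emeasure_uniform_sphere_ball[of z y r k] z k that
            padic_ball_subset_sphere[of w y r k]
          by (simp add: S_def U_def s_def Int_absorb1)
        then have "emeasure U S = m * s"
          unfolding m_def by (rule count[OF S_borel order_refl])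
        then have ms: "m * s = 1" using U_S by simp
        have "t = (m * s) * t" by (simp add: ms)
        also have "\<dots> = s * emeasure U A" by (simp add: At mult_ac)
        finally have "t / emeasure U A = s"
          using A0 A_fin by (simp add: ennreal_mult_divide_eq less_top)
        then show "emeasure N (padic_ball k z) = emeasure (uniform_measure padic_haar (padic_sphere y r)) (padic_ball k z)"
          using N[of "padic_ball k z"] by (simp add: padic_cyl_borel t_def s_def U_def S_def)
      qed
      \<comment> \<open>Independence of \<open>A\<close> from itself forces measure 1.\<close>
      then have "emeasure U A = emeasure N A" by (rule arg_cong)
      also have "\<dots> = emeasure U A / emeasure U A" by (simp only: N[OF A_borel] Int_absorb)
      also have "\<dots> = 1" by (rule self)
      finally have "emeasure (sphere_measure y r) A = 1" by (simp only: \<nu>[OF A_borel AS] flip: \<nu>_def)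
      then show False using \<open>emeasure (sphere_measure y r) A \<noteq> 1\<close> by (rule notE[rotated])
    qed
  qed
qed

lemma ergodic_on_sphere_iff_transitive:
  assumes "compatible f"
  shows "ergodic_on_sphere f y r \<longleftrightarrow> sphere_transitive f y r"
proof
  assume "ergodic_on_sphere f y r"
  then show "sphere_transitive f y r" by (rule ergodic_on_sphere_imp_transitive[OF assms])
next
  assume tr: "sphere_transitive f y r"
  then have "f ` padic_sphere y r \<subseteq> padic_sphere y r" by (simp add: sphere_transitive_def)
  then show "ergodic_on_sphere f y r"
    unfolding ergodic_on_sphere_def
    using sphere_transitive_imp_preserves_measure[OF assms tr] sphere_transitive_imp_ergodic_wrt[OF assms tr]
    by (intro conjI)
qed

section \<open>Passage from the sphere to the units, and the criterion\<close>

lemma mem_padic_sphere_iff_unit: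
  "x \<in> padic_sphere y r \<longleftrightarrow> (\<exists>u. \<not> \<pi> dvd u \<and> x = y + \<pi> ^ r * u)"
proof -
  have "x \<in> padic_sphere y r \<longleftrightarrow> \<pi> ^ r dvd x - y \<and> \<not> \<pi> ^ Suc r dvd x - y"
    by (simp only: mem_padic_sphere_iff padic_residue_eq_iff_dvd)
  also have "\<dots> \<longleftrightarrow> (\<exists>u. \<not> \<pi> dvd u \<and> x = y + \<pi> ^ r * u)"
  proof
    assume *: "\<pi> ^ r dvd x - y \<and> \<not> \<pi> ^ Suc r dvd x - y"
    then obtain u where u: "x - y = \<pi> ^ r * u" by (auto elim: dvdE)
    then have "\<not> \<pi> dvd u"
      using * padic_p_power_mult_dvd_mult_iff[of r \<pi> u] unfolding power_Suc2 by simp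
    moreover have "x = y + \<pi> ^ r * u" using u by (simp add: algebra_simps)
    ultimately show "\<exists>u. \<not> \<pi> dvd u \<and> x = y + \<pi> ^ r * u" by blast
  next
    assume "\<exists>u. \<not> \<pi> dvd u \<and> x = y + \<pi> ^ r * u"
    then obtain u where "\<not> \<pi> dvd u" "x - y = \<pi> ^ r * u" by auto
    then show "\<pi> ^ r dvd x - y \<and> \<not> \<pi> ^ Suc r dvd x - y"
      using padic_p_power_mult_dvd_mult_iff[of r \<pi> u] unfolding power_Suc2 by simp
  qed
  finally show ?thesis .
qed

text \<open>The coordinate u with x = y + p^r u conjugates \<open>f\<close> to
  \<open>\<phi>\<close>; precision k for units corresponds to precision r + k on the sphere.\<close>

lemma sphere_transitive_iff_unit_transitive:
  fixes f :: "'p::prime_card padic_int \<Rightarrow> 'p padic_int"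
  assumes \<phi>: "\<And>u. f (y + \<pi> ^ r * u) = y + \<pi> ^ r * \<phi> u"
  shows "sphere_transitive f y r \<longleftrightarrow> unit_transitive \<phi>"
proof -
  have sphere: "y + \<pi> ^ r * u \<in> padic_sphere y r \<longleftrightarrow> \<not> \<pi> dvd u" for u
    unfolding mem_padic_sphere_iff_unit by auto
  have iter: "(f ^^ j) (y + \<pi> ^ r * u) = y + \<pi> ^ r * (\<phi> ^^ j) u" for j u
    by (induction j) (simp_all add: \<phi>)
  have res: "padic_residue k (y + \<pi> ^ r * a) = padic_residue k (y + \<pi> ^ r * b) \<longleftrightarrow> \<pi> ^ k dvd \<pi> ^ r * (a - b)" for a b k
    unfolding padic_residue_eq_iff_dvd by (simp add: algebra_simps)
  have maps: "f ` padic_sphere y r \<subseteq> padic_sphere y r \<longleftrightarrow> (\<forall>u. \<not> \<pi> dvd u \<longrightarrow> \<not> \<pi> dvd \<phi> u)"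
  proof
    assume sub: "f ` padic_sphere y r \<subseteq> padic_sphere y r"
    show "\<forall>u. \<not> \<pi> dvd u \<longrightarrow> \<not> \<pi> dvd \<phi> u"
    proof (intro allI impI)
      fix u :: "'p padic_int" assume "\<not> \<pi> dvd u"
      then have "f (y + \<pi> ^ r * u) \<in> padic_sphere y r" by (intro subsetD[OF sub imageI]) (simp only: sphere not_False_eq_True)
      then show "\<not> \<pi> dvd \<phi> u" unfolding \<phi> sphere .
    qed
  next
    assume units: "\<forall>u. \<not> \<pi> dvd u \<longrightarrow> \<not> \<pi> dvd \<phi> u"
    show "f ` padic_sphere y r \<subseteq> padic_sphere y r"
    proof (rule image_subsetI)
      fix x assume "x \<in> padic_sphere y r"
      then obtain u where "\<not> \<pi> dvd u" "x = y + \<pi> ^ r * u" unfolding mem_padic_sphere_iff_unit by (elim exE conjE)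
      then show "f x \<in> padic_sphere y r" using units by (simp add: \<phi> sphere)
    qed
  qed
  have orbits: "(\<forall>x\<in>padic_sphere y r. \<forall>z\<in>padic_sphere y r. \<forall>k. \<exists>j. padic_residue k ((f ^^ j) x) = padic_residue k z) \<longleftrightarrow>
      (\<forall>u v k. \<not> \<pi> dvd u \<longrightarrow> \<not> \<pi> dvd v \<longrightarrow> (\<exists>j. \<pi> ^ k dvd (\<phi> ^^ j) u - v))" (is "?L \<longleftrightarrow> ?R")
  proof
    assume L: ?L
    show ?R
    proof (intro allI impI)
      fix u v :: "'p padic_int" and k
      assume "\<not> \<pi> dvd u" "\<not> \<pi> dvd v"
      then have "\<exists>j. padic_residue (r + k) ((f ^^ j) (y + \<pi> ^ r * u)) = padic_residue (r + k) (y + \<pi> ^ r * v)"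
        by (intro L[rule_format]) (simp_all only: sphere not_False_eq_True)
      then show "\<exists>j. \<pi> ^ k dvd (\<phi> ^^ j) u - v"
        by (simp only: iter res power_add padic_p_power_mult_dvd_mult_iff)
    qed
  next
    assume R: ?R
    show ?L
    proof (intro ballI allI)
      fix x z k
      assume "x \<in> padic_sphere y r" "z \<in> padic_sphere y r"
      then obtain u v where uv: "\<not> \<pi> dvd u" "x = y + \<pi> ^ r * u" "\<not> \<pi> dvd v" "z = y + \<pi> ^ r * v"
        unfolding mem_padic_sphere_iff_unit by (elim exE conjE)
      obtain j where "\<pi> ^ k dvd (\<phi> ^^ j) u - v" using R uv(1,3) by blast
      then have "\<pi> ^ k dvd \<pi> ^ r * ((\<phi> ^^ j) u - v)" by (rule dvd_mult)
      then have "padic_residue k ((f ^^ j) x) = padic_residue k z"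
        unfolding uv(2,4) iter res .
      then show "\<exists>j. padic_residue k ((f ^^ j) x) = padic_residue k z" by (rule exI)
    qed
  qed
  show ?thesis
    unfolding sphere_transitive_def unit_transitive_def maps orbits ..
qed

theorem mainTheorem5:
  fixes n :: nat
  shows "\<exists>R :: nat. \<forall>f :: 'p::prime_card padic_int \<Rightarrow> 'p padic_int.
    f \<in> class_A \<and> (\<lambda>x. of_nat CARD('p) ^ n * f x) \<in> class_B \<longrightarrow>
    (\<forall>y. \<forall>r\<ge>R. ergodic_on_sphere f y r \<longleftrightarrow>
      (odd CARD('p) \<and> padic_cong (f y) y (r + 1) \<and> generates_units_mod_p2 (padic_deriv f y)) \<or>
      (CARD('p) = 2 \<and> padic_cong (f y) y (r + 1) \<and> \<not> padic_cong (f y) y (r + 2) \<and>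
        padic_cong (padic_deriv f y) 1 2))"
\<comment> \<open>Of the r digits n are lost to the factor p^n; three must remain, since
  \<open>unit_transitive_only_if_two\<close> uses the slope modulo p^3.\<close>
proof (intro exI[of _ "n + 3"] allI impI)
  fix f :: "'p padic_int \<Rightarrow> 'p padic_int" and y :: "'p padic_int" and r :: nat
  assume f: "f \<in> class_A \<and> (\<lambda>x. of_nat CARD('p) ^ n * f x) \<in> class_B" and r: "n + 3 \<le> r"
  define D where "D = padic_deriv f y"
  have compat: "compatible f" using f by (simp add: class_A_def)
  have diff_dvd: "u - v dvd f u - f v" for u v using compat by (simp add: compatible_iff_dvd)
  let ?odd = "odd CARD('p) \<and> padic_cong (f y) y (r + 1) \<and> generates_units_mod_p2 D"
  let ?two = "CARD('p) = 2 \<and> padic_cong (f y) y (r + 1) \<and> \<not> padic_cong (f y) y (r + 2) \<and> padic_cong D 1 2"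
  have "sphere_transitive f y r \<longleftrightarrow> ?odd \<or> ?two"
  proof (cases "\<pi> ^ r dvd f y - y")
    \<comment> \<open>Both sides fail: if the sphere were mapped into itself, compatibility would
      bring \<open>f y\<close> within p^r of \<open>y\<close>, and either alternative asks for even
      more.\<close>
    case False
    have "\<not> sphere_transitive f y r"
    proof
      assume "sphere_transitive f y r"
      then have "f (y + \<pi> ^ r) \<in> padic_sphere y r"
        using padic_sphere_nonempty[of y r] by (auto simp: sphere_transitive_def)
      then have 1: "\<pi> ^ r dvd f (y + \<pi> ^ r) - y"
        by (simp only: mem_padic_sphere_iff padic_residue_eq_iff_dvd)
      have "\<pi> ^ r dvd f (y + \<pi> ^ r) - f y" using diff_dvd[of "y + \<pi> ^ r" y] by simp
      from dvd_diff[OF 1 this] False show False by simp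
    qed
    moreover have "\<not> padic_cong (f y) y (r + 1)"
      using False unfolding padic_cong_def by (auto dest: dvd_mult_right)
    ultimately show ?thesis by simp
  next
    case True
    have "\<exists>w. f (y + \<pi> ^ r * u) = y + \<pi> ^ r * w" for u
    proof -
      have "y + \<pi> ^ r * u - y dvd f (y + \<pi> ^ r * u) - f y" by (rule diff_dvd)
      then have "\<pi> ^ r dvd f (y + \<pi> ^ r * u) - f y" by (auto dest: dvd_mult_left)
      from dvd_add[OF this True] obtain w where "f (y + \<pi> ^ r * u) - y = \<pi> ^ r * w" by (auto elim: dvdE)
      then show ?thesis by (intro exI[of _ w]) (simp add: algebra_simps)
    qed
    then obtain \<phi> where \<phi>: "\<And>u. f (y + \<pi> ^ r * u) = y + \<pi> ^ r * \<phi> u" by metis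
    have slope3: "has_slope_mod (\<pi> ^ 3) \<phi> D"
      unfolding has_slope_mod_def
    proof (intro allI)
      fix u v
      have "\<pi> ^ (r - n) * ((y + \<pi> ^ r * v) - (y + \<pi> ^ r * u)) dvd
          f (y + \<pi> ^ r * v) - f (y + \<pi> ^ r * u) - D * ((y + \<pi> ^ r * v) - (y + \<pi> ^ r * u))"
        unfolding D_def using f r by (intro padic_deriv_difference_bound compat) simp_all
      then have "\<pi> ^ r * (\<pi> ^ (r - n) * (v - u)) dvd \<pi> ^ r * (\<phi> v - \<phi> u - D * (v - u))"
        unfolding \<phi> by (simp add: algebra_simps)
      then have "\<pi> ^ (r - n) * (v - u) dvd \<phi> v - \<phi> u - D * (v - u)"
        by (simp only: padic_p_power_mult_dvd_mult_iff)
      moreover have "\<pi> ^ 3 * (v - u) dvd \<pi> ^ (r - n) * (v - u)"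
        using r by (intro mult_dvd_mono le_imp_power_dvd) simp_all
      ultimately show "\<pi> ^ 3 * (v - u) dvd \<phi> v - \<phi> u - D * (v - u)" by (rule dvd_trans[rotated])
    qed
    then have slope2: "has_slope_mod (\<pi> ^ 2) \<phi> D"
      by (rule has_slope_mod_dvd) (simp add: le_imp_power_dvd)
    \<comment> \<open>The value at 0, which is not a unit, records \<open>f y - y\<close> at scale
      p^r; this is how the congruences on \<open>f y\<close> arise.\<close>
    have "f y - y = \<pi> ^ r * \<phi> 0" using \<phi>[of 0] by simp
    then have cong: "padic_cong (f y) y (r + k) \<longleftrightarrow> \<pi> ^ k dvd \<phi> 0" for k
      by (simp only: padic_cong_def power_add padic_p_power_mult_dvd_mult_iff)
    have "unit_transitive \<phi> \<longleftrightarrow> ?odd \<or> ?two"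
    proof (cases "odd CARD('p)")
      case True
      then have "CARD('p) \<noteq> 2" by auto
      with True show ?thesis
        using unit_transitive_iff_odd[OF True slope2] cong[of 1] by simp
    next
      case False
      then have two: "CARD('p) = 2"
        using primes_dvd_imp_eq[OF two_is_prime_nat prime_card[where 'a = 'p]] by simp
      have "unit_transitive \<phi> \<longleftrightarrow> \<pi> dvd \<phi> 0 \<and> \<not> \<pi> ^ 2 dvd \<phi> 0 \<and> \<pi> ^ 2 dvd D - 1"
        using unit_transitive_if_two[OF two slope2] unit_transitive_only_if_two[OF two slope3] by blast
      with False two show ?thesis
        using cong[of 1] cong[of 2] by (simp only: padic_cong_def[of D] power_one_right) blast
    qed
    then show ?thesis using sphere_transitive_iff_unit_transitive[of f y r \<phi>, OF \<phi>] by simp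
  qed
  then show "ergodic_on_sphere f y r \<longleftrightarrow>
      (odd CARD('p) \<and> padic_cong (f y) y (r + 1) \<and> generates_units_mod_p2 (padic_deriv f y)) \<or>
      (CARD('p) = 2 \<and> padic_cong (f y) y (r + 1) \<and> \<not> padic_cong (f y) y (r + 2) \<and>
        padic_cong (padic_deriv f y) 1 2)"
    unfolding D_def using ergodic_on_sphere_iff_transitive[OF compat] by simp
qed

end
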